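(* Let $K$ be a field of characteristic zero, $R=K[X_1,\ldots,X_n]$ with its standard grading, and $A_n(K)$ the $n$-th Weyl algebra over $K$, graded by $\deg X_i=1$, $\deg\partial_i=-1$. Let $\mathcal{T}$ be a graded Lyubeznik functor on the category ${}^*\mathrm{Mod}(R)$ of graded $R$-modules. Then $\mathcal{T}(R)$ is a strongly generalized Eulerian $A_n(K)$-module.
   Context: Let $\mathcal{E}_n=\sum_{i=1}^n X_i\partial_i$, and write $|w|=\deg w$ for homogeneous $w$. A graded left $A_n(K)$-module $W$ is strongly generalized Eulerian if there is an integer $a>0$, independent of $w$, with $(\mathcal{E}_n-|w|)^a w=0$ for all homogeneous $w\in W$. A homogeneous closed subset of $\operatorname{Spec}(R)$ is a set $V(f_1,\ldots,f_s)$ with all $f_i$ homogeneous polynomials. A homogeneous locally closed subset is $Y=Y''\setminus Y'$ with $Y'\subset Y''$ homogeneous closed subsets. $H^i_Y(-)$ denotes local cohomology with support in $Y$: for $Y=V(I)$ closed it is $H^i_I(-)$, and for $Y=Y''\setminus Y'$ locally closed it is $H^i(\Gamma_{Y''}(\mathbb{I}^\bullet)/\Gamma_{Y'}(\mathbb{I}^\bullet))$, with $\mathbb{I}^\bullet$ a graded injective resolution of the module. There is an exact sequence of functors on ${}^*\mathrm{Mod}(R)$ $$\cdots\to H^i_{Y'}(-)\to H^i_{Y''}(-)\to H^i_Y(-)\to H^{i+1}_{Y'}(-)\to\cdots.\qquad(\ast)$$ A graded Lyubeznik functor is a composite $\mathcal{T}=\mathcal{T}_1\circ\mathcal{T}_2\circ\cdots\circ\mathcal{T}_m$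 where each $\mathcal{T}_j$ is either $H^i_{Y_j}(-)$ for some homogeneous locally closed subset $Y_j$, or the kernel, image or cokernel of any arrow appearing in $(\ast)$ with $Y=Y_j$, $Y'=Y_j'$, $Y''=Y_j''$, where $Y_j=Y_j''\setminus Y_j'$ and $Y_j'\subset Y_j''$ are homogeneous closed subsets. When applied to a graded left $A_n(K)$-module, all these functors and arrows carry natural graded left $A_n(K)$-module structures (computed e.g. by using a graded injective resolution over $A_n(K)$, which is also one over $R$). Here $R$ is a graded left $A_n(K)$-module in the usual way. *)

theory Defs
  imports "HOL-Library.Poly_Mapping" "HOL-Algebra.Module" "HOL-Algebra.Ideal_Product"
begin

section \<open>Polynomials in the variables \<open>X i\<close>, \<open>i :: 'n\<close>, over the field \<open>'k\<close>\<close>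

text \<open>
  The variables are indexed by a finite type \<open>'n\<close>, so \<open>n = CARD('n)\<close>. A monomial is an exponent
  vector \<open>'n \<Rightarrow>\<^sub>0 nat\<close>, and \<open>*\<close> on the type below is the multiplication of polynomials.
\<close>

type_synonym ('n, 'k) mpoly = "('n \<Rightarrow>\<^sub>0 nat) \<Rightarrow>\<^sub>0 'k"

definition Const :: "'k \<Rightarrow> ('n, 'k::field_char_0) mpoly" where
  "Const c = Poly_Mapping.single 0 c"

definition Var :: "'n \<Rightarrow> ('n, 'k::field_char_0) mpoly" where
  "Var i = Poly_Mapping.single (Poly_Mapping.single i 1) 1"

text \<open>The exponent of \<open>X i\<close> is decreased by truncated subtraction; where truncation would matter,
  the coefficient is zero.\<close>

definition pdiff :: "'n \<Rightarrow> ('n, 'k::field_char_0) mpoly \<Rightarrow> ('n, 'k) mpoly" where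
  "pdiff i p = (\<Sum>m\<in>Poly_Mapping.keys p. Poly_Mapping.single (m - Poly_Mapping.single i 1)
                               (of_nat (Poly_Mapping.lookup m i) * Poly_Mapping.lookup p m))"

definition homogeneous_polys :: "int \<Rightarrow> ('n::finite, 'k::field_char_0) mpoly set" where
  "homogeneous_polys e = {p. \<forall>m\<in>Poly_Mapping.keys p. int (\<Sum>i\<in>UNIV. Poly_Mapping.lookup m i) = e}"

definition poly_ring :: "('n, 'k::field_char_0) mpoly ring" where
  "poly_ring = \<lparr>carrier = UNIV, mult = (*), one = 1, zero = 0, add = (+)\<rparr>"


section \<open>The Weyl algebra\<close>

text \<open>
  As \<open>'k\<close> has characteristic zero, the Weyl algebra is the ring of differential operators on the
  polynomial ring: the subalgebra of the algebra of additive endomorphisms generated by the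
  constants, the multiplications by the variables and the partial derivatives.
\<close>

type_synonym ('n, 'k) operator = "('n, 'k) mpoly \<Rightarrow> ('n, 'k) mpoly"

definition mult_op :: "('n, 'k::field_char_0) mpoly \<Rightarrow> ('n, 'k) operator" where
  "mult_op r = (\<lambda>p. r * p)"

inductive_set weyl_carrier :: "('n, 'k::field_char_0) operator set" where
  Const: "mult_op (Const c) \<in> weyl_carrier"
| X: "mult_op (Var i) \<in> weyl_carrier"
| D: "pdiff i \<in> weyl_carrier"
| add: "a \<in> weyl_carrier \<Longrightarrow> b \<in> weyl_carrier \<Longrightarrow> (\<lambda>p. a p + b p) \<in> weyl_carrier"
| mult: "a \<in> weyl_carrier \<Longrightarrow> b \<in> weyl_carrier \<Longrightarrow> a \<circ> b \<in> weyl_carrier"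

definition weyl :: "('n, 'k::field_char_0) operator ring" where
  "weyl = \<lparr>carrier = weyl_carrier, mult = (\<circ>), one = id, zero = (\<lambda>_. 0),
           add = (\<lambda>a b p. a p + b p)\<rparr>"

text \<open>\<open>weyl_homogeneous e a\<close>: the operator \<open>a\<close> lies in the component of degree \<open>e\<close> for the grading
  with \<open>deg X\<^sub>i = 1\<close> and \<open>deg \<partial>\<^sub>i = -1\<close>.\<close>

inductive weyl_homogeneous :: "int \<Rightarrow> ('n, 'k::field_char_0) operator \<Rightarrow> bool" where
  Const: "weyl_homogeneous 0 (mult_op (Const c))"
| X: "weyl_homogeneous 1 (mult_op (Var i))"
| D: "weyl_homogeneous (- 1) (pdiff i)"
| add: "weyl_homogeneous e a \<Longrightarrow> weyl_homogeneous e b \<Longrightarrow> weyl_homogeneous e (\<lambda>p. a p + b p)"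
| mult: "weyl_homogeneous e a \<Longrightarrow> weyl_homogeneous e' b \<Longrightarrow> weyl_homogeneous (e + e') (a \<circ> b)"

definition euler :: "('n::finite, 'k::field_char_0) operator" where
  "euler = (\<Oplus>\<^bsub>weyl\<^esub>i\<in>UNIV. mult_op (Var i) \<otimes>\<^bsub>weyl\<^esub> pdiff i)"


section \<open>Graded left modules over the Weyl algebra\<close>

text \<open>The fields \<open>mult\<close> and \<open>one\<close> inherited from rings are not used (as for \<open>module\<close> in
  \<open>HOL-Algebra\<close>); \<open>hcomp M e\<close> is the component of degree \<open>e\<close>.\<close>

record ('a, 'm) gmodule = "('a, 'm) module" +
  hcomp :: "int \<Rightarrow> 'm set"

type_synonym ('n, 'k, 'm) weyl_gmodule = "(('n, 'k) operator, 'm) gmodule"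

locale left_module = A: ring A + M: abelian_group M
  for A :: "('a, 'b) ring_scheme" and M :: "('a, 'm, 'c) module_scheme" +
  assumes smult_closed: "\<lbrakk>a \<in> carrier A; x \<in> carrier M\<rbrakk> \<Longrightarrow> a \<odot>\<^bsub>M\<^esub> x \<in> carrier M"
    and smult_l_distr: "\<lbrakk>a \<in> carrier A; b \<in> carrier A; x \<in> carrier M\<rbrakk> \<Longrightarrow>
          (a \<oplus>\<^bsub>A\<^esub> b) \<odot>\<^bsub>M\<^esub> x = a \<odot>\<^bsub>M\<^esub> x \<oplus>\<^bsub>M\<^esub> b \<odot>\<^bsub>M\<^esub> x"
    and smult_r_distr: "\<lbrakk>a \<in> carrier A; x \<in> carrier M; y \<in> carrier M\<rbrakk> \<Longrightarrow>
          a \<odot>\<^bsub>M\<^esub> (x \<oplus>\<^bsub>M\<^esub> y) = a \<odot>\<^bsub>M\<^esub> x \<oplus>\<^bsub>M\<^esub> a \<odot>\<^bsub>M\<^esub> y"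
    and smult_assoc: "\<lbrakk>a \<in> carrier A; b \<in> carrier A; x \<in> carrier M\<rbrakk> \<Longrightarrow>
          (a \<otimes>\<^bsub>A\<^esub> b) \<odot>\<^bsub>M\<^esub> x = a \<odot>\<^bsub>M\<^esub> (b \<odot>\<^bsub>M\<^esub> x)"
    and smult_one: "x \<in> carrier M \<Longrightarrow> \<one>\<^bsub>A\<^esub> \<odot>\<^bsub>M\<^esub> x = x"

locale graded_weyl_module = left_module weyl M
  for M :: "('n::finite, 'k::field_char_0, 'm) weyl_gmodule" +
  assumes hcomp_subgroup: "additive_subgroup (hcomp M e) M"
    and hcomp_smult: "\<lbrakk>weyl_homogeneous e a; x \<in> hcomp M e'\<rbrakk> \<Longrightarrow> a \<odot>\<^bsub>M\<^esub> x \<in> hcomp M (e + e')"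
    and hcomp_direct_sum: "x \<in> carrier M \<Longrightarrow>
          \<exists>!c. (\<forall>e. c e \<in> hcomp M e) \<and> finite {e. c e \<noteq> \<zero>\<^bsub>M\<^esub>} \<and>
               x = (\<Oplus>\<^bsub>M\<^esub>e\<in>{e. c e \<noteq> \<zero>\<^bsub>M\<^esub>}. c e)"

definition gmodule_hom ::
    "('n, 'k::field_char_0, 'v) weyl_gmodule \<Rightarrow> ('n, 'k, 'w) weyl_gmodule \<Rightarrow> ('v \<Rightarrow> 'w) set" where
  "gmodule_hom M N = {f. f \<in> carrier M \<rightarrow> carrier N \<and>
     (\<forall>x\<in>carrier M. \<forall>y\<in>carrier M. f (x \<oplus>\<^bsub>M\<^esub> y) = f x \<oplus>\<^bsub>N\<^esub> f y) \<and>
     (\<forall>a\<in>carrier weyl. \<forall>x\<in>carrier M. f (a \<odot>\<^bsub>M\<^esub> x) = a \<odot>\<^bsub>N\<^esub> f x) \<and>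
     (\<forall>e. f ` hcomp M e \<subseteq> hcomp N e)}"

text \<open>Transport of structure: neither side is required to be a graded module, but the one is if
  the other is.\<close>

definition gmodule_iso ::
    "('n, 'k::field_char_0, 'v) weyl_gmodule \<Rightarrow> ('n, 'k, 'w) weyl_gmodule \<Rightarrow> bool" where
  "gmodule_iso M N \<longleftrightarrow> (\<exists>f\<in>gmodule_hom M N. bij_betw f (carrier M) (carrier N) \<and>
     f \<zero>\<^bsub>M\<^esub> = \<zero>\<^bsub>N\<^esub> \<and> (\<forall>e. f ` hcomp M e = hcomp N e))"

text \<open>The submodule of \<open>M\<close> with carrier \<open>S\<close>, the quotient of \<open>M\<close> by the submodule \<open>S\<close> (whose
  elements are the cosets of \<open>S\<close>), and the map induced on cosets by a map \<open>f\<close> into \<open>M\<close>.\<close>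

definition gsub :: "('a, 'm) gmodule \<Rightarrow> 'm set \<Rightarrow> ('a, 'm) gmodule" where
  "gsub M S = M\<lparr>carrier := S, hcomp := (\<lambda>e. hcomp M e \<inter> S)\<rparr>"

definition gquot :: "('a, 'm) gmodule \<Rightarrow> 'm set \<Rightarrow> ('a, 'm set) gmodule" where
  "gquot M S = \<lparr>carrier = a_rcosets\<^bsub>M\<^esub> S, mult = undefined, one = undefined,
     zero = S, add = set_add M,
     smult = (\<lambda>a C. \<Union>x\<in>C. S +>\<^bsub>M\<^esub> (a \<odot>\<^bsub>M\<^esub> x)),
     hcomp = (\<lambda>e. (\<lambda>x. S +>\<^bsub>M\<^esub> x) ` hcomp M e)\<rparr>"

definition gquot_map :: "('a, 'm) gmodule \<Rightarrow> 'm set \<Rightarrow> ('v \<Rightarrow> 'm) \<Rightarrow> 'v set \<Rightarrow> 'm set" where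
  "gquot_map M S f C = (\<Union>x\<in>C. S +>\<^bsub>M\<^esub> f x)"

definition poly_gmodule :: "('n::finite, 'k::field_char_0, ('n, 'k) mpoly) weyl_gmodule" where
  "poly_gmodule = \<lparr>carrier = UNIV, mult = (*), one = 1, zero = 0, add = (+),
     smult = (\<lambda>a p. a p), hcomp = homogeneous_polys\<rparr>"

definition strongly_generalized_Eulerian ::
    "('n::finite, 'k::field_char_0, 'm) weyl_gmodule \<Rightarrow> bool" where
  "strongly_generalized_Eulerian W \<longleftrightarrow> graded_weyl_module W \<and>
     (\<exists>a::nat. a > 0 \<and> (\<forall>e::int. \<forall>w\<in>hcomp W e.
        ((euler \<ominus>\<^bsub>weyl\<^esub> [e] \<cdot>\<^bsub>weyl\<^esub> \<one>\<^bsub>weyl\<^esub>) [^]\<^bsub>weyl\<^esub> a) \<odot>\<^bsub>W\<^esub> w = \<zero>\<^bsub>W\<^esub>))"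


section \<open>Graded injective resolutions\<close>

text \<open>
  HOL cannot quantify over all types inside a definition, so injectivity of \<open>I\<close> is tested on the
  graded modules whose elements are drawn from the type \<open>'u\<close> of the elements of \<open>I\<close>. By the graded
  form of Baer's criterion this is injectivity in the category of all graded modules as soon as
  \<open>'u\<close> has at least the cardinality of the Weyl algebra. That is the case whenever the polynomial
  ring embeds into a module with elements in \<open>'u\<close>, since the two have the same cardinality; and
  over \<open>'u = ('n, 'k) mpoly set\<close>, for instance, every graded module with elements
  in \<open>'u\<close> has an injective resolution by such modules.
\<close>

definition graded_injective :: "('n::finite, 'k::field_char_0, 'u) weyl_gmodule \<Rightarrow> bool" where
  "graded_injective I \<longleftrightarrow> graded_weyl_module I \<and>
     (\<forall>(M :: ('n, 'k, 'u) weyl_gmodule) (N :: ('n, 'k, 'u) weyl_gmodule). \<forall>j\<in>gmodule_hom M N. \<forall>g\<in>gmodule_hom M I.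
        graded_weyl_module M \<longrightarrow> graded_weyl_module N \<longrightarrow> inj_on j (carrier M) \<longrightarrow>
        (\<exists>h\<in>gmodule_hom N I. \<forall>x\<in>carrier M. h (j x) = g x))"

definition graded_injective_resolution ::
    "('n::finite, 'k::field_char_0, 'v) weyl_gmodule \<Rightarrow> ('v \<Rightarrow> 'u) \<Rightarrow>
     (nat \<Rightarrow> ('n, 'k, 'u) weyl_gmodule) \<Rightarrow> (nat \<Rightarrow> 'u \<Rightarrow> 'u) \<Rightarrow> bool" where
  "graded_injective_resolution M \<epsilon> I d \<longleftrightarrow> graded_weyl_module M \<and>
     (\<forall>i. graded_injective (I i)) \<and>
     \<epsilon> \<in> gmodule_hom M (I 0) \<and> inj_on \<epsilon> (carrier M) \<and>
     (\<forall>i. d i \<in> gmodule_hom (I i) (I (Suc i))) \<and>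
     \<epsilon> ` carrier M = {x\<in>carrier (I 0). d 0 x = \<zero>\<^bsub>I 1\<^esub>} \<and>
     (\<forall>i. d i ` carrier (I i) = {x\<in>carrier (I (Suc i)). d (Suc i) x = \<zero>\<^bsub>I (Suc (Suc i))\<^esub>})"

definition boundaries :: "(nat \<Rightarrow> ('a, 'm) gmodule) \<Rightarrow> (nat \<Rightarrow> 'm \<Rightarrow> 'm) \<Rightarrow> nat \<Rightarrow> 'm set" where
  "boundaries C d i = (case i of 0 \<Rightarrow> {\<zero>\<^bsub>C 0\<^esub>} | Suc j \<Rightarrow> d j ` carrier (C j))"

definition cohomology ::
    "(nat \<Rightarrow> ('a, 'm) gmodule) \<Rightarrow> (nat \<Rightarrow> 'm \<Rightarrow> 'm) \<Rightarrow> nat \<Rightarrow> ('a, 'm set) gmodule" where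
  "cohomology C d i =
     gquot (gsub (C i) {x\<in>carrier (C i). d i x = \<zero>\<^bsub>C (Suc i)\<^esub>}) (boundaries C d i)"


section \<open>Supports\<close>

definition Spec :: "('n, 'k::field_char_0) mpoly set set" where
  "Spec = {P. primeideal P poly_ring}"

definition V :: "('n, 'k::field_char_0) mpoly set \<Rightarrow> ('n, 'k) mpoly set set" where
  "V F = {P\<in>Spec. F \<subseteq> P}"

definition homogeneous_presentation ::
    "('n::finite, 'k::field_char_0) mpoly set \<Rightarrow> ('n, 'k) mpoly set set \<Rightarrow> bool" where
  "homogeneous_presentation F Y \<longleftrightarrow> finite F \<and> F \<subseteq> (\<Union>e. homogeneous_polys e) \<and> Y = V F"

definition homogeneous_closed :: "('n::finite, 'k::field_char_0) mpoly set set \<Rightarrow> bool" where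
  "homogeneous_closed Y \<longleftrightarrow> (\<exists>F. homogeneous_presentation F Y)"

definition ideal_power :: "('n, 'k::field_char_0) mpoly set \<Rightarrow> nat \<Rightarrow> ('n, 'k) mpoly set" where
  "ideal_power J k = (ideal_prod poly_ring J ^^ k) (carrier poly_ring)"

text \<open>\<open>\<Gamma>\<^sub>J(M)\<close> for an ideal \<open>J\<close> of polynomials; these act on \<open>M\<close> as elements of the Weyl algebra.\<close>

definition torsion ::
    "('n, 'k::field_char_0) mpoly set \<Rightarrow> ('n, 'k, 'm) weyl_gmodule \<Rightarrow> 'm set" where
  "torsion J M = {x\<in>carrier M. \<exists>k. \<forall>r\<in>ideal_power J k. mult_op r \<odot>\<^bsub>M\<^esub> x = \<zero>\<^bsub>M\<^esub>}"

text \<open>\<open>\<Gamma>\<^sub>Y(M)\<close> is \<open>\<Gamma>\<^sub>J(M)\<close> for any ideal \<open>J\<close> with \<open>Y = V(J)\<close>. As \<open>\<Gamma>\<^sub>J(M)\<close> depends only on the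
  radical of \<open>J\<close>, all members of the union are equal.\<close>

definition sections_with_support ::
    "('n::finite, 'k::field_char_0) mpoly set set \<Rightarrow> ('n, 'k, 'm) weyl_gmodule \<Rightarrow> 'm set" where
  "sections_with_support Y M = (\<Union>F\<in>{F. homogeneous_presentation F Y}. torsion (Idl\<^bsub>poly_ring\<^esub> F) M)"


section \<open>Local cohomology, computed from a resolution \<open>(I, d)\<close>\<close>

definition \<Gamma> :: "('n::finite, 'k::field_char_0) mpoly set set \<Rightarrow>
    (nat \<Rightarrow> ('n, 'k, 'u) weyl_gmodule) \<Rightarrow> nat \<Rightarrow> ('n, 'k, 'u) weyl_gmodule" where
  "\<Gamma> Y I i = gsub (I i) (sections_with_support Y (I i))"

definition H_closed :: "('n::finite, 'k::field_char_0) mpoly set set \<Rightarrow>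
    (nat \<Rightarrow> ('n, 'k, 'u) weyl_gmodule) \<Rightarrow> (nat \<Rightarrow> 'u \<Rightarrow> 'u) \<Rightarrow> nat \<Rightarrow> ('n, 'k, 'u set) weyl_gmodule" where
  "H_closed Y I d = cohomology (\<Gamma> Y I) d"

text \<open>For \<open>Y' \<subseteq> Y''\<close>, the complex \<open>\<Gamma>\<^sub>Y\<^sub>''(I)/\<Gamma>\<^sub>Y\<^sub>'(I)\<close> and its differential.\<close>

definition \<Gamma>_quot :: "('n::finite, 'k::field_char_0) mpoly set set \<Rightarrow> ('n, 'k) mpoly set set \<Rightarrow>
    (nat \<Rightarrow> ('n, 'k, 'u) weyl_gmodule) \<Rightarrow> nat \<Rightarrow> ('n, 'k, 'u set) weyl_gmodule" where
  "\<Gamma>_quot Y'' Y' I i = gquot (\<Gamma> Y'' I i) (carrier (\<Gamma> Y' I i))"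

definition d_quot :: "('n::finite, 'k::field_char_0) mpoly set set \<Rightarrow> ('n, 'k) mpoly set set \<Rightarrow>
    (nat \<Rightarrow> ('n, 'k, 'u) weyl_gmodule) \<Rightarrow> (nat \<Rightarrow> 'u \<Rightarrow> 'u) \<Rightarrow> nat \<Rightarrow> 'u set \<Rightarrow> 'u set" where
  "d_quot Y'' Y' I d i = gquot_map (\<Gamma> Y'' I (Suc i)) (carrier (\<Gamma> Y' I (Suc i))) (d i)"

definition H_locally_closed :: "('n::finite, 'k::field_char_0) mpoly set set \<Rightarrow>
    ('n, 'k) mpoly set set \<Rightarrow> (nat \<Rightarrow> ('n, 'k, 'u) weyl_gmodule) \<Rightarrow> (nat \<Rightarrow> 'u \<Rightarrow> 'u) \<Rightarrow>
    nat \<Rightarrow> ('n, 'k, 'u set set) weyl_gmodule" where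
  "H_locally_closed Y'' Y' I d = cohomology (\<Gamma>_quot Y'' Y' I) (d_quot Y'' Y' I d)"

text \<open>
  The three kinds of arrows of the long exact sequence of
  \<open>0 \<rightarrow> \<Gamma>\<^sub>Y\<^sub>'(I) \<rightarrow> \<Gamma>\<^sub>Y\<^sub>''(I) \<rightarrow> \<Gamma>\<^sub>Y\<^sub>''(I)/\<Gamma>\<^sub>Y\<^sub>'(I) \<rightarrow> 0\<close>:
  \<open>H\<^sup>i\<^sub>Y\<^sub>' \<rightarrow> H\<^sup>i\<^sub>Y\<^sub>''\<close>, \<open>H\<^sup>i\<^sub>Y\<^sub>'' \<rightarrow> H\<^sup>i\<^sub>Y\<close> and the connecting map \<open>H\<^sup>i\<^sub>Y \<rightarrow> H\<^sup>i\<^sup>+\<^sup>1\<^sub>Y\<^sub>'\<close>, which sends the class of the coset of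
  \<open>x\<close> to the class of \<open>d x\<close>.
\<close>

definition arrow_incl :: "('n::finite, 'k::field_char_0) mpoly set set \<Rightarrow> ('n, 'k) mpoly set set \<Rightarrow>
    (nat \<Rightarrow> ('n, 'k, 'u) weyl_gmodule) \<Rightarrow> (nat \<Rightarrow> 'u \<Rightarrow> 'u) \<Rightarrow> nat \<Rightarrow> 'u set \<Rightarrow> 'u set" where
  "arrow_incl Y'' Y' I d i = gquot_map (\<Gamma> Y'' I i) (boundaries (\<Gamma> Y'' I) d i) id"

definition arrow_proj :: "('n::finite, 'k::field_char_0) mpoly set set \<Rightarrow> ('n, 'k) mpoly set set \<Rightarrow>
    (nat \<Rightarrow> ('n, 'k, 'u) weyl_gmodule) \<Rightarrow> (nat \<Rightarrow> 'u \<Rightarrow> 'u) \<Rightarrow> nat \<Rightarrow> 'u set \<Rightarrow> 'u set set" where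
  "arrow_proj Y'' Y' I d i =
     gquot_map (\<Gamma>_quot Y'' Y' I i) (boundaries (\<Gamma>_quot Y'' Y' I) (d_quot Y'' Y' I d) i)
       (\<lambda>x. carrier (\<Gamma> Y' I i) +>\<^bsub>\<Gamma> Y'' I i\<^esub> x)"

definition arrow_conn :: "('n::finite, 'k::field_char_0) mpoly set set \<Rightarrow> ('n, 'k) mpoly set set \<Rightarrow>
    (nat \<Rightarrow> ('n, 'k, 'u) weyl_gmodule) \<Rightarrow> (nat \<Rightarrow> 'u \<Rightarrow> 'u) \<Rightarrow> nat \<Rightarrow> 'u set set \<Rightarrow> 'u set" where
  "arrow_conn Y'' Y' I d i Z =
     (\<Union>z\<in>Z. gquot_map (\<Gamma> Y' I (Suc i)) (boundaries (\<Gamma> Y' I) d (Suc i)) (d i) z)"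


section \<open>Graded Lyubeznik functors\<close>

datatype part = Kernel | Image | Cokernel

datatype arrow = Incl | Proj | Conn

text \<open>The locally closed set \<open>Y = Y'' - Y'\<close> is given by \<open>Y''\<close> and \<open>Y'\<close>, in this order.\<close>

datatype 'y step =
    Closed nat 'y
  | Locally_Closed nat 'y 'y
  | Part part arrow nat 'y 'y

type_synonym ('n, 'k) lyubeznik_step = "('n, 'k) mpoly set set step"

fun valid_step :: "('n::finite, 'k::field_char_0) lyubeznik_step \<Rightarrow> bool" where
  "valid_step (Closed i Y) = homogeneous_closed Y"
| "valid_step (Locally_Closed i Y'' Y') =
     (homogeneous_closed Y'' \<and> homogeneous_closed Y' \<and> Y' \<subseteq> Y'')"
| "valid_step (Part p q i Y'' Y') =
     (homogeneous_closed Y'' \<and> homogeneous_closed Y' \<and> Y' \<subseteq> Y'')"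

text \<open>\<open>is_part p f M N W\<close>: \<open>W\<close> is isomorphic to the kernel, image or cokernel of \<open>f : M \<rightarrow> N\<close>.\<close>

fun is_part :: "part \<Rightarrow> ('v \<Rightarrow> 'w) \<Rightarrow> ('n, 'k::field_char_0, 'v) weyl_gmodule \<Rightarrow>
    ('n, 'k, 'w) weyl_gmodule \<Rightarrow> ('n, 'k, 'u) weyl_gmodule \<Rightarrow> bool" where
  "is_part Kernel f M N W = gmodule_iso (gsub M {x\<in>carrier M. f x = \<zero>\<^bsub>N\<^esub>}) W"
| "is_part Image f M N W = gmodule_iso (gsub N (f ` carrier M)) W"
| "is_part Cokernel f M N W = gmodule_iso (gquot N (f ` carrier M)) W"

fun step_on_resolution :: "('n::finite, 'k::field_char_0) lyubeznik_step \<Rightarrow>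
    (nat \<Rightarrow> ('n, 'k, 'u) weyl_gmodule) \<Rightarrow> (nat \<Rightarrow> 'u \<Rightarrow> 'u) \<Rightarrow> ('n, 'k, 'w) weyl_gmodule \<Rightarrow> bool" where
  "step_on_resolution (Closed i Y) I d W = gmodule_iso (H_closed Y I d i) W"
| "step_on_resolution (Locally_Closed i Y'' Y') I d W =
     gmodule_iso (H_locally_closed Y'' Y' I d i) W"
| "step_on_resolution (Part p Incl i Y'' Y') I d W =
     is_part p (arrow_incl Y'' Y' I d i) (H_closed Y' I d i) (H_closed Y'' I d i) W"
| "step_on_resolution (Part p Proj i Y'' Y') I d W =
     is_part p (arrow_proj Y'' Y' I d i) (H_closed Y'' I d i) (H_locally_closed Y'' Y' I d i) W"
| "step_on_resolution (Part p Conn i Y'' Y') I d W =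
     is_part p (arrow_conn Y'' Y' I d i)
       (H_locally_closed Y'' Y' I d i) (H_closed Y' I d (Suc i)) W"

text \<open>The values of these functors are determined up to isomorphism only, so they are relations:
  \<open>W\<close> is the value at \<open>M\<close>, up to isomorphism, computed from some graded injective resolution
  of \<open>M\<close>. Resolutions and values have elements in the same type \<open>'u\<close>.\<close>

definition step_value :: "('n::finite, 'k::field_char_0) lyubeznik_step \<Rightarrow>
    ('n, 'k, 'v) weyl_gmodule \<Rightarrow> ('n, 'k, 'u) weyl_gmodule \<Rightarrow> bool" where
  "step_value s M W \<longleftrightarrow>
     (\<exists>(\<epsilon> :: 'v \<Rightarrow> 'u) I d. graded_injective_resolution M \<epsilon> I d \<and> step_on_resolution s I d W)"

text \<open>The list \<open>[T\<^sub>1, \<dots>, T\<^sub>m]\<close> stands for the composite \<open>T\<^sub>1 \<circ> \<dots> \<circ> T\<^sub>m\<close>, so \<open>T\<^sub>m\<close> is applied first.\<close>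

definition graded_Lyubeznik_functor :: "('n::finite, 'k::field_char_0) lyubeznik_step list \<Rightarrow> bool" where
  "graded_Lyubeznik_functor T \<longleftrightarrow> T \<noteq> [] \<and> (\<forall>s\<in>set T. valid_step s)"

primrec functor_value :: "('n::finite, 'k::field_char_0) lyubeznik_step list \<Rightarrow>
    ('n, 'k, 'v) weyl_gmodule \<Rightarrow> ('n, 'k, 'u) weyl_gmodule \<Rightarrow> bool" where
  "functor_value [] M W \<longleftrightarrow> gmodule_iso M W"
| "functor_value (s # T) M W \<longleftrightarrow>
     (\<exists>L :: ('n, 'k, 'u) weyl_gmodule. functor_value T M L \<and> step_value s L W)"

end

theory Submission
  imports Defs
begin

text \<open>
  For a homogeneous element \<open>w\<close> of a graded module put \<open>\<theta> w = (\<E> - |w|)\<^sup>a w\<close>. Since \<open>[\<E>, b] = deg(b) b\<close>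
  for every homogeneous operator \<open>b\<close> (\<open>euler_minus_commute\<close>), the twist by the degree makes \<open>\<theta>\<close> linear
  over the Weyl algebra, and all morphisms commute with it (\<open>euler_endo_hom\<close>, \<open>euler_endo_natural\<close>).
  A graded module is strongly generalized Eulerian if and only if \<open>\<theta>\<close> vanishes on it for some \<open>a > 0\<close>;
  clearly this passes to graded submodules, quotients and isomorphic copies.

  Let \<open>\<theta>\<close> vanish on \<open>M\<close> and let \<open>I\<close> be a graded injective resolution of \<open>M\<close>. On \<open>I\<close> the maps \<open>\<theta>\<close> form a
  morphism of complexes that lifts the zero map of \<open>M\<close>. So it is null-homotopic, \<open>\<theta> = h d + d h\<close> with
  \<open>h\<close> linear over the Weyl algebra (\<open>euler_endo_null_homotopic\<close>). Linear maps preserve supports, hence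
  \<open>h\<close> acts on \<open>\<Gamma>\<^sub>Y(I)\<close> and on \<open>\<Gamma>\<^sub>Y\<^sub>'\<^sub>'(I)/\<Gamma>\<^sub>Y\<^sub>'(I)\<close>, and \<open>\<theta>\<close> maps cocycles of these complexes to boundaries.
  Thus \<open>\<theta>\<close> vanishes on local cohomology (\<open>H_closed_eulerian\<close>, \<open>H_locally_closed_eulerian\<close>) and on
  kernels, images and cokernels of maps between such modules. The exponent \<open>a\<close> does not change. On the
  polynomial ring \<open>a = 1\<close> will do, by Euler's identity, so \<open>a = 1\<close> also works for the value of a graded
  Lyubeznik functor.

  It remains to see that all modules in question are graded modules over the Weyl algebra. The point
  that needs an argument is that \<open>\<Gamma>\<^sub>Y(M)\<close> is a graded submodule, independently of the choice of
  equations for \<open>Y\<close>. To this end \<open>\<Gamma>\<^sub>Y(M)\<close> is described as the set of elements \<open>x\<close> such that all primes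
  containing the annihilator of \<open>x\<close> belong to \<open>Y\<close> (\<open>sections_with_support_iff\<close>). This uses that the
  radical of an ideal is an intersection of primes. Stability under \<open>\<partial>\<^sub>i\<close> holds because \<open>r x = 0\<close>
  implies \<open>r\<^sup>2 \<partial>\<^sub>i x = 0\<close>.
\<close>

section \<open>Polynomials and the Weyl algebra\<close>

lemma mpoly_induct [case_names single add]:
  fixes p :: "('n, 'k::field_char_0) mpoly"
  assumes single: "\<And>m c. P (Poly_Mapping.single m c)"
    and add: "\<And>p q. P p \<Longrightarrow> P q \<Longrightarrow> P (p + q)"
  shows "P p"
proof (induction p rule: update_induct)
  case const
  show ?case using single[of 0 0] by simp
next
  case (update p m c)
  have "Poly_Mapping.update m c p = p + Poly_Mapping.single m c"
    using update(1) by (intro poly_mapping_eqI) (auto simp: lookup_update lookup_add lookup_single in_keys_iff when_def)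
  then show ?case using add[OF update(3) single] by simp
qed

lemma pdiff_supset:
  fixes p :: "('n, 'k::field_char_0) mpoly"
  assumes "finite A" "Poly_Mapping.keys p \<subseteq> A"
  shows "pdiff i p = (\<Sum>m\<in>A. Poly_Mapping.single (m - Poly_Mapping.single i 1)
                        (of_nat (Poly_Mapping.lookup m i) * Poly_Mapping.lookup p m))"
  unfolding pdiff_def
  by (rule sum.mono_neutral_left) (use assms in \<open>auto simp: in_keys_iff\<close>)

lemma pdiff_add: "pdiff i (p + q) = pdiff i p + pdiff i q"
proof -
  let ?A = "Poly_Mapping.keys p \<union> Poly_Mapping.keys q"
  have "Poly_Mapping.keys (p + q) \<subseteq> ?A"
    by (rule Poly_Mapping.keys_add)
  then show ?thesis
    by (simp add: pdiff_supset[of ?A] lookup_add algebra_simps single_add sum.distrib)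
qed

lemma pdiff_single:
  "pdiff i (Poly_Mapping.single m c) =
     Poly_Mapping.single (m - Poly_Mapping.single i 1) (of_nat (Poly_Mapping.lookup m i) * c)"
  by (simp add: pdiff_supset[of "{m}"])

text \<open>Truncated subtraction of exponents is harmless in the product rule: where it would truncate, the
  coefficient \<open>m\<^sub>i\<close> is zero.\<close>

lemma monomial_diff_add:
  fixes m m' :: "'n \<Rightarrow>\<^sub>0 nat"
  assumes "Poly_Mapping.lookup m i \<noteq> 0"
  shows "m + m' - Poly_Mapping.single i 1 = m - Poly_Mapping.single i 1 + m'"
  using assms by (intro poly_mapping_eqI) (auto simp: lookup_add lookup_minus lookup_single when_def)

lemma pdiff_mult: "pdiff i (p * q) = pdiff i p * q + p * pdiff i q"
proof (induction p rule: mpoly_induct)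
  case (single m c)
  show ?case
  proof (induction q rule: mpoly_induct)
    case (single m' c')
    let ?u = "Poly_Mapping.single i (1::nat)"
    have 1: "Poly_Mapping.single (m - ?u + m') (of_nat (Poly_Mapping.lookup m i) * (c * c')) =
      Poly_Mapping.single (m + m' - ?u) (of_nat (Poly_Mapping.lookup m i) * (c * c'))"
      using monomial_diff_add[of m i m']
      by (cases "Poly_Mapping.lookup m i = 0") simp_all
    have 2: "Poly_Mapping.single (m + (m' - ?u)) (of_nat (Poly_Mapping.lookup m' i) * (c * c')) =
      Poly_Mapping.single (m + m' - ?u) (of_nat (Poly_Mapping.lookup m' i) * (c * c'))"
      using monomial_diff_add[of m' i m]
      by (cases "Poly_Mapping.lookup m' i = 0") (simp_all add: add.commute)
    show ?case
      using 1 2 by (simp add: pdiff_single mult_single lookup_add algebra_simps single_add)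
  qed (simp add: pdiff_add algebra_simps)
qed (simp add: pdiff_add algebra_simps)

lemma weyl_simps [simp]:
  "carrier weyl = weyl_carrier" "mult weyl = (\<circ>)" "one weyl = id"
  "zero weyl = (\<lambda>_. 0)" "add weyl = (\<lambda>a b p. a p + b p)"
  by (simp_all add: weyl_def)

lemma weyl_additive: "a \<in> weyl_carrier \<Longrightarrow> a (p + q) = a p + a q"
  by (induction arbitrary: p q rule: weyl_carrier.induct) (simp_all add: mult_op_def pdiff_add algebra_simps)

lemma weyl_zero: "a \<in> weyl_carrier \<Longrightarrow> a 0 = 0"
  using weyl_additive[of a 0 0] by simp

lemma weyl_sum: "a \<in> weyl_carrier \<Longrightarrow> a (sum f A) = (\<Sum>x\<in>A. a (f x))"
  by (induction A rule: infinite_finite_induct) (simp_all add: weyl_zero weyl_additive)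

lemma Const_simps: "Const 0 = 0" "Const 1 = 1" "Const (c + d) = Const c + Const d" "Const (- c) = - Const c"
  "Const (c - d) = Const c - Const d"
  by (simp_all add: Const_def single_add single_uminus single_diff)

text \<open>Degrees enter the Euler operator as constant factors; these can be moved through any operator
  in the Weyl algebra.\<close>

lemma weyl_Const: "a \<in> weyl_carrier \<Longrightarrow> a (Const c * p) = Const c * a p"
proof (induction arbitrary: p rule: weyl_carrier.induct)
  case (D i)
  have "pdiff i (Const c) = 0" by (simp add: Const_def pdiff_single)
  then show ?case by (simp add: pdiff_mult)
qed (simp_all add: mult_op_def algebra_simps)

lemma weyl_id: "id \<in> weyl_carrier"
  using weyl_carrier.Const[of 1] by (simp add: Const_simps mult_op_def id_def)

lemma weyl_ring: "ring (weyl :: ('n, 'k::field_char_0) operator ring)"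
proof (rule ringI)
  have neg: "(\<lambda>p. - a p) \<in> weyl_carrier" if "a \<in> weyl_carrier" for a :: "('n, 'k) operator"
    using weyl_carrier.mult[OF weyl_carrier.Const[of "- 1"] that]
    by (simp add: mult_op_def Const_simps o_def)
  have zero: "(\<lambda>_. 0) \<in> (weyl_carrier :: ('n, 'k) operator set)"
    using weyl_carrier.Const[of 0] by (simp add: Const_simps mult_op_def)
  show "abelian_group (weyl :: ('n, 'k) operator ring)"
  proof (rule abelian_groupI)
    fix a :: "('n, 'k) operator" assume "a \<in> carrier weyl"
    then show "\<exists>b\<in>carrier weyl. b \<oplus>\<^bsub>weyl\<^esub> a = \<zero>\<^bsub>weyl\<^esub>"
      using neg by (intro bexI[of _ "\<lambda>p. - a p"]) auto
  qed (auto intro: weyl_carrier.add zero simp: algebra_simps)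
  show "monoid (weyl :: ('n, 'k) operator ring)"
    by (rule monoidI) (auto intro: weyl_carrier.mult weyl_id)
qed (auto simp: fun_eq_iff weyl_additive)

interpretation weyl: ring "weyl :: ('n, 'k::field_char_0) operator ring"
  by (rule weyl_ring)

lemma weyl_homogeneous_closed: "weyl_homogeneous e a \<Longrightarrow> a \<in> weyl_carrier"
  by (induction rule: weyl_homogeneous.induct) (blast intro: weyl_carrier.intros)+

text \<open>The degree of the zero operator is arbitrary because operators of every degree exist (powers of
  \<open>X\<^sub>i\<close> and of \<open>\<partial>\<^sub>i\<close>), which can be composed with the constant \<open>0\<close> of degree \<open>0\<close>.\<close>

lemma weyl_homogeneous_zero: "weyl_homogeneous e ((\<lambda>_. 0) :: ('n, 'k::field_char_0) operator)"
proof -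
  have pos: "\<exists>b :: ('n, 'k) operator. weyl_homogeneous (int n) b" for n
  proof (induction n)
    case 0
    show ?case using weyl_homogeneous.Const by auto
  next
    case (Suc n)
    then obtain b :: "('n, 'k) operator" where "weyl_homogeneous (int n) b" by blast
    from weyl_homogeneous.mult[OF weyl_homogeneous.X this] show ?case
      unfolding of_nat_Suc by blast
  qed
  have neg: "\<exists>b :: ('n, 'k) operator. weyl_homogeneous (- int n) b" for n
  proof (induction n)
    case 0
    show ?case using weyl_homogeneous.Const by auto
  next
    case (Suc n)
    then obtain b :: "('n, 'k) operator" where "weyl_homogeneous (- int n) b" by blast
    from weyl_homogeneous.mult[OF weyl_homogeneous.D this] show ?case
      by (metis minus_add_distrib of_nat_Suc)
  qed
  obtain b :: "('n, 'k) operator" where "weyl_homogeneous e b"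
    by (metis int_cases2 pos neg)
  from weyl_homogeneous.mult[OF weyl_homogeneous.Const[of 0] this] show ?thesis
    by (simp add: mult_op_def Const_simps o_def)
qed

abbreviation mdegree :: "('n::finite \<Rightarrow>\<^sub>0 nat) \<Rightarrow> int" where
  "mdegree m \<equiv> int (\<Sum>i\<in>UNIV. Poly_Mapping.lookup m i)"

lemma mdegree_add: "mdegree (m + m') = mdegree m + mdegree m'"
  by (simp add: lookup_add sum.distrib)

lemma mdegree_single: "mdegree (Poly_Mapping.single i k) = int k"
  by (simp add: lookup_single when_def)

text \<open>Splitting off one variable at a time exhibits a monomial as a product of generators.\<close>

lemma weyl_homogeneous_monomial:
  "weyl_homogeneous (mdegree m) (mult_op (Poly_Mapping.single m c))"
proof (induction "\<Sum>i\<in>UNIV. Poly_Mapping.lookup m i" arbitrary: m)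
  case 0
  then have "m = 0" by (intro poly_mapping_eqI) simp
  then show ?case using weyl_homogeneous.Const[of c] by (simp add: Const_def)
next
  case (Suc n)
  then obtain i where i: "Poly_Mapping.lookup m i \<noteq> 0"
    by (metis sum.neutral nat.distinct(1))
  let ?u = "Poly_Mapping.single i (1::nat)"
  have m: "m = ?u + (m - ?u)"
    using i by (intro poly_mapping_eqI) (auto simp: lookup_add lookup_minus lookup_single when_def)
  have deg: "mdegree m = 1 + mdegree (m - ?u)"
    using mdegree_add[of ?u "m - ?u"] m mdegree_single[of i 1] by simp
  then have "weyl_homogeneous (mdegree (m - ?u)) (mult_op (Poly_Mapping.single (m - ?u) c))"
    using Suc(2) by (intro Suc(1)) (simp flip: of_nat_sum)
  from weyl_homogeneous.mult[OF weyl_homogeneous.X[of i] this]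
  have "weyl_homogeneous (mdegree m) (mult_op (Var i) \<circ> mult_op (Poly_Mapping.single (m - ?u) c))"
    using deg by simp
  moreover have "mult_op (Var i) \<circ> mult_op (Poly_Mapping.single (m - ?u) c) = mult_op (Poly_Mapping.single m c)"
    using arg_cong[OF m, of "\<lambda>m. Poly_Mapping.single m c"]
    by (simp add: mult_op_def Var_def o_def mult.assoc[symmetric] mult_single)
  ultimately show ?case by simp
qed

lemma mpoly_eq_sum: "p = (\<Sum>m\<in>Poly_Mapping.keys p. Poly_Mapping.single m (Poly_Mapping.lookup p m))"
  by (intro poly_mapping_eqI)
    (simp add: lookup_sum lookup_single when_def in_keys_iff)

lemma weyl_homogeneous_mult_op:
  assumes "r \<in> homogeneous_polys e"
  shows "weyl_homogeneous e (mult_op r)"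
proof -
  have "weyl_homogeneous e (mult_op (\<Sum>m\<in>A. Poly_Mapping.single m (Poly_Mapping.lookup r m)))"
    if "A \<subseteq> Poly_Mapping.keys r" "finite A" for A
    using that(2,1)
  proof (induction A rule: finite_induct)
    case empty
    then show ?case using weyl_homogeneous_zero by (simp add: mult_op_def)
  next
    case (insert m A)
    then have "mdegree m = e" using assms by (auto simp: homogeneous_polys_def)
    with insert weyl_homogeneous.add[OF _ insert.IH] weyl_homogeneous_monomial[of m "Poly_Mapping.lookup r m"]
    show ?case by (auto simp: mult_op_def algebra_simps)
  qed
  from this[of "Poly_Mapping.keys r"] show ?thesis
    by (simp flip: mpoly_eq_sum)
qed

lemma mult_op_closed:
  fixes r :: "('n::finite, 'k::field_char_0) mpoly"
  shows "mult_op r \<in> weyl_carrier"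
proof (induction r rule: mpoly_induct)
  case (single m c)
  show ?case by (rule weyl_homogeneous_closed[OF weyl_homogeneous_monomial])
next
  case (add p q)
  then show ?case using weyl_carrier.add[OF add] by (simp add: mult_op_def algebra_simps)
qed

subsection \<open>The Euler operator\<close>

lemma homogeneous_polys_add:
  "p \<in> homogeneous_polys e \<Longrightarrow> q \<in> homogeneous_polys e \<Longrightarrow> p + q \<in> homogeneous_polys e"
  using Poly_Mapping.keys_add[of p q] by (auto simp: homogeneous_polys_def)

lemma homogeneous_polys_0: "0 \<in> homogeneous_polys e"
  by (simp add: homogeneous_polys_def)

lemma homogeneous_polys_sum:
  "(\<And>x. x \<in> A \<Longrightarrow> f x \<in> homogeneous_polys e) \<Longrightarrow> sum f A \<in> homogeneous_polys e"
  by (induction A rule: infinite_finite_induct) (auto intro: homogeneous_polys_add homogeneous_polys_0)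

lemma homogeneous_polys_single: "Poly_Mapping.single m c \<in> homogeneous_polys (mdegree m)"
  by (auto simp: homogeneous_polys_def)

lemma homogeneous_polys_mult:
  assumes "p \<in> homogeneous_polys e" "q \<in> homogeneous_polys e'"
  shows "p * q \<in> homogeneous_polys (e + e')"
  using assms keys_mult[of p q] by (fastforce simp: homogeneous_polys_def mdegree_add lookup_add sum.distrib)

lemma homogeneous_polys_pdiff:
  assumes "p \<in> homogeneous_polys e"
  shows "pdiff i p \<in> homogeneous_polys (e - 1)"
  unfolding pdiff_def
proof (rule homogeneous_polys_sum)
  fix m assume m: "m \<in> Poly_Mapping.keys p"
  let ?u = "Poly_Mapping.single i (1::nat)"
  show "Poly_Mapping.single (m - ?u) (of_nat (Poly_Mapping.lookup m i) * Poly_Mapping.lookup p m)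
    \<in> homogeneous_polys (e - 1)"
  proof (cases "Poly_Mapping.lookup m i = 0")
    case False
    then have "m = ?u + (m - ?u)"
      by (intro poly_mapping_eqI) (auto simp: lookup_add lookup_minus lookup_single when_def)
    then have "mdegree m = 1 + mdegree (m - ?u)"
      using mdegree_add[of ?u "m - ?u"] mdegree_single[of i 1] by simp
    moreover have "mdegree m = e" using assms m by (auto simp: homogeneous_polys_def)
    ultimately have "e - 1 = mdegree (m - ?u)" by simp
    then show ?thesis using homogeneous_polys_single by simp
  qed (simp add: homogeneous_polys_0)
qed

lemma weyl_homogeneous_polys:
  "weyl_homogeneous e a \<Longrightarrow> p \<in> homogeneous_polys e' \<Longrightarrow> a p \<in> homogeneous_polys (e + e')"
proof (induction arbitrary: p e' rule: weyl_homogeneous.induct)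
  case (Const c)
  have "Const c \<in> homogeneous_polys 0" by (auto simp: Const_def homogeneous_polys_def)
  from homogeneous_polys_mult[OF this Const] show ?case by (simp add: mult_op_def)
next
  case (X i)
  have "Var i \<in> homogeneous_polys 1"
    unfolding Var_def using homogeneous_polys_single[of "Poly_Mapping.single i 1" 1] mdegree_single[of i 1] by simp
  from homogeneous_polys_mult[OF this X] show ?case by (simp add: mult_op_def)
next
  case (D i)
  from homogeneous_polys_pdiff[OF this] show ?case by simp
next
  case (mult e a e2 b)
  then show ?case by (metis add.assoc comp_apply)
qed (auto intro: homogeneous_polys_add)

lemma weyl_finsum_apply:
  assumes "finite A" "\<And>i. i \<in> A \<Longrightarrow> f i \<in> weyl_carrier"
  shows "(\<Oplus>\<^bsub>weyl\<^esub>i\<in>A. f i) p = (\<Sum>i\<in>A. f i p)"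
  using assms
proof (induction A rule: finite_induct)
  case (insert x A)
  then have "(\<Oplus>\<^bsub>weyl\<^esub>i\<in>insert x A. f i) = f x \<oplus>\<^bsub>weyl\<^esub> (\<Oplus>\<^bsub>weyl\<^esub>i\<in>A. f i)"
    by (intro weyl.finsum_insert) auto
  with insert show ?case by simp
qed simp

lemma euler_apply: "euler p = (\<Sum>i\<in>UNIV. Var i * pdiff i p)"
  unfolding euler_def
  by (subst weyl_finsum_apply, simp, simp only: weyl_simps weyl_carrier.intros)
    (simp add: mult_op_def)

lemma weyl_homogeneous_sum:
  assumes "finite A" "\<And>i. i \<in> A \<Longrightarrow> weyl_homogeneous e (f i)"
  shows "weyl_homogeneous e (\<lambda>p. \<Sum>i\<in>A. f i p)"
  using assms by (induction A rule: finite_induct)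
    (auto intro: weyl_homogeneous_zero weyl_homogeneous.add)

lemma euler_homogeneous: "weyl_homogeneous 0 (euler :: ('n::finite, 'k::field_char_0) operator)"
proof -
  have "weyl_homogeneous (1 + - 1) (mult_op (Var i) \<circ> pdiff i :: ('n, 'k) operator)" for i
    by (rule weyl_homogeneous.mult[OF weyl_homogeneous.X weyl_homogeneous.D])
  then have "weyl_homogeneous 0 (mult_op (Var i) \<circ> pdiff i :: ('n, 'k) operator)" for i
    by simp
  from weyl_homogeneous_sum[OF _ this, of UNIV "\<lambda>i. i"] show ?thesis
    by (simp add: euler_apply[abs_def] mult_op_def)
qed

text \<open>Euler's identity: on a monomial of degree \<open>e\<close>, each \<open>X\<^sub>i \<partial>\<^sub>i\<close> multiplies by the exponent of \<open>X\<^sub>i\<close>.\<close>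

lemma euler_homogeneous_poly:
  assumes "p \<in> homogeneous_polys e"
  shows "euler p = Const (of_int e) * p"
proof -
  have mono: "euler (Poly_Mapping.single m c) = Const (of_int (mdegree m)) * Poly_Mapping.single m c"
    for m :: "'a \<Rightarrow>\<^sub>0 nat" and c :: 'b
  proof -
    have "Var i * pdiff i (Poly_Mapping.single m c) = Poly_Mapping.single m (of_nat (Poly_Mapping.lookup m i) * c)" for i
    proof (cases "Poly_Mapping.lookup m i = 0")
      case False
      then have "Poly_Mapping.single i 1 + (m - Poly_Mapping.single i 1) = m"
        by (intro poly_mapping_eqI) (auto simp: lookup_add lookup_minus lookup_single when_def)
      then show ?thesis by (simp add: pdiff_single Var_def mult_single)
    qed (simp add: pdiff_single)
    then have "euler (Poly_Mapping.single m c) = (\<Sum>i\<in>UNIV. Poly_Mapping.single m (of_nat (Poly_Mapping.lookup m i) * c))"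
      by (simp add: euler_apply)
    also have "\<dots> = Poly_Mapping.single m (\<Sum>i\<in>UNIV. of_nat (Poly_Mapping.lookup m i) * c)"
      by (intro poly_mapping_eqI) (simp add: lookup_sum lookup_single when_def)
    also have "\<dots> = Const (of_int (mdegree m)) * Poly_Mapping.single m c"
      by (simp add: Const_def mult_single sum_distrib_right)
    finally show ?thesis .
  qed
  let ?s = "\<lambda>m. Poly_Mapping.single m (Poly_Mapping.lookup p m)"
  have "euler p = euler (\<Sum>m\<in>Poly_Mapping.keys p. ?s m)" by (simp flip: mpoly_eq_sum)
  also have "\<dots> = (\<Sum>m\<in>Poly_Mapping.keys p. euler (?s m))"
    by (rule weyl_sum[OF weyl_homogeneous_closed[OF euler_homogeneous]])
  also have "\<dots> = (\<Sum>m\<in>Poly_Mapping.keys p. Const (of_int e) * ?s m)"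
    using assms mono by (intro sum.cong) (auto simp: homogeneous_polys_def)
  also have "\<dots> = Const (of_int e) * p"
    by (simp flip: sum_distrib_left mpoly_eq_sum)
  finally show ?thesis .
qed

definition euler_minus :: "int \<Rightarrow> ('n::finite, 'k::field_char_0) operator" where
  "euler_minus e = euler \<ominus>\<^bsub>weyl\<^esub> [e] \<cdot>\<^bsub>weyl\<^esub> \<one>\<^bsub>weyl\<^esub>"

lemma weyl_a_inv_apply:
  assumes "a \<in> weyl_carrier"
  shows "(\<ominus>\<^bsub>weyl\<^esub> a) p = - a p"
proof -
  have "a \<oplus>\<^bsub>weyl\<^esub> (\<ominus>\<^bsub>weyl\<^esub> a) = \<zero>\<^bsub>weyl\<^esub>" using assms by (intro weyl.r_neg) simp
  then have "a p + (\<ominus>\<^bsub>weyl\<^esub> a) p = 0" by (simp add: fun_eq_iff)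
  then show ?thesis by (simp add: eq_neg_iff_add_eq_0 add.commute)
qed

lemma weyl_int_multiple_one: "[e] \<cdot>\<^bsub>weyl\<^esub> \<one>\<^bsub>weyl\<^esub> = mult_op (Const (of_int e))"
proof -
  have nat: "[n] \<cdot>\<^bsub>weyl\<^esub> \<one>\<^bsub>weyl\<^esub> = mult_op (Const (of_nat n))" for n :: nat
  proof (induction n)
    case 0
    show ?case by (simp add: add_pow_def mult_op_def Const_simps)
  next
    case (Suc n)
    have "[Suc n] \<cdot>\<^bsub>weyl\<^esub> \<one>\<^bsub>weyl\<^esub> = [n] \<cdot>\<^bsub>weyl\<^esub> \<one>\<^bsub>weyl\<^esub> \<oplus>\<^bsub>weyl\<^esub> \<one>\<^bsub>weyl\<^esub>"
      by (simp add: add_pow_def)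
    with Suc show ?case by (simp add: mult_op_def Const_simps algebra_simps)
  qed
  show ?thesis
  proof (cases "e \<ge> 0")
    case True
    then show ?thesis by (simp only: add_pow_int_ge nat) simp
  next
    case False
    then have "[e] \<cdot>\<^bsub>weyl\<^esub> \<one>\<^bsub>weyl\<^esub> = \<ominus>\<^bsub>weyl\<^esub> mult_op (Const (of_nat (nat (- e))))"
      by (simp only: add_pow_int_lt nat not_le)
    also have "\<dots> = mult_op (Const (of_int e))"
    proof
      fix p
      show "(\<ominus>\<^bsub>weyl\<^esub> mult_op (Const (of_nat (nat (- e))))) p = mult_op (Const (of_int e)) p"
        unfolding weyl_a_inv_apply[OF weyl_carrier.Const]
        using False by (simp add: mult_op_def Const_simps)
    qed
    finally show ?thesis .
  qed
qed

lemma euler_minus_apply: "euler_minus e p = euler p - Const (of_int e) * p"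
  unfolding euler_minus_def a_minus_def weyl_int_multiple_one
  by (simp add: weyl_a_inv_apply weyl_carrier.Const) (simp add: mult_op_def)

lemma euler_minus_homogeneous:
  "weyl_homogeneous 0 (euler_minus e :: ('n::finite, 'k::field_char_0) operator)"
proof -
  have "(euler_minus e :: ('n, 'k) operator) = (\<lambda>p. euler p + mult_op (Const (of_int (- e))) p)"
    by (simp add: fun_eq_iff euler_minus_apply mult_op_def Const_simps)
  then show ?thesis
    using weyl_homogeneous.add[OF euler_homogeneous weyl_homogeneous.Const[of "of_int (- e)"]]
    by (simp only: )
qed

text \<open>The commutation relation \<open>[\<E>, b] = deg(b) b\<close>. It holds because \<open>\<E>\<close> acts on homogeneous
  polynomials by their degree, \<open>b\<close> raises degrees by \<open>deg(b)\<close>, and an operator is determined by its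
  values on homogeneous polynomials.\<close>

lemma euler_minus_commute:
  fixes b :: "('n::finite, 'k::field_char_0) operator"
  assumes "weyl_homogeneous d b"
  shows "euler_minus (d + e) \<circ> b = b \<circ> euler_minus e"
proof
  fix p :: "('n, 'k) mpoly"
  note b = weyl_homogeneous_closed[OF assms]
  note E = weyl_homogeneous_closed[OF euler_minus_homogeneous]
  show "(euler_minus (d + e) \<circ> b) p = (b \<circ> euler_minus e) p"
  proof (induction p rule: mpoly_induct)
    case (single m c)
    let ?p = "Poly_Mapping.single m c"
    note p = homogeneous_polys_single[of m c]
    have "euler_minus (d + e) (b ?p) = Const (of_int (mdegree m - e)) * b ?p"
      using euler_homogeneous_poly[OF weyl_homogeneous_polys[OF assms p]]
      by (simp add: euler_minus_apply Const_simps algebra_simps)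
    also have "\<dots> = b (Const (of_int (mdegree m - e)) * ?p)"
      by (simp add: weyl_Const[OF b])
    also have "Const (of_int (mdegree m - e)) * ?p = euler_minus e ?p"
      using euler_homogeneous_poly[OF p]
      by (simp add: euler_minus_apply Const_simps algebra_simps)
    finally show ?case by simp
  next
    case (add p q)
    then show ?case by (simp add: weyl_additive[OF b] weyl_additive[OF E])
  qed
qed

abbreviation euler_power :: "nat \<Rightarrow> int \<Rightarrow> ('n::finite, 'k::field_char_0) operator" where
  "euler_power a e \<equiv> euler_minus e [^]\<^bsub>weyl\<^esub> a"

lemma euler_power_0: "euler_power 0 e = id"
  and euler_power_Suc: "euler_power (Suc a) e = euler_power a e \<circ> euler_minus e"
  by simp_all

lemma euler_power_homogeneous: "weyl_homogeneous 0 (euler_power a e)"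
proof (induction a)
  case 0
  have id: "id = mult_op (Const (1::'b))" by (simp add: Const_simps mult_op_def id_def)
  show ?case unfolding euler_power_0 id by (rule weyl_homogeneous.Const)
next
  case (Suc a)
  from weyl_homogeneous.mult[OF this euler_minus_homogeneous] show ?case
    unfolding euler_power_Suc by (simp del: o_apply)
qed

lemma euler_power_commute:
  assumes "weyl_homogeneous d b"
  shows "euler_power a (d + e) \<circ> b = b \<circ> euler_power a e"
proof (induction a)
  case (Suc a)
  have "euler_power (Suc a) (d + e) \<circ> b = euler_power a (d + e) \<circ> (euler_minus (d + e) \<circ> b)"
    unfolding euler_power_Suc comp_assoc ..
  also have "\<dots> = (euler_power a (d + e) \<circ> b) \<circ> euler_minus e"
    unfolding euler_minus_commute[OF assms] comp_assoc ..
  also have "\<dots> = b \<circ> euler_power (Suc a) e"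
    unfolding Suc unfolding euler_power_Suc comp_assoc ..
  finally show ?case .
qed (unfold euler_power_0, simp)

lemma weyl_const_zero: "(\<lambda>_. 0) \<in> weyl_carrier"
  using weyl.zero_closed by simp

lemma weyl_neg_one_plus_id: "(\<lambda>p. mult_op (Const (- 1)) p + id p) = (\<lambda>_. 0)"
  by (simp add: mult_op_def Const_simps)

section \<open>Graded modules and their homogeneous parts\<close>

lemma additive_finsum:
  assumes "abelian_group M" "abelian_group N" "f \<in> carrier M \<rightarrow> carrier N"
    and add: "\<And>x y. x \<in> carrier M \<Longrightarrow> y \<in> carrier M \<Longrightarrow> f (x \<oplus>\<^bsub>M\<^esub> y) = f x \<oplus>\<^bsub>N\<^esub> f y"
    and zero: "f \<zero>\<^bsub>M\<^esub> = \<zero>\<^bsub>N\<^esub>"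
    and "finite A" "\<And>i. i \<in> A \<Longrightarrow> c i \<in> carrier M"
  shows "f (\<Oplus>\<^bsub>M\<^esub>i\<in>A. c i) = (\<Oplus>\<^bsub>N\<^esub>i\<in>A. f (c i))"
proof -
  interpret M: abelian_group M by fact
  interpret N: abelian_group N by fact
  have f: "x \<in> carrier M \<Longrightarrow> f x \<in> carrier N" for x using assms(3) by auto
  show ?thesis
    using assms(6,7)
  proof (induction A rule: finite_induct)
    case (insert i A)
    then have "c \<in> A \<rightarrow> carrier M" "c i \<in> carrier M" "(\<lambda>i. f (c i)) \<in> A \<rightarrow> carrier N" "f (c i) \<in> carrier N"
      using f by auto
    with insert show ?case
      by (simp add: M.finsum_insert N.finsum_insert add)
  qed (simp add: zero)
qed

lemma additive_zero:
  assumes "abelian_group M" "abelian_group N" "f \<in> carrier M \<rightarrow> carrier N"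
    and add: "\<And>x y. x \<in> carrier M \<Longrightarrow> y \<in> carrier M \<Longrightarrow> f (x \<oplus>\<^bsub>M\<^esub> y) = f x \<oplus>\<^bsub>N\<^esub> f y"
  shows "f \<zero>\<^bsub>M\<^esub> = \<zero>\<^bsub>N\<^esub>"
proof -
  interpret M: abelian_group M by fact
  interpret N: abelian_group N by fact
  have "f \<zero>\<^bsub>M\<^esub> \<in> carrier N" using assms(3) by auto
  moreover have "f \<zero>\<^bsub>M\<^esub> \<oplus>\<^bsub>N\<^esub> f \<zero>\<^bsub>M\<^esub> = f \<zero>\<^bsub>M\<^esub>" using add[of "\<zero>\<^bsub>M\<^esub>" "\<zero>\<^bsub>M\<^esub>"] by simp
  ultimately show ?thesis by (metis N.add.r_cancel_one)
qed

definition homogeneous_part :: "('a, 'm) gmodule \<Rightarrow> int \<Rightarrow> 'm \<Rightarrow> 'm" where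
  "homogeneous_part M e x = (THE c. (\<forall>e. c e \<in> hcomp M e) \<and> finite {e. c e \<noteq> \<zero>\<^bsub>M\<^esub>} \<and>
     x = (\<Oplus>\<^bsub>M\<^esub>e\<in>{e. c e \<noteq> \<zero>\<^bsub>M\<^esub>}. c e)) e"

definition homogeneous_support :: "('a, 'm) gmodule \<Rightarrow> 'm \<Rightarrow> int set" where
  "homogeneous_support M x = {e. homogeneous_part M e x \<noteq> \<zero>\<^bsub>M\<^esub>}"

context graded_weyl_module
begin

lemma act_closed: "a \<in> weyl_carrier \<Longrightarrow> x \<in> carrier M \<Longrightarrow> a \<odot>\<^bsub>M\<^esub> x \<in> carrier M"
  using smult_closed by simp

lemma act_add_left: "a \<in> weyl_carrier \<Longrightarrow> b \<in> weyl_carrier \<Longrightarrow> x \<in> carrier M \<Longrightarrow>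
    (\<lambda>p. a p + b p) \<odot>\<^bsub>M\<^esub> x = a \<odot>\<^bsub>M\<^esub> x \<oplus>\<^bsub>M\<^esub> b \<odot>\<^bsub>M\<^esub> x"
  using smult_l_distr by simp

lemma act_add_right: "a \<in> weyl_carrier \<Longrightarrow> x \<in> carrier M \<Longrightarrow> y \<in> carrier M \<Longrightarrow>
    a \<odot>\<^bsub>M\<^esub> (x \<oplus>\<^bsub>M\<^esub> y) = a \<odot>\<^bsub>M\<^esub> x \<oplus>\<^bsub>M\<^esub> a \<odot>\<^bsub>M\<^esub> y"
  using smult_r_distr by simp

lemma act_comp: "a \<in> weyl_carrier \<Longrightarrow> b \<in> weyl_carrier \<Longrightarrow> x \<in> carrier M \<Longrightarrow>
    (a \<circ> b) \<odot>\<^bsub>M\<^esub> x = a \<odot>\<^bsub>M\<^esub> (b \<odot>\<^bsub>M\<^esub> x)"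
  using smult_assoc by simp

lemma act_id: "x \<in> carrier M \<Longrightarrow> id \<odot>\<^bsub>M\<^esub> x = x"
  using smult_one by simp

lemma act_zero: "a \<in> weyl_carrier \<Longrightarrow> a \<odot>\<^bsub>M\<^esub> \<zero>\<^bsub>M\<^esub> = \<zero>\<^bsub>M\<^esub>"
  by (rule additive_zero) (auto intro: M.abelian_group_axioms act_closed simp: act_add_right)

lemma zero_act:
  assumes x: "x \<in> carrier M"
  shows "(\<lambda>_. 0) \<odot>\<^bsub>M\<^esub> x = \<zero>\<^bsub>M\<^esub>"
proof -
  note z = weyl_const_zero
  from act_add_left[OF z z x] have "(\<lambda>_. 0) \<odot>\<^bsub>M\<^esub> x \<oplus>\<^bsub>M\<^esub> (\<lambda>_. 0) \<odot>\<^bsub>M\<^esub> x = (\<lambda>_. 0) \<odot>\<^bsub>M\<^esub> x"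
    by simp
  then show ?thesis using act_closed[OF z x] by (metis M.add.r_cancel_one)
qed

lemma neg_act:
  assumes "x \<in> carrier M"
  shows "mult_op (Const (- 1)) \<odot>\<^bsub>M\<^esub> x = \<ominus>\<^bsub>M\<^esub> x"
proof -
  note c = weyl_carrier.Const[of "- 1"]
  have "mult_op (Const (- 1)) \<odot>\<^bsub>M\<^esub> x \<oplus>\<^bsub>M\<^esub> id \<odot>\<^bsub>M\<^esub> x = (\<lambda>p. mult_op (Const (- 1)) p + id p) \<odot>\<^bsub>M\<^esub> x"
    by (rule act_add_left[OF c weyl_id assms, symmetric])
  also have "\<dots> = (\<lambda>_. 0) \<odot>\<^bsub>M\<^esub> x"
    unfolding weyl_neg_one_plus_id ..
  finally have "mult_op (Const (- 1)) \<odot>\<^bsub>M\<^esub> x \<oplus>\<^bsub>M\<^esub> x = \<zero>\<^bsub>M\<^esub>"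
    using assms by (simp only: act_id zero_act)
  then show ?thesis using assms act_closed[OF c assms] by (simp add: M.minus_equality)
qed

lemma hcomp_closed: "x \<in> hcomp M e \<Longrightarrow> x \<in> carrier M"
  using additive_subgroup.a_Hcarr[OF hcomp_subgroup] .

lemma hcomp_zero: "\<zero>\<^bsub>M\<^esub> \<in> hcomp M e"
  using additive_subgroup.zero_closed[OF hcomp_subgroup] .

lemma hcomp_add: "x \<in> hcomp M e \<Longrightarrow> y \<in> hcomp M e \<Longrightarrow> x \<oplus>\<^bsub>M\<^esub> y \<in> hcomp M e"
  using additive_subgroup.a_closed[OF hcomp_subgroup] .

lemma homogeneous_part_spec:
  assumes "x \<in> carrier M"
  shows homogeneous_part_hcomp: "homogeneous_part M e x \<in> hcomp M e"
    and finite_homogeneous_support: "finite (homogeneous_support M x)"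
    and homogeneous_decomposition: "x = (\<Oplus>\<^bsub>M\<^esub>e\<in>homogeneous_support M x. homogeneous_part M e x)"
  using theI'[OF hcomp_direct_sum[OF assms]] unfolding homogeneous_part_def homogeneous_support_def by blast+

lemma homogeneous_part_closed: "x \<in> carrier M \<Longrightarrow> homogeneous_part M e x \<in> carrier M"
  by (rule hcomp_closed[OF homogeneous_part_hcomp])

lemma homogeneous_part_unique:
  assumes "finite A" "\<And>e. c e \<in> hcomp M e" "\<And>e. e \<notin> A \<Longrightarrow> c e = \<zero>\<^bsub>M\<^esub>" "x = (\<Oplus>\<^bsub>M\<^esub>e\<in>A. c e)"
  shows "homogeneous_part M e x = c e"
proof -
  have sub: "{e. c e \<noteq> \<zero>\<^bsub>M\<^esub>} \<subseteq> A" using assms(3) by auto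
  have x: "x = (\<Oplus>\<^bsub>M\<^esub>e\<in>{e. c e \<noteq> \<zero>\<^bsub>M\<^esub>}. c e)"
    unfolding assms(4)
    by (rule M.add.finprod_mono_neutral_cong_right[OF assms(1) sub]) (auto intro: hcomp_closed assms(2))
  have "x \<in> carrier M"
    unfolding assms(4) by (rule M.finsum_closed) (auto intro: hcomp_closed assms(2))
  from the1_equality[OF hcomp_direct_sum[OF this], of c] show ?thesis
    unfolding homogeneous_part_def using assms(2) x finite_subset[OF sub assms(1)] by simp
qed

lemma homogeneous_decomposition_superset:
  assumes "x \<in> carrier M" "finite A" "homogeneous_support M x \<subseteq> A"
  shows "x = (\<Oplus>\<^bsub>M\<^esub>e\<in>A. homogeneous_part M e x)"
proof -
  have "(\<Oplus>\<^bsub>M\<^esub>e\<in>A. homogeneous_part M e x) = (\<Oplus>\<^bsub>M\<^esub>e\<in>homogeneous_support M x. homogeneous_part M e x)"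
    by (rule M.add.finprod_mono_neutral_cong_right[OF assms(2,3)])
      (auto simp: homogeneous_support_def homogeneous_part_closed assms(1))
  with homogeneous_decomposition[OF assms(1)] show ?thesis by simp
qed

lemma homogeneous_part_add:
  assumes "x \<in> carrier M" "y \<in> carrier M"
  shows "homogeneous_part M e (x \<oplus>\<^bsub>M\<^esub> y) = homogeneous_part M e x \<oplus>\<^bsub>M\<^esub> homogeneous_part M e y"
proof (rule homogeneous_part_unique)
  let ?A = "homogeneous_support M x \<union> homogeneous_support M y"
  show A: "finite ?A" using assms finite_homogeneous_support by simp
  show "e \<notin> ?A \<Longrightarrow> homogeneous_part M e x \<oplus>\<^bsub>M\<^esub> homogeneous_part M e y = \<zero>\<^bsub>M\<^esub>" for e
    by (simp add: homogeneous_support_def)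
  have "x \<oplus>\<^bsub>M\<^esub> y = (\<Oplus>\<^bsub>M\<^esub>e\<in>?A. homogeneous_part M e x) \<oplus>\<^bsub>M\<^esub> (\<Oplus>\<^bsub>M\<^esub>e\<in>?A. homogeneous_part M e y)"
    using assms A homogeneous_decomposition_superset[of _ ?A] by simp
  also have "\<dots> = (\<Oplus>\<^bsub>M\<^esub>e\<in>?A. homogeneous_part M e x \<oplus>\<^bsub>M\<^esub> homogeneous_part M e y)"
    using assms by (intro M.finsum_addf[symmetric]) (auto intro: homogeneous_part_closed)
  finally show "x \<oplus>\<^bsub>M\<^esub> y = (\<Oplus>\<^bsub>M\<^esub>e\<in>?A. homogeneous_part M e x \<oplus>\<^bsub>M\<^esub> homogeneous_part M e y)" .
qed (auto intro: hcomp_add homogeneous_part_hcomp assms)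

lemma homogeneous_part_of_homogeneous:
  assumes "x \<in> hcomp M e"
  shows "homogeneous_part M e' x = (if e' = e then x else \<zero>\<^bsub>M\<^esub>)"
proof (rule homogeneous_part_unique)
  show "x = (\<Oplus>\<^bsub>M\<^esub>e'\<in>{e}. if e' = e then x else \<zero>\<^bsub>M\<^esub>)"
    using hcomp_closed[OF assms] by (simp add: M.finsum_insert)
qed (use assms hcomp_zero in auto)

text \<open>Additive statements about graded modules, such as the equality of two additive maps, need to be
  checked on homogeneous elements only.\<close>

lemma homogeneous_induct [consumes 1, case_names homogeneous add]:
  assumes "x \<in> carrier M"
    and "\<And>e x. x \<in> hcomp M e \<Longrightarrow> P x"
    and "\<And>x y. x \<in> carrier M \<Longrightarrow> y \<in> carrier M \<Longrightarrow> P x \<Longrightarrow> P y \<Longrightarrow> P (x \<oplus>\<^bsub>M\<^esub> y)"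
  shows "P x"
proof -
  have "P (\<Oplus>\<^bsub>M\<^esub>e\<in>A. homogeneous_part M e x)" if "finite A" for A
    using that
  proof (induction A rule: finite_induct)
    case empty
    then show ?case using assms(2)[OF hcomp_zero] by simp
  next
    case (insert e A)
    note closed = homogeneous_part_closed[OF assms(1)]
    from insert have "(\<Oplus>\<^bsub>M\<^esub>e\<in>insert e A. homogeneous_part M e x) =
        homogeneous_part M e x \<oplus>\<^bsub>M\<^esub> (\<Oplus>\<^bsub>M\<^esub>e\<in>A. homogeneous_part M e x)"
      using closed by (intro M.finsum_insert) auto
    moreover have "P (homogeneous_part M e x)"
      by (rule assms(2)[OF homogeneous_part_hcomp[OF assms(1)]])
    ultimately show ?case
      using insert(3) closed by (auto intro!: assms(3) M.finsum_closed)
  qed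
  from this[OF finite_homogeneous_support[OF assms(1)]] show ?thesis
    using homogeneous_decomposition[OF assms(1)] by simp
qed

end

text \<open>Homogeneous additive maps commute with taking homogeneous parts, by uniqueness of the
  decomposition. Morphisms (\<open>d = 0\<close>) and the action of homogeneous operators are of this kind.\<close>

lemma homogeneous_part_additive:
  fixes M :: "('n::finite, 'k::field_char_0, 'v) weyl_gmodule"
    and N :: "('n, 'k, 'w) weyl_gmodule"
  assumes "graded_weyl_module M" "graded_weyl_module N" "f \<in> carrier M \<rightarrow> carrier N"
    and add: "\<And>x y. x \<in> carrier M \<Longrightarrow> y \<in> carrier M \<Longrightarrow> f (x \<oplus>\<^bsub>M\<^esub> y) = f x \<oplus>\<^bsub>N\<^esub> f y"
    and hom: "\<And>e x. x \<in> hcomp M e \<Longrightarrow> f x \<in> hcomp N (d + e)"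
    and x: "x \<in> carrier M"
  shows "homogeneous_part N (d + e) (f x) = f (homogeneous_part M e x)"
proof -
  interpret M: graded_weyl_module M by fact
  interpret N: graded_weyl_module N by fact
  have zero: "f \<zero>\<^bsub>M\<^esub> = \<zero>\<^bsub>N\<^esub>"
    by (rule additive_zero) (use assms M.M.abelian_group_axioms N.M.abelian_group_axioms in auto)
  let ?S = "homogeneous_support M x" and ?c = "\<lambda>e. f (homogeneous_part M (e - d) x)"
  have "homogeneous_part N (d + e) (f x) = ?c (d + e)"
  proof (rule N.homogeneous_part_unique)
    show "finite ((+) d ` ?S)" using M.finite_homogeneous_support[OF x] by simp
    show "?c e \<in> hcomp N e" for e using hom[OF M.homogeneous_part_hcomp[OF x, of "e - d"]] by simp
    show "?c e = \<zero>\<^bsub>N\<^esub>" if "e \<notin> (+) d ` ?S" for e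
    proof -
      have "e - d \<notin> ?S" using that by (metis add_diff_cancel_left' diff_add_cancel add.commute image_eqI)
      then show ?thesis by (simp add: homogeneous_support_def zero)
    qed
    have "f x = f (\<Oplus>\<^bsub>M\<^esub>e\<in>?S. homogeneous_part M e x)"
      using M.homogeneous_decomposition[OF x] by simp
    also have "\<dots> = (\<Oplus>\<^bsub>N\<^esub>e\<in>?S. f (homogeneous_part M e x))"
      by (rule additive_finsum)
        (use assms zero M.M.abelian_group_axioms N.M.abelian_group_axioms M.finite_homogeneous_support
          M.homogeneous_part_closed in auto)
    also have "\<dots> = (\<Oplus>\<^bsub>N\<^esub>e\<in>(+) d ` ?S. ?c e)"
      by (subst N.M.finsum_reindex) (use assms(3) x M.homogeneous_part_closed in auto)
    finally show "f x = (\<Oplus>\<^bsub>N\<^esub>e\<in>(+) d ` ?S. ?c e)" .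
  qed
  then show ?thesis by simp
qed

lemma gmodule_homI:
  assumes "\<And>x. x \<in> carrier M \<Longrightarrow> f x \<in> carrier N"
    "\<And>x y. x \<in> carrier M \<Longrightarrow> y \<in> carrier M \<Longrightarrow> f (x \<oplus>\<^bsub>M\<^esub> y) = f x \<oplus>\<^bsub>N\<^esub> f y"
    "\<And>a x. a \<in> weyl_carrier \<Longrightarrow> x \<in> carrier M \<Longrightarrow> f (a \<odot>\<^bsub>M\<^esub> x) = a \<odot>\<^bsub>N\<^esub> f x"
    "\<And>e x. x \<in> hcomp M e \<Longrightarrow> f x \<in> hcomp N e"
  shows "f \<in> gmodule_hom M N"
  using assms by (auto simp: gmodule_hom_def)

lemma gmodule_homD:
  assumes "f \<in> gmodule_hom M N"
  shows "f \<in> carrier M \<rightarrow> carrier N" "x \<in> carrier M \<Longrightarrow> f x \<in> carrier N"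
    "x \<in> carrier M \<Longrightarrow> y \<in> carrier M \<Longrightarrow> f (x \<oplus>\<^bsub>M\<^esub> y) = f x \<oplus>\<^bsub>N\<^esub> f y"
    "a \<in> weyl_carrier \<Longrightarrow> x \<in> carrier M \<Longrightarrow> f (a \<odot>\<^bsub>M\<^esub> x) = a \<odot>\<^bsub>N\<^esub> f x"
    "x \<in> hcomp M e \<Longrightarrow> f x \<in> hcomp N e"
  using assms by (simp_all add: gmodule_hom_def Pi_iff image_subset_iff)

lemma gmodule_hom_zero:
  assumes "graded_weyl_module M" "graded_weyl_module N" "f \<in> gmodule_hom M N"
  shows "f \<zero>\<^bsub>M\<^esub> = \<zero>\<^bsub>N\<^esub>"
proof -
  interpret M: graded_weyl_module M by fact
  interpret N: graded_weyl_module N by fact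
  show ?thesis
    by (rule additive_zero) (use gmodule_homD[OF assms(3)] M.M.abelian_group_axioms N.M.abelian_group_axioms in auto)
qed

lemma gmodule_hom_homogeneous_part:
  assumes "graded_weyl_module M" "graded_weyl_module N" "f \<in> gmodule_hom M N" "x \<in> carrier M"
  shows "homogeneous_part N e (f x) = f (homogeneous_part M e x)"
  using homogeneous_part_additive[OF assms(1,2), of f 0 x e] gmodule_homD[OF assms(3)] assms(4) by simp

lemma homogeneous_part_act:
  assumes "graded_weyl_module M" "weyl_homogeneous d a" "x \<in> carrier M"
  shows "homogeneous_part M (d + e) (a \<odot>\<^bsub>M\<^esub> x) = a \<odot>\<^bsub>M\<^esub> homogeneous_part M e x"
proof -
  interpret graded_weyl_module M by fact
  show ?thesis
    by (rule homogeneous_part_additive[OF assms(1,1)])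
      (use weyl_homogeneous_closed[OF assms(2)] assms(3) hcomp_smult[OF assms(2)] in \<open>auto intro: act_closed simp: act_add_right\<close>)
qed

lemma gmodule_hom_compose:
  "f \<in> gmodule_hom L M \<Longrightarrow> g \<in> gmodule_hom M N \<Longrightarrow> (\<lambda>x. g (f x)) \<in> gmodule_hom L N"
  by (intro gmodule_homI) (auto simp: gmodule_homD)

lemma gmodule_hom_diff:
  fixes M :: "('n::finite, 'k::field_char_0, 'v) weyl_gmodule" and N :: "('n, 'k, 'w) weyl_gmodule"
  assumes "graded_weyl_module N" "f \<in> gmodule_hom M N" "g \<in> gmodule_hom M N"
  shows "(\<lambda>x. f x \<ominus>\<^bsub>N\<^esub> g x) \<in> gmodule_hom M N"
proof -
  interpret N: graded_weyl_module N by fact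
  note f = gmodule_homD[OF assms(2)] and g = gmodule_homD[OF assms(3)]
  show ?thesis
  proof (rule gmodule_homI)
    fix x y assume "x \<in> carrier M" "y \<in> carrier M"
    then show "f (x \<oplus>\<^bsub>M\<^esub> y) \<ominus>\<^bsub>N\<^esub> g (x \<oplus>\<^bsub>M\<^esub> y) = f x \<ominus>\<^bsub>N\<^esub> g x \<oplus>\<^bsub>N\<^esub> (f y \<ominus>\<^bsub>N\<^esub> g y)"
      using f(2) g(2) by (simp add: f(3) g(3) a_minus_def N.M.minus_add N.M.a_ac)
  next
    fix a :: "('n, 'k) operator" and x assume a: "a \<in> weyl_carrier" and x: "x \<in> carrier M"
    have "a \<odot>\<^bsub>N\<^esub> (\<ominus>\<^bsub>N\<^esub> g x) = (a \<circ> mult_op (Const (- 1))) \<odot>\<^bsub>N\<^esub> g x"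
      using g(2)[OF x] a by (simp only: weyl_carrier.Const N.act_comp N.neg_act)
    also have "a \<circ> mult_op (Const (- 1)) = mult_op (Const (- 1)) \<circ> a"
      by (simp add: fun_eq_iff mult_op_def weyl_Const[OF a])
    also have "\<dots> \<odot>\<^bsub>N\<^esub> g x = \<ominus>\<^bsub>N\<^esub> (a \<odot>\<^bsub>N\<^esub> g x)"
      using g(2)[OF x] a by (simp only: weyl_carrier.Const N.act_comp N.neg_act N.act_closed)
    finally show "f (a \<odot>\<^bsub>M\<^esub> x) \<ominus>\<^bsub>N\<^esub> g (a \<odot>\<^bsub>M\<^esub> x) = a \<odot>\<^bsub>N\<^esub> (f x \<ominus>\<^bsub>N\<^esub> g x)"
      using a x f(2) g(2) by (simp add: f(4) g(4) a_minus_def N.act_add_right)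
  next
    fix e x assume "x \<in> hcomp M e"
    then show "f x \<ominus>\<^bsub>N\<^esub> g x \<in> hcomp N e"
      unfolding a_minus_def
      by (intro N.hcomp_add additive_subgroup.a_inv_closed[OF N.hcomp_subgroup] f(5) g(5))
  qed (simp add: f g)
qed

subsection \<open>The central endomorphism given by the Euler operator\<close>

text \<open>
  The operator \<open>\<E> - |w|\<close> depends on the degree of the element \<open>w\<close> to which it is applied. Just
  because of this twist the resulting additive map is linear over the Weyl algebra and commutes with
  every morphism: it is an element of the centre of the category of graded modules.
\<close>

definition euler_endo :: "nat \<Rightarrow> ('n::finite, 'k::field_char_0, 'm) weyl_gmodule \<Rightarrow> 'm \<Rightarrow> 'm" where
  "euler_endo a M x = (\<Oplus>\<^bsub>M\<^esub>e\<in>homogeneous_support M x. euler_power a e \<odot>\<^bsub>M\<^esub> homogeneous_part M e x)"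

context graded_weyl_module
begin

lemma euler_power_act_closed: "x \<in> carrier M \<Longrightarrow> euler_power a e \<odot>\<^bsub>M\<^esub> x \<in> carrier M"
  by (rule act_closed[OF weyl_homogeneous_closed[OF euler_power_homogeneous]])

lemma euler_power_act_hcomp: "x \<in> hcomp M e \<Longrightarrow> euler_power a e' \<odot>\<^bsub>M\<^esub> x \<in> hcomp M e"
  using hcomp_smult[OF euler_power_homogeneous] by fastforce

lemma euler_power_act_add: "x \<in> carrier M \<Longrightarrow> y \<in> carrier M \<Longrightarrow>
  euler_power a e \<odot>\<^bsub>M\<^esub> (x \<oplus>\<^bsub>M\<^esub> y) = euler_power a e \<odot>\<^bsub>M\<^esub> x \<oplus>\<^bsub>M\<^esub> euler_power a e \<odot>\<^bsub>M\<^esub> y"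
  by (rule act_add_right[OF weyl_homogeneous_closed[OF euler_power_homogeneous]])

lemma euler_power_act_zero: "euler_power a e \<odot>\<^bsub>M\<^esub> \<zero>\<^bsub>M\<^esub> = \<zero>\<^bsub>M\<^esub>"
  by (rule act_zero[OF weyl_homogeneous_closed[OF euler_power_homogeneous]])

lemma euler_endo_closed: "x \<in> carrier M \<Longrightarrow> euler_endo a M x \<in> carrier M"
  unfolding euler_endo_def
  by (rule M.finsum_closed) (auto intro: euler_power_act_closed homogeneous_part_closed)

lemma euler_endo_superset:
  assumes "x \<in> carrier M" "finite A" "homogeneous_support M x \<subseteq> A"
  shows "euler_endo a M x = (\<Oplus>\<^bsub>M\<^esub>e\<in>A. euler_power a e \<odot>\<^bsub>M\<^esub> homogeneous_part M e x)"
  unfolding euler_endo_def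
  by (rule M.add.finprod_mono_neutral_cong_left[OF assms(2,3)])
    (auto simp: homogeneous_support_def euler_power_act_zero
      intro: euler_power_act_closed homogeneous_part_closed assms(1))

lemma euler_endo_homogeneous:
  assumes "x \<in> hcomp M e"
  shows "euler_endo a M x = euler_power a e \<odot>\<^bsub>M\<^esub> x"
proof -
  note x = hcomp_closed[OF assms]
  have "homogeneous_support M x \<subseteq> {e}"
    by (auto simp: homogeneous_support_def homogeneous_part_of_homogeneous[OF assms] split: if_splits)
  from euler_endo_superset[OF x _ this] show ?thesis
    using euler_power_act_closed[OF x]
    by (simp add: M.finsum_insert homogeneous_part_of_homogeneous[OF assms])
qed

lemma euler_endo_add:
  assumes "x \<in> carrier M" "y \<in> carrier M"
  shows "euler_endo a M (x \<oplus>\<^bsub>M\<^esub> y) = euler_endo a M x \<oplus>\<^bsub>M\<^esub> euler_endo a M y"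
proof -
  let ?A = "homogeneous_support M x \<union> homogeneous_support M y \<union> homogeneous_support M (x \<oplus>\<^bsub>M\<^esub> y)"
  have A: "finite ?A" using finite_homogeneous_support assms by simp
  have "euler_endo a M (x \<oplus>\<^bsub>M\<^esub> y) = (\<Oplus>\<^bsub>M\<^esub>e\<in>?A. euler_power a e \<odot>\<^bsub>M\<^esub> homogeneous_part M e x
      \<oplus>\<^bsub>M\<^esub> euler_power a e \<odot>\<^bsub>M\<^esub> homogeneous_part M e y)"
    using assms A
    by (simp add: euler_endo_superset[of _ ?A] homogeneous_part_add euler_power_act_add homogeneous_part_closed)
  also have "\<dots> = (\<Oplus>\<^bsub>M\<^esub>e\<in>?A. euler_power a e \<odot>\<^bsub>M\<^esub> homogeneous_part M e x)
      \<oplus>\<^bsub>M\<^esub> (\<Oplus>\<^bsub>M\<^esub>e\<in>?A. euler_power a e \<odot>\<^bsub>M\<^esub> homogeneous_part M e y)"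
    using assms by (intro M.finsum_addf) (auto intro: euler_power_act_closed homogeneous_part_closed)
  also have "\<dots> = euler_endo a M x \<oplus>\<^bsub>M\<^esub> euler_endo a M y"
    by (subst (1 2) euler_endo_superset[OF _ A]) (use assms in auto)
  finally show ?thesis .
qed

lemma euler_endo_act_homogeneous:
  assumes b: "weyl_homogeneous d b" and "x \<in> carrier M"
  shows "euler_endo a M (b \<odot>\<^bsub>M\<^esub> x) = b \<odot>\<^bsub>M\<^esub> euler_endo a M x"
  using assms(2)
proof (induction x rule: homogeneous_induct)
  case (homogeneous e x)
  note bc = weyl_homogeneous_closed[OF b] and x = hcomp_closed[OF homogeneous]
  note E = weyl_homogeneous_closed[OF euler_power_homogeneous]
  have "euler_endo a M (b \<odot>\<^bsub>M\<^esub> x) = (euler_power a (d + e) \<circ> b) \<odot>\<^bsub>M\<^esub> x"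
    unfolding act_comp[OF E bc x] by (rule euler_endo_homogeneous[OF hcomp_smult[OF b homogeneous]])
  also have "\<dots> = (b \<circ> euler_power a e) \<odot>\<^bsub>M\<^esub> x" by (simp only: euler_power_commute[OF b])
  also have "\<dots> = b \<odot>\<^bsub>M\<^esub> euler_endo a M x"
    unfolding act_comp[OF bc E x] euler_endo_homogeneous[OF homogeneous] ..
  finally show ?case .
next
  case (add x y)
  then show ?case using weyl_homogeneous_closed[OF b]
    by (simp add: act_add_right euler_endo_add euler_endo_closed act_closed)
qed

lemma euler_endo_act:
  assumes "b \<in> weyl_carrier" "x \<in> carrier M"
  shows "euler_endo a M (b \<odot>\<^bsub>M\<^esub> x) = b \<odot>\<^bsub>M\<^esub> euler_endo a M x"
  using assms
proof (induction b arbitrary: x rule: weyl_carrier.induct)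
  case (add b c)
  then show ?case by (simp add: act_add_left euler_endo_add euler_endo_closed act_closed)
next
  case (mult b c)
  then show ?case by (simp only: act_comp euler_endo_closed act_closed)
qed (auto intro: euler_endo_act_homogeneous weyl_homogeneous.Const weyl_homogeneous.X weyl_homogeneous.D)

lemma euler_endo_hom: "euler_endo a M \<in> gmodule_hom M M"
  by (rule gmodule_homI)
    (auto simp: euler_endo_closed euler_endo_add euler_endo_act euler_endo_homogeneous intro: euler_power_act_hcomp)

end

lemma euler_endo_natural:
  assumes "graded_weyl_module M" "graded_weyl_module N" "f \<in> gmodule_hom M N" "x \<in> carrier M"
  shows "euler_endo a N (f x) = f (euler_endo a M x)"
proof -
  interpret M: graded_weyl_module M by fact
  interpret N: graded_weyl_module N by fact
  note f = gmodule_homD[OF assms(3)]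
  show ?thesis using assms(4)
  proof (induction x rule: M.homogeneous_induct)
    case (homogeneous e x)
    then show ?case
      using f(4)[OF weyl_homogeneous_closed[OF euler_power_homogeneous] M.hcomp_closed]
      by (simp add: M.euler_endo_homogeneous N.euler_endo_homogeneous f(5))
  next
    case (add x y)
    then show ?case by (simp add: f(2,3) M.euler_endo_add N.euler_endo_add M.euler_endo_closed)
  qed
qed

text \<open>The exponent is a parameter here because local cohomology preserves it, while the strongly
  generalized Eulerian property only records that some exponent exists.\<close>

definition eulerian_of_exponent :: "nat \<Rightarrow> ('n::finite, 'k::field_char_0, 'm) weyl_gmodule \<Rightarrow> bool" where
  "eulerian_of_exponent a M \<longleftrightarrow> graded_weyl_module M \<and>
     (\<forall>e. \<forall>w\<in>hcomp M e. euler_power a e \<odot>\<^bsub>M\<^esub> w = \<zero>\<^bsub>M\<^esub>)"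

lemma strongly_generalized_Eulerian_iff:
  "strongly_generalized_Eulerian M \<longleftrightarrow> (\<exists>a>0. eulerian_of_exponent a M)"
  unfolding strongly_generalized_Eulerian_def eulerian_of_exponent_def euler_minus_def by auto

lemma eulerian_of_exponent_endo:
  assumes "eulerian_of_exponent a M" "x \<in> carrier M"
  shows "euler_endo a M x = \<zero>\<^bsub>M\<^esub>"
proof -
  interpret graded_weyl_module M using assms(1) by (simp add: eulerian_of_exponent_def)
  show ?thesis using assms(2)
  proof (induction x rule: homogeneous_induct)
    case (homogeneous e x)
    then show ?case using assms(1) by (simp add: euler_endo_homogeneous eulerian_of_exponent_def)
  qed (simp add: euler_endo_add)
qed

section \<open>Submodules, quotients and isomorphic copies\<close>

text \<open>Quotients and isomorphic copies are both images of a surjective map. The kernel condition says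
  that the kernel is a graded submodule, which is what makes the sum of the components of \<open>N\<close> direct:
  two decompositions of an element of \<open>N\<close> lift to elements of \<open>M\<close> that differ by an element of the
  kernel, hence each homogeneous part of one differs from that of the other by an element of the kernel.\<close>

lemma graded_weyl_module_epimorphic_image:
  fixes M :: "('n::finite, 'k::field_char_0, 'v) weyl_gmodule"
    and N :: "('n, 'k, 'w) weyl_gmodule"
  assumes "graded_weyl_module M"
    and f: "f \<in> gmodule_hom M N" and surj: "f ` carrier M = carrier N" and zero: "f \<zero>\<^bsub>M\<^esub> = \<zero>\<^bsub>N\<^esub>"
    and hcomp: "\<And>e. f ` hcomp M e = hcomp N e"
    and ker: "\<And>x e. x \<in> carrier M \<Longrightarrow> f x = \<zero>\<^bsub>N\<^esub> \<Longrightarrow> f (homogeneous_part M e x) = \<zero>\<^bsub>N\<^esub>"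
  shows "graded_weyl_module N"
proof -
  interpret M: graded_weyl_module M by fact
  note fD = gmodule_homD[OF f]
  have lift: "\<exists>x\<in>carrier M. f x = y" if "y \<in> carrier N" for y
    using that surj by (metis imageE)
  have hlift: "\<exists>x\<in>hcomp M e. f x = y" if "y \<in> hcomp N e" for y e
    using that unfolding hcomp[symmetric] by blast
  have group: "abelian_group N"
  proof (rule abelian_groupI)
    fix x y assume "x \<in> carrier N" "y \<in> carrier N"
    then show "x \<oplus>\<^bsub>N\<^esub> y \<in> carrier N" "x \<oplus>\<^bsub>N\<^esub> y = y \<oplus>\<^bsub>N\<^esub> x"
      by (metis lift fD(2,3) M.M.a_closed, metis lift fD(3) M.M.a_comm)
  next
    show "\<zero>\<^bsub>N\<^esub> \<in> carrier N" using fD(2)[of "\<zero>\<^bsub>M\<^esub>"] zero by simp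
  next
    fix x y z assume "x \<in> carrier N" "y \<in> carrier N" "z \<in> carrier N"
    from this[THEN lift] obtain u v w where "u \<in> carrier M" "f u = x" "v \<in> carrier M" "f v = y"
      "w \<in> carrier M" "f w = z" by blast
    then show "x \<oplus>\<^bsub>N\<^esub> y \<oplus>\<^bsub>N\<^esub> z = x \<oplus>\<^bsub>N\<^esub> (y \<oplus>\<^bsub>N\<^esub> z)"
      by (auto simp: M.M.a_assoc simp flip: fD(3))
  next
    fix x assume "x \<in> carrier N"
    then obtain u where u: "u \<in> carrier M" "f u = x" using lift by blast
    then show "\<zero>\<^bsub>N\<^esub> \<oplus>\<^bsub>N\<^esub> x = x" by (metis fD(3) zero M.M.l_zero M.M.zero_closed)
    show "\<exists>y\<in>carrier N. y \<oplus>\<^bsub>N\<^esub> x = \<zero>\<^bsub>N\<^esub>"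
      using u by (intro bexI[of _ "f (\<ominus>\<^bsub>M\<^esub> u)"]) (auto simp: fD zero M.M.l_neg simp flip: fD(3))
  qed
  then interpret N: abelian_group N .
  have module: "left_module weyl N"
  proof (intro left_module.intro left_module_axioms.intro weyl_ring group, unfold weyl_simps)
    fix a :: "('n, 'k) operator" and x assume a: "a \<in> weyl_carrier" and "x \<in> carrier N"
    then obtain u where u: "u \<in> carrier M" "f u = x" using lift by blast
    show "a \<odot>\<^bsub>N\<^esub> x \<in> carrier N"
      using fD(2)[OF M.act_closed[OF a u(1)]] fD(4)[OF a u(1)] u by simp
    fix b :: "('n, 'k) operator" assume b: "b \<in> weyl_carrier"
    show "(\<lambda>p. a p + b p) \<odot>\<^bsub>N\<^esub> x = a \<odot>\<^bsub>N\<^esub> x \<oplus>\<^bsub>N\<^esub> b \<odot>\<^bsub>N\<^esub> x"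
      using fD(4)[OF weyl_carrier.add[OF a b] u(1)] fD(4)[OF a u(1)] fD(4)[OF b u(1)] u
        fD(3)[OF M.act_closed[OF a u(1)] M.act_closed[OF b u(1)]] M.act_add_left[OF a b u(1)] by simp
    show "(a \<circ> b) \<odot>\<^bsub>N\<^esub> x = a \<odot>\<^bsub>N\<^esub> (b \<odot>\<^bsub>N\<^esub> x)"
      by (metis fD(4) M.act_comp M.act_closed weyl_carrier.mult a b u)
  next
    fix a :: "('n, 'k) operator" and x y assume a: "a \<in> weyl_carrier" and "x \<in> carrier N" "y \<in> carrier N"
    then obtain u v where u: "u \<in> carrier M" "f u = x" "v \<in> carrier M" "f v = y" using lift by blast
    then show "a \<odot>\<^bsub>N\<^esub> (x \<oplus>\<^bsub>N\<^esub> y) = a \<odot>\<^bsub>N\<^esub> x \<oplus>\<^bsub>N\<^esub> a \<odot>\<^bsub>N\<^esub> y"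
      using a by (auto simp: M.act_add_right M.act_closed simp flip: fD(3,4))
  next
    fix x assume "x \<in> carrier N"
    then obtain u where u: "u \<in> carrier M" "f u = x" using lift by blast
    then show "id \<odot>\<^bsub>N\<^esub> x = x" by (metis fD(4) M.act_id weyl_id)
  qed
  have neg: "f (\<ominus>\<^bsub>M\<^esub> u) = \<ominus>\<^bsub>N\<^esub> f u" if "u \<in> carrier M" for u
    using fD(3)[of "\<ominus>\<^bsub>M\<^esub> u" u] that by (simp add: M.M.l_neg zero fD(2) N.minus_equality)
  have sub: "additive_subgroup (hcomp N e) N" for e
  proof (intro additive_subgroup.intro subgroup.intro)
    have sc: "hcomp N e \<subseteq> carrier N"
    proof
      fix y assume "y \<in> hcomp N e"
      then obtain u where "u \<in> hcomp M e" "f u = y" using hlift by blast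
      with fD(2)[OF M.hcomp_closed] show "y \<in> carrier N" by blast
    qed
    then show "hcomp N e \<subseteq> carrier (add_monoid N)" by simp
    fix x y assume "x \<in> hcomp N e"
    then obtain u where u: "u \<in> hcomp M e" "f u = x" using hlift by blast
    have "f (\<ominus>\<^bsub>M\<^esub> u) \<in> hcomp N e"
      by (rule fD(5)[OF additive_subgroup.a_inv_closed[OF M.hcomp_subgroup u(1)]])
    then show "inv\<^bsub>add_monoid N\<^esub> x \<in> hcomp N e"
      using neg[OF M.hcomp_closed[OF u(1)]] u by (simp add: a_inv_def)
    assume "y \<in> hcomp N e"
    then obtain v where v: "v \<in> hcomp M e" "f v = y" using hlift by blast
    show "x \<otimes>\<^bsub>add_monoid N\<^esub> y \<in> hcomp N e"
      using fD(5)[OF M.hcomp_add[OF u(1) v(1)]] fD(3)[OF M.hcomp_closed[OF u(1)] M.hcomp_closed[OF v(1)]] u v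
      by simp
  next
    show "\<one>\<^bsub>add_monoid N\<^esub> \<in> hcomp N e" using fD(5)[OF M.hcomp_zero] zero by simp
  qed
  have f_finsum: "f (\<Oplus>\<^bsub>M\<^esub>e\<in>A. c e) = (\<Oplus>\<^bsub>N\<^esub>e\<in>A. f (c e))"
    if "finite A" "\<And>e. e \<in> A \<Longrightarrow> c e \<in> carrier M" for A :: "int set" and c
    by (rule additive_finsum[OF M.M.abelian_group_axioms group]) (use fD zero that in auto)
  show ?thesis
  proof (intro graded_weyl_module.intro module graded_weyl_module_axioms.intro)
    fix e show "additive_subgroup (hcomp N e) N" by (rule sub)
  next
    fix e e' and a :: "('n, 'k) operator" and x
    assume a: "weyl_homogeneous e a" and "x \<in> hcomp N e'"
    then obtain u where u: "u \<in> hcomp M e'" "f u = x" using hlift by blast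
    show "a \<odot>\<^bsub>N\<^esub> x \<in> hcomp N (e + e')"
      using fD(5)[OF M.hcomp_smult[OF a u(1)]] fD(4)[OF weyl_homogeneous_closed[OF a] M.hcomp_closed[OF u(1)]] u
      by simp
  next
    fix y assume "y \<in> carrier N"
    then obtain x where x: "x \<in> carrier M" "y = f x" using lift by blast
    let ?c = "\<lambda>e. f (homogeneous_part M e x)" and ?S = "homogeneous_support M x"
    have c: "?c e \<in> hcomp N e" for e by (rule fD(5)[OF M.homogeneous_part_hcomp[OF x(1)]])
    have supp: "{e. ?c e \<noteq> \<zero>\<^bsub>N\<^esub>} \<subseteq> ?S" by (auto simp: homogeneous_support_def zero)
    have "y = (\<Oplus>\<^bsub>N\<^esub>e\<in>?S. ?c e)"
      using f_finsum[OF M.finite_homogeneous_support[OF x(1)], of "\<lambda>e. homogeneous_part M e x"]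
        M.homogeneous_part_closed[OF x(1)] M.homogeneous_decomposition[OF x(1)] x(2) by simp
    also have "\<dots> = (\<Oplus>\<^bsub>N\<^esub>e\<in>{e. ?c e \<noteq> \<zero>\<^bsub>N\<^esub>}. ?c e)"
      by (rule N.add.finprod_mono_neutral_cong_right[OF M.finite_homogeneous_support[OF x(1)] supp])
        (auto intro: fD(2) M.homogeneous_part_closed x)
    finally have y: "y = (\<Oplus>\<^bsub>N\<^esub>e\<in>{e. ?c e \<noteq> \<zero>\<^bsub>N\<^esub>}. ?c e)" .
    have unique: "c = ?c"
      if c: "\<And>e. c e \<in> hcomp N e" and fin: "finite {e. c e \<noteq> \<zero>\<^bsub>N\<^esub>}"
        and y: "y = (\<Oplus>\<^bsub>N\<^esub>e\<in>{e. c e \<noteq> \<zero>\<^bsub>N\<^esub>}. c e)" for c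
    proof
      fix e
      let ?T = "{e. c e \<noteq> \<zero>\<^bsub>N\<^esub>}"
      \<comment> \<open>Lifting zero summands to zero keeps the support of the lifted family finite.\<close>
      define b where "b e = (if c e = \<zero>\<^bsub>N\<^esub> then \<zero>\<^bsub>M\<^esub> else SOME u. u \<in> hcomp M e \<and> f u = c e)" for e
      have b: "b e \<in> hcomp M e" "f (b e) = c e" for e
      proof -
        have "\<exists>u. u \<in> hcomp M e \<and> f u = c e" using hlift[OF c[of e]] by blast
        from someI_ex[OF this] show "b e \<in> hcomp M e" "f (b e) = c e"
          by (auto simp: b_def M.hcomp_zero zero)
      qed
      define x' where "x' = (\<Oplus>\<^bsub>M\<^esub>e\<in>?T. b e)"
      have x': "x' \<in> carrier M" unfolding x'_def by (rule M.M.finsum_closed) (auto intro: M.hcomp_closed b)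
      have part: "homogeneous_part M e x' = b e" for e
      proof (rule M.homogeneous_part_unique[OF fin b(1) _ x'_def])
        show "e \<notin> ?T \<Longrightarrow> b e = \<zero>\<^bsub>M\<^esub>" for e by (simp add: b_def)
      qed
      have "f x' = f x"
        using f_finsum[OF fin, of b] M.hcomp_closed[OF b(1)] x(2) y by (simp add: x'_def b)
      then have "f (x \<oplus>\<^bsub>M\<^esub> \<ominus>\<^bsub>M\<^esub> x') = \<zero>\<^bsub>N\<^esub>"
        using x(1) x' fD(2)[OF x'] by (simp add: fD(3) neg N.r_neg)
      then have "f (homogeneous_part M e (x \<oplus>\<^bsub>M\<^esub> \<ominus>\<^bsub>M\<^esub> x')) = \<zero>\<^bsub>N\<^esub>"
        using x(1) x' by (intro ker) auto
      moreover have "x = (x \<oplus>\<^bsub>M\<^esub> \<ominus>\<^bsub>M\<^esub> x') \<oplus>\<^bsub>M\<^esub> x'"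
        using x(1) x' by (simp add: M.M.a_assoc M.M.l_neg)
      then have "homogeneous_part M e x = homogeneous_part M e (x \<oplus>\<^bsub>M\<^esub> \<ominus>\<^bsub>M\<^esub> x') \<oplus>\<^bsub>M\<^esub> b e"
        using M.homogeneous_part_add[of "x \<oplus>\<^bsub>M\<^esub> \<ominus>\<^bsub>M\<^esub> x'" x' e] x(1) x' part by simp
      ultimately show "c e = ?c e"
        using fD(2)[OF M.hcomp_closed[OF b(1)]] b x(1) x'
        by (simp add: fD(3) M.hcomp_closed[OF b(1)] M.homogeneous_part_closed)
    qed
    show "\<exists>!c. (\<forall>e. c e \<in> hcomp N e) \<and> finite {e. c e \<noteq> \<zero>\<^bsub>N\<^esub>} \<and> y = (\<Oplus>\<^bsub>N\<^esub>e\<in>{e. c e \<noteq> \<zero>\<^bsub>N\<^esub>}. c e)"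
      by (rule ex1I[of _ ?c])
        (use c finite_subset[OF supp M.finite_homogeneous_support[OF x(1)]] y unique in blast)+
  qed
qed

definition graded_submodule :: "('n::finite, 'k::field_char_0, 'm) weyl_gmodule \<Rightarrow> 'm set \<Rightarrow> bool" where
  "graded_submodule M S \<longleftrightarrow> S \<subseteq> carrier M \<and> \<zero>\<^bsub>M\<^esub> \<in> S \<and> (\<forall>x\<in>S. \<forall>y\<in>S. x \<oplus>\<^bsub>M\<^esub> y \<in> S) \<and>
     (\<forall>a\<in>weyl_carrier. \<forall>x\<in>S. a \<odot>\<^bsub>M\<^esub> x \<in> S) \<and> (\<forall>x\<in>S. \<forall>e. homogeneous_part M e x \<in> S)"

lemma graded_submoduleD:
  assumes "graded_submodule M S"
  shows "x \<in> S \<Longrightarrow> x \<in> carrier M" "\<zero>\<^bsub>M\<^esub> \<in> S" "x \<in> S \<Longrightarrow> y \<in> S \<Longrightarrow> x \<oplus>\<^bsub>M\<^esub> y \<in> S"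
    "a \<in> weyl_carrier \<Longrightarrow> x \<in> S \<Longrightarrow> a \<odot>\<^bsub>M\<^esub> x \<in> S" "x \<in> S \<Longrightarrow> homogeneous_part M e x \<in> S"
  using assms by (auto simp: graded_submodule_def)

lemma gsub_simps [simp]:
  "carrier (gsub M S) = S" "zero (gsub M S) = zero M" "add (gsub M S) = add M"
  "smult (gsub M S) = smult M" "hcomp (gsub M S) e = hcomp M e \<inter> S"
  by (simp_all add: gsub_def)

lemma a_r_coset_gsub [simp]: "B +>\<^bsub>gsub M S\<^esub> x = B +>\<^bsub>M\<^esub> x"
  by (simp add: a_r_coset_def')

lemma graded_submodule_minus:
  assumes "graded_weyl_module M" "graded_submodule M S" "x \<in> S"
  shows "\<ominus>\<^bsub>M\<^esub> x \<in> S"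
proof -
  interpret graded_weyl_module M by fact
  show ?thesis
    using graded_submoduleD(4)[OF assms(2) weyl_carrier.Const assms(3)] neg_act
      graded_submoduleD(1)[OF assms(2,3)] by metis
qed

lemma graded_submodule_additive_subgroup:
  assumes "graded_weyl_module M" "graded_submodule M S"
  shows "additive_subgroup S M"
  using graded_submoduleD[OF assms(2)] graded_submodule_minus[OF assms]
  by (intro additive_subgroup.intro subgroup.intro) (auto simp: a_inv_def)

lemma graded_submodule_gsub_eq:
  assumes "graded_submodule M S"
  shows "(\<lambda>x. x) \<in> gmodule_hom (gsub M S) M"
  using graded_submoduleD[OF assms] by (intro gmodule_homI) auto

lemma graded_weyl_module_gsub:
  fixes M :: "('n::finite, 'k::field_char_0, 'm) weyl_gmodule"
  assumes "graded_weyl_module M" and S: "graded_submodule M S"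
  shows "graded_weyl_module (gsub M S)"
proof -
  interpret M: graded_weyl_module M by fact
  note SD = graded_submoduleD[OF S] and neg = graded_submodule_minus[OF assms]
  have group: "abelian_group (gsub M S)"
  proof (rule abelian_groupI)
    fix x assume "x \<in> carrier (gsub M S)"
    then show "\<exists>y\<in>carrier (gsub M S). y \<oplus>\<^bsub>gsub M S\<^esub> x = \<zero>\<^bsub>gsub M S\<^esub>"
      using neg[of x] SD(1) by (auto intro!: bexI[of _ "\<ominus>\<^bsub>M\<^esub> x"] simp: M.M.l_neg)
  qed (auto simp: SD M.M.a_ac)
  then interpret gsub: abelian_group "gsub M S" .
  have inv: "inv\<^bsub>add_monoid (gsub M S)\<^esub> x = \<ominus>\<^bsub>M\<^esub> x" if "x \<in> S" for x
  proof -
    have "\<ominus>\<^bsub>gsub M S\<^esub> x = \<ominus>\<^bsub>M\<^esub> x"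
      using that neg[OF that] SD(1) by (intro gsub.minus_equality) (auto simp: M.M.l_neg)
    then show ?thesis by (simp add: a_inv_def)
  qed
  have module: "left_module weyl (gsub M S)"
    by (intro left_module.intro left_module_axioms.intro weyl_ring group, unfold weyl_simps)
      (simp_all only: gsub_simps SD M.act_add_left M.act_add_right M.act_comp M.act_id)
  have finsum: "(\<Oplus>\<^bsub>gsub M S\<^esub>e\<in>A. c e) = (\<Oplus>\<^bsub>M\<^esub>e\<in>A. c e)"
    if "finite A" "\<And>e. e \<in> A \<Longrightarrow> c e \<in> S" for A :: "int set" and c
    using additive_finsum[OF group M.M.abelian_group_axioms, of "\<lambda>x. x" A c] that SD(1) by auto
  show ?thesis
  proof (intro graded_weyl_module.intro module graded_weyl_module_axioms.intro)
    fix e show "additive_subgroup (hcomp (gsub M S) e) (gsub M S)"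
      by (intro additive_subgroup.intro subgroup.intro)
        (auto simp: SD inv[simplified] neg M.hcomp_add M.hcomp_zero additive_subgroup.a_inv_closed[OF M.hcomp_subgroup])
  next
    fix e e' and a :: "('n, 'k) operator" and x
    assume "weyl_homogeneous e a" "x \<in> hcomp (gsub M S) e'"
    then show "a \<odot>\<^bsub>gsub M S\<^esub> x \<in> hcomp (gsub M S) (e + e')"
      using M.hcomp_smult SD(4)[OF weyl_homogeneous_closed] by auto
  next
    fix x assume "x \<in> carrier (gsub M S)"
    then have x: "x \<in> S" by simp
    note xM = SD(1)[OF x]
    show "\<exists>!c. (\<forall>e. c e \<in> hcomp (gsub M S) e) \<and> finite {e. c e \<noteq> \<zero>\<^bsub>gsub M S\<^esub>} \<and>
        x = (\<Oplus>\<^bsub>gsub M S\<^esub>e\<in>{e. c e \<noteq> \<zero>\<^bsub>gsub M S\<^esub>}. c e)"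
    proof (rule ex1I[of _ "\<lambda>e. homogeneous_part M e x"])
      show "(\<forall>e. homogeneous_part M e x \<in> hcomp (gsub M S) e) \<and>
          finite {e. homogeneous_part M e x \<noteq> \<zero>\<^bsub>gsub M S\<^esub>} \<and>
          x = (\<Oplus>\<^bsub>gsub M S\<^esub>e\<in>{e. homogeneous_part M e x \<noteq> \<zero>\<^bsub>gsub M S\<^esub>}. homogeneous_part M e x)"
        using M.homogeneous_part_spec[OF xM] SD(5)[OF x] finsum by (simp add: homogeneous_support_def)
    next
      fix c assume c: "(\<forall>e. c e \<in> hcomp (gsub M S) e) \<and> finite {e. c e \<noteq> \<zero>\<^bsub>gsub M S\<^esub>} \<and>
        x = (\<Oplus>\<^bsub>gsub M S\<^esub>e\<in>{e. c e \<noteq> \<zero>\<^bsub>gsub M S\<^esub>}. c e)"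
      then have "homogeneous_part M e x = c e" for e
        by (intro M.homogeneous_part_unique[of "{e. c e \<noteq> \<zero>\<^bsub>M\<^esub>}"]) (auto simp: finsum)
      then show "c = (\<lambda>e. homogeneous_part M e x)" by auto
    qed
  qed
qed

lemma homogeneous_part_gsub:
  assumes "graded_weyl_module M" "graded_submodule M S" "x \<in> S"
  shows "homogeneous_part (gsub M S) e x = homogeneous_part M e x"
  using gmodule_hom_homogeneous_part[OF graded_weyl_module_gsub[OF assms(1,2)] assms(1)
      graded_submodule_gsub_eq[OF assms(2)], of x e] assms(3) by simp

lemma graded_submodule_gsub:
  assumes "graded_weyl_module M" "graded_submodule M S" "graded_submodule M B" "B \<subseteq> S"
  shows "graded_submodule (gsub M S) B"
proof -
  have "homogeneous_part (gsub M S) e x = homogeneous_part M e x" if "x \<in> B" for e x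
    using homogeneous_part_gsub[OF assms(1,2)] that assms(4) by blast
  then show ?thesis
    using assms(3,4) by (simp add: graded_submodule_def)
qed

lemma graded_submodule_zero:
  assumes "graded_weyl_module M"
  shows "graded_submodule M {\<zero>\<^bsub>M\<^esub>}"
proof -
  interpret graded_weyl_module M by fact
  show ?thesis
    using homogeneous_part_of_homogeneous[OF hcomp_zero] by (auto simp: graded_submodule_def act_zero)
qed

lemma graded_submodule_kernel:
  assumes "graded_weyl_module M" "graded_weyl_module N" "f \<in> gmodule_hom M N"
  shows "graded_submodule M {x\<in>carrier M. f x = \<zero>\<^bsub>N\<^esub>}"
proof -
  interpret M: graded_weyl_module M by fact
  interpret N: graded_weyl_module N by fact
  have "f (homogeneous_part M e x) = \<zero>\<^bsub>N\<^esub>" if "x \<in> carrier M" "f x = \<zero>\<^bsub>N\<^esub>" for e x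
    using gmodule_hom_homogeneous_part[OF assms that(1), of e] that(2)
      N.homogeneous_part_of_homogeneous[OF N.hcomp_zero] by simp
  then show ?thesis
    using gmodule_homD[OF assms(3)] gmodule_hom_zero[OF assms]
    by (auto simp: graded_submodule_def M.act_closed N.act_zero M.homogeneous_part_closed)
qed

lemma graded_submodule_image:
  assumes "graded_weyl_module M" "graded_weyl_module N" "f \<in> gmodule_hom M N"
  shows "graded_submodule N (f ` carrier M)"
proof -
  interpret M: graded_weyl_module M by fact
  interpret N: graded_weyl_module N by fact
  note f = gmodule_homD[OF assms(3)]
  show ?thesis
    unfolding graded_submodule_def
  proof (intro conjI ballI allI)
    show "f ` carrier M \<subseteq> carrier N" using f by auto
    show "\<zero>\<^bsub>N\<^esub> \<in> f ` carrier M" using gmodule_hom_zero[OF assms] by (metis M.M.zero_closed image_eqI)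
    show "x \<oplus>\<^bsub>N\<^esub> y \<in> f ` carrier M" if "x \<in> f ` carrier M" "y \<in> f ` carrier M" for x y
      using that by (auto simp flip: f(3))
    show "a \<odot>\<^bsub>N\<^esub> x \<in> f ` carrier M" if "a \<in> weyl_carrier" "x \<in> f ` carrier M" for a x
      using that by (auto simp: M.act_closed simp flip: f(4))
    show "homogeneous_part N e x \<in> f ` carrier M" if "x \<in> f ` carrier M" for e x
      using that gmodule_hom_homogeneous_part[OF assms] by (auto simp: M.homogeneous_part_closed)
  qed
qed

lemma UN_eq_common_value: "z \<in> C \<Longrightarrow> (\<And>y. y \<in> C \<Longrightarrow> F y = D) \<Longrightarrow> (\<Union>y\<in>C. F y) = D"
  by auto

locale graded_quotient = M: graded_weyl_module M
  for M :: "('n::finite, 'k::field_char_0, 'm) weyl_gmodule" +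
  fixes S :: "'m set"
  assumes submodule: "graded_submodule M S"
begin

lemma abelian_subgroup: "abelian_subgroup S M"
  by (rule abelian_subgroupI3[OF graded_submodule_additive_subgroup[OF M.graded_weyl_module_axioms submodule]
        M.M.abelian_group_axioms])

lemma coset_self: "x \<in> carrier M \<Longrightarrow> x \<in> S +>\<^bsub>M\<^esub> x"
  using abelian_subgroup.a_rcos_self[OF abelian_subgroup] .

lemma coset_eqI: "x \<in> carrier M \<Longrightarrow> y \<in> S +>\<^bsub>M\<^esub> x \<Longrightarrow> S +>\<^bsub>M\<^esub> y = S +>\<^bsub>M\<^esub> x"
  using abelian_subgroup.a_repr_independence'[OF abelian_subgroup] by metis

lemma coset_memE:
  assumes "y \<in> S +>\<^bsub>M\<^esub> x"
  obtains s where "s \<in> S" "y = s \<oplus>\<^bsub>M\<^esub> x"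
  using assms by (auto simp: a_r_coset_def')

lemma coset_absorb: "s \<in> S \<Longrightarrow> x \<in> carrier M \<Longrightarrow> S +>\<^bsub>M\<^esub> (s \<oplus>\<^bsub>M\<^esub> x) = S +>\<^bsub>M\<^esub> x"
  by (rule coset_eqI) (auto simp: a_r_coset_def')

lemma coset_eq_zero_iff: "x \<in> carrier M \<Longrightarrow> S +>\<^bsub>M\<^esub> x = S \<longleftrightarrow> x \<in> S"
  using coset_self abelian_subgroup.a_rcos_const[OF abelian_subgroup] by metis

lemma coset_add: "x \<in> carrier M \<Longrightarrow> y \<in> carrier M \<Longrightarrow>
    (S +>\<^bsub>M\<^esub> x) <+>\<^bsub>M\<^esub> (S +>\<^bsub>M\<^esub> y) = S +>\<^bsub>M\<^esub> (x \<oplus>\<^bsub>M\<^esub> y)"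
  by (rule abelian_subgroup.a_rcos_sum[OF abelian_subgroup])

lemma gquot_simps:
  "carrier (gquot M S) = (\<lambda>x. S +>\<^bsub>M\<^esub> x) ` carrier M" "\<zero>\<^bsub>gquot M S\<^esub> = S"
  "x \<in> carrier M \<Longrightarrow> y \<in> carrier M \<Longrightarrow>
     (S +>\<^bsub>M\<^esub> x) \<oplus>\<^bsub>gquot M S\<^esub> (S +>\<^bsub>M\<^esub> y) = S +>\<^bsub>M\<^esub> (x \<oplus>\<^bsub>M\<^esub> y)"
  "hcomp (gquot M S) e = (\<lambda>x. S +>\<^bsub>M\<^esub> x) ` hcomp M e"
  by (auto simp: gquot_def A_RCOSETS_def' coset_add)

lemma gquot_act:
  assumes "a \<in> weyl_carrier" "x \<in> carrier M"
  shows "a \<odot>\<^bsub>gquot M S\<^esub> (S +>\<^bsub>M\<^esub> x) = S +>\<^bsub>M\<^esub> (a \<odot>\<^bsub>M\<^esub> x)"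
proof -
  have "S +>\<^bsub>M\<^esub> (a \<odot>\<^bsub>M\<^esub> y) = S +>\<^bsub>M\<^esub> (a \<odot>\<^bsub>M\<^esub> x)" if y: "y \<in> S +>\<^bsub>M\<^esub> x" for y
  proof -
    obtain s where "s \<in> S" "y = s \<oplus>\<^bsub>M\<^esub> x" using coset_memE[OF y] .
    then show ?thesis
      using assms graded_submoduleD(1,4)[OF submodule] by (simp add: M.act_add_right coset_absorb M.act_closed)
  qed
  from UN_eq_common_value[OF coset_self[OF assms(2)] this] show ?thesis by (simp add: gquot_def)
qed

lemma coset_hom: "(\<lambda>x. S +>\<^bsub>M\<^esub> x) \<in> gmodule_hom M (gquot M S)"
  by (rule gmodule_homI) (auto simp: gquot_simps gquot_act)

lemma graded_weyl_module_gquot: "graded_weyl_module (gquot M S)"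
proof (rule graded_weyl_module_epimorphic_image[OF M.graded_weyl_module_axioms coset_hom])
  fix x e assume x: "x \<in> carrier M" and "S +>\<^bsub>M\<^esub> x = \<zero>\<^bsub>gquot M S\<^esub>"
  then have "homogeneous_part M e x \<in> S"
    using graded_submoduleD(5)[OF submodule] by (simp add: gquot_simps coset_eq_zero_iff)
  then show "S +>\<^bsub>M\<^esub> homogeneous_part M e x = \<zero>\<^bsub>gquot M S\<^esub>"
    using x by (simp add: gquot_simps coset_eq_zero_iff M.homogeneous_part_closed)
qed (auto simp: gquot_simps coset_eq_zero_iff graded_submoduleD(2)[OF submodule])

lemma gquot_carrierE:
  assumes "Z \<in> carrier (gquot M S)"
  obtains x where "x \<in> carrier M" "Z = S +>\<^bsub>M\<^esub> x"
  using assms by (auto simp: gquot_simps)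

end

text \<open>The union in the definition of the induced map is taken over equal cosets.\<close>

lemma gquot_map_coset:
  assumes "graded_quotient M S" "graded_quotient N S'" "f \<in> gmodule_hom M N" "\<And>s. s \<in> S \<Longrightarrow> f s \<in> S'"
    and x: "x \<in> carrier M"
  shows "gquot_map N S' f (S +>\<^bsub>M\<^esub> x) = S' +>\<^bsub>N\<^esub> f x"
proof -
  interpret M: graded_quotient M S by fact
  interpret N: graded_quotient N S' by fact
  note f = gmodule_homD[OF assms(3)]
  have "S' +>\<^bsub>N\<^esub> f y = S' +>\<^bsub>N\<^esub> f x" if y: "y \<in> S +>\<^bsub>M\<^esub> x" for y
  proof -
    obtain s where "s \<in> S" "y = s \<oplus>\<^bsub>M\<^esub> x" using M.coset_memE[OF y] .
    then show ?thesis
      using x graded_submoduleD(1)[OF M.submodule] assms(4) by (simp add: f(2,3) N.coset_absorb)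
  qed
  from UN_eq_common_value[OF M.coset_self[OF x] this] show ?thesis by (simp add: gquot_map_def)
qed

lemma gquot_map_hom:
  fixes M :: "('n::finite, 'k::field_char_0, 'v) weyl_gmodule" and N :: "('n, 'k, 'w) weyl_gmodule"
  assumes "graded_quotient M S" "graded_quotient N S'" "f \<in> gmodule_hom M N" "\<And>s. s \<in> S \<Longrightarrow> f s \<in> S'"
  shows "gquot_map N S' f \<in> gmodule_hom (gquot M S) (gquot N S')"
proof -
  interpret M: graded_quotient M S by fact
  interpret N: graded_quotient N S' by fact
  note f = gmodule_homD[OF assms(3)] and map = gquot_map_coset[OF assms]
  show ?thesis
  proof (rule gmodule_homI)
    fix Z assume "Z \<in> carrier (gquot M S)"
    then show "gquot_map N S' f Z \<in> carrier (gquot N S')"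
      by (auto simp: M.gquot_simps N.gquot_simps map f(2))
  next
    fix Z Z' assume "Z \<in> carrier (gquot M S)" "Z' \<in> carrier (gquot M S)"
    then show "gquot_map N S' f (Z \<oplus>\<^bsub>gquot M S\<^esub> Z') = gquot_map N S' f Z \<oplus>\<^bsub>gquot N S'\<^esub> gquot_map N S' f Z'"
      by (auto elim!: M.gquot_carrierE simp: M.gquot_simps N.gquot_simps map f)
  next
    fix a :: "('n, 'k) operator" and Z assume "a \<in> weyl_carrier" "Z \<in> carrier (gquot M S)"
    then show "gquot_map N S' f (a \<odot>\<^bsub>gquot M S\<^esub> Z) = a \<odot>\<^bsub>gquot N S'\<^esub> gquot_map N S' f Z"
      by (auto elim!: M.gquot_carrierE simp: M.gquot_act N.gquot_act map f M.M.act_closed)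
  next
    fix e Z assume "Z \<in> hcomp (gquot M S) e"
    then show "gquot_map N S' f Z \<in> hcomp (gquot N S') e"
      by (auto simp: M.gquot_simps N.gquot_simps map f(5) M.M.hcomp_closed)
  qed
qed

lemma graded_weyl_module_iso:
  assumes "graded_weyl_module M" "gmodule_iso M N"
  shows "graded_weyl_module N"
proof -
  interpret M: graded_weyl_module M by fact
  from assms(2) obtain f where f: "f \<in> gmodule_hom M N" "bij_betw f (carrier M) (carrier N)"
    "f \<zero>\<^bsub>M\<^esub> = \<zero>\<^bsub>N\<^esub>" "\<And>e. f ` hcomp M e = hcomp N e"
    unfolding gmodule_iso_def by blast
  show ?thesis
  proof (rule graded_weyl_module_epimorphic_image[OF assms(1) f(1) _ f(3,4)])
    show "f ` carrier M = carrier N" using f(2) by (simp add: bij_betw_def)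
    fix x e assume x: "x \<in> carrier M" "f x = \<zero>\<^bsub>N\<^esub>"
    then have "x = \<zero>\<^bsub>M\<^esub>" using f(2,3) by (metis M.M.zero_closed bij_betw_inv_into_left)
    then show "f (homogeneous_part M e x) = \<zero>\<^bsub>N\<^esub>"
      using M.homogeneous_part_of_homogeneous[OF M.hcomp_zero] f(3) by simp
  qed
qed

lemma eulerian_gsub:
  assumes "eulerian_of_exponent a M" "graded_submodule M S"
  shows "eulerian_of_exponent a (gsub M S)"
  using assms graded_weyl_module_gsub by (auto simp: eulerian_of_exponent_def)

lemma eulerian_gquot:
  assumes "eulerian_of_exponent a M" "graded_submodule M S"
  shows "eulerian_of_exponent a (gquot M S)"
proof -
  interpret graded_quotient M S
    using assms by (simp add: eulerian_of_exponent_def graded_quotient_def graded_quotient_axioms_def)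
  have "euler_power a e \<odot>\<^bsub>gquot M S\<^esub> (S +>\<^bsub>M\<^esub> x) = \<zero>\<^bsub>gquot M S\<^esub>" if x: "x \<in> hcomp M e" for x e
  proof -
    have "euler_power a e \<odot>\<^bsub>gquot M S\<^esub> (S +>\<^bsub>M\<^esub> x) = S +>\<^bsub>M\<^esub> (euler_power a e \<odot>\<^bsub>M\<^esub> x)"
      by (rule gquot_act[OF weyl_homogeneous_closed[OF euler_power_homogeneous] M.hcomp_closed[OF x]])
    also have "\<dots> = \<zero>\<^bsub>gquot M S\<^esub>"
      using assms x by (simp add: eulerian_of_exponent_def gquot_simps coset_eq_zero_iff graded_submoduleD(2))
    finally show ?thesis .
  qed
  then show ?thesis
    using graded_weyl_module_gquot by (auto simp: eulerian_of_exponent_def gquot_simps)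
qed

lemma eulerian_iso:
  assumes "eulerian_of_exponent a M" "gmodule_iso M N"
  shows "eulerian_of_exponent a N"
proof -
  have M: "graded_weyl_module M" using assms(1) by (simp add: eulerian_of_exponent_def)
  interpret M: graded_weyl_module M by fact
  from assms(2) obtain f where f: "f \<in> gmodule_hom M N"
    "f \<zero>\<^bsub>M\<^esub> = \<zero>\<^bsub>N\<^esub>" "\<And>e. f ` hcomp M e = hcomp N e"
    unfolding gmodule_iso_def by blast
  have "euler_power a e \<odot>\<^bsub>N\<^esub> w = \<zero>\<^bsub>N\<^esub>" if "w \<in> hcomp N e" for e w
  proof -
    from that obtain x where x: "x \<in> hcomp M e" "w = f x" using f(3) by blast
    with assms(1) have "euler_power a e \<odot>\<^bsub>M\<^esub> x = \<zero>\<^bsub>M\<^esub>" by (simp add: eulerian_of_exponent_def)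
    with gmodule_homD(4)[OF f(1) weyl_homogeneous_closed[OF euler_power_homogeneous] M.hcomp_closed[OF x(1)], of e a]
    show ?thesis using x(2) f(2) by simp
  qed
  with graded_weyl_module_iso[OF M assms(2)] show ?thesis by (simp add: eulerian_of_exponent_def)
qed

section \<open>Contracting the Euler endomorphism on an injective resolution\<close>

text \<open>Injectivity of \<open>I\<close> is used for the inclusion of the image of \<open>d\<close> into \<open>N\<close>: through it \<open>\<phi>\<close> factors.
  This inclusion stays within the type of the elements of \<open>N\<close>, over which injectivity is tested.\<close>

lemma graded_injective_factor:
  fixes M N I :: "('n::finite, 'k::field_char_0, 'u) weyl_gmodule"
  assumes M: "graded_weyl_module M" and N: "graded_weyl_module N" and I: "graded_injective I"
    and d: "d \<in> gmodule_hom M N" and \<phi>: "\<phi> \<in> gmodule_hom M I"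
    and ker: "\<And>x. x \<in> carrier M \<Longrightarrow> d x = \<zero>\<^bsub>N\<^esub> \<Longrightarrow> \<phi> x = \<zero>\<^bsub>I\<^esub>"
  obtains h where "h \<in> gmodule_hom N I" "\<And>x. x \<in> carrier M \<Longrightarrow> h (d x) = \<phi> x"
proof -
  have I': "graded_weyl_module I" using I by (simp add: graded_injective_def)
  interpret M: graded_weyl_module M by fact
  interpret N: graded_weyl_module N by fact
  interpret I: graded_weyl_module I by fact
  note dD = gmodule_homD[OF d] and \<phi>D = gmodule_homD[OF \<phi>]
  let ?S = "d ` carrier M"
  have S: "graded_submodule N ?S" by (rule graded_submodule_image[OF M N d])
  define g where "g y = \<phi> (SOME x. x \<in> carrier M \<and> d x = y)" for y
  \<comment> \<open>Elements with the same image under \<open>d\<close> differ by an element of the kernel of \<open>d\<close>, hence of \<open>\<phi>\<close>.\<close>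
  have well_defined: "\<phi> x = \<phi> x'" if x: "x \<in> carrier M" "x' \<in> carrier M" "d x = d x'" for x x'
  proof -
    have "d (x \<ominus>\<^bsub>M\<^esub> x') \<oplus>\<^bsub>N\<^esub> d x' = d x'" "\<phi> (x \<ominus>\<^bsub>M\<^esub> x') \<oplus>\<^bsub>I\<^esub> \<phi> x' = \<phi> x"
      using x by (auto simp: a_minus_def M.M.a_assoc M.M.l_neg simp flip: dD(3) \<phi>D(3))
    note eqs = this
    have "d (x \<ominus>\<^bsub>M\<^esub> x') = \<zero>\<^bsub>N\<^esub>"
      using eqs(1) N.M.add.l_cancel_one[OF dD(2)[OF x(2)] dD(2)[OF M.M.minus_closed[OF x(1,2)]]]
        N.M.a_comm[OF dD(2)[OF x(2)] dD(2)[OF M.M.minus_closed[OF x(1,2)]]] by simp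
    from ker[OF M.M.minus_closed[OF x(1,2)] this] show ?thesis
      using eqs(2) \<phi>D(2)[OF x(2)] by simp
  qed
  have g: "g (d x) = \<phi> x" if "x \<in> carrier M" for x
    unfolding g_def using someI[of "\<lambda>x'. x' \<in> carrier M \<and> d x' = d x" x] that
    by (intro well_defined) auto
  have "g \<in> gmodule_hom (gsub N ?S) I"
  proof (rule gmodule_homI)
    fix y assume "y \<in> carrier (gsub N ?S)"
    then show "g y \<in> carrier I" using g \<phi>D(2) by auto
  next
    fix y y' assume "y \<in> carrier (gsub N ?S)" "y' \<in> carrier (gsub N ?S)"
    then obtain x x' where x: "x \<in> carrier M" "y = d x" "x' \<in> carrier M" "y' = d x'" by auto
    then show "g (y \<oplus>\<^bsub>gsub N ?S\<^esub> y') = g y \<oplus>\<^bsub>I\<^esub> g y'"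
      using g[of "x \<oplus>\<^bsub>M\<^esub> x'"] by (simp add: dD(3) \<phi>D(3) g)
  next
    fix a :: "('n, 'k) operator" and y assume a: "a \<in> weyl_carrier" and "y \<in> carrier (gsub N ?S)"
    then obtain x where x: "x \<in> carrier M" "y = d x" by auto
    then show "g (a \<odot>\<^bsub>gsub N ?S\<^esub> y) = a \<odot>\<^bsub>I\<^esub> g y"
      using g[OF M.act_closed[OF a x(1)]] a by (simp add: dD(4) \<phi>D(4) g)
  next
    fix e y assume "y \<in> hcomp (gsub N ?S) e"
    then obtain x where x: "x \<in> carrier M" "y = d x" "y \<in> hcomp N e" by auto
    have "y = d (homogeneous_part M e x)"
      using gmodule_hom_homogeneous_part[OF M N d x(1), of e] x
      by (simp add: N.homogeneous_part_of_homogeneous)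
    then show "g y \<in> hcomp I e"
      using x(1) by (simp add: g M.homogeneous_part_closed \<phi>D(5) M.homogeneous_part_hcomp)
  qed
  moreover have "inj_on (\<lambda>x. x) (carrier (gsub N ?S))" by simp
  ultimately obtain h where h: "h \<in> gmodule_hom N I" "\<forall>y\<in>?S. h y = g y"
    using I graded_submodule_gsub_eq[OF S] graded_weyl_module_gsub[OF N S] N
    unfolding graded_injective_def by (metis gsub_simps(1))
  show thesis
    by (rule that[OF h(1)]) (use h(2) g in auto)
qed

text \<open>
  The Euler endomorphism of the resolution lifts the one of \<open>M\<close>, which is zero. So it is
  null-homotopic, as any lift of the zero map. At stage \<open>i\<close> the map \<open>h\<^sub>i\<close> is constructed from the fact that
  the Euler endomorphism minus \<open>d\<^sub>i\<^sub>-\<^sub>1 h\<^sub>i\<^sub>-\<^sub>1\<close> vanishes on the kernel of \<open>d\<^sub>i\<close>.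
\<close>

lemma euler_endo_null_homotopic:
  fixes M :: "('n::finite, 'k::field_char_0, 'v) weyl_gmodule"
    and I :: "nat \<Rightarrow> ('n, 'k, 'u) weyl_gmodule"
  assumes res: "graded_injective_resolution M \<epsilon> I d" and eul: "eulerian_of_exponent a M"
  obtains h where "\<And>i. h i \<in> gmodule_hom (I (Suc i)) (I i)"
    "\<And>x. x \<in> carrier (I 0) \<Longrightarrow> euler_endo a (I 0) x = h 0 (d 0 x)"
    "\<And>i x. x \<in> carrier (I (Suc i)) \<Longrightarrow>
       euler_endo a (I (Suc i)) x = h (Suc i) (d (Suc i) x) \<oplus>\<^bsub>I (Suc i)\<^esub> d i (h i x)"
proof -
  have M: "graded_weyl_module M" using eul by (simp add: eulerian_of_exponent_def)
  have inj: "graded_injective (I i)" and I: "graded_weyl_module (I i)"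
    and d: "d i \<in> gmodule_hom (I i) (I (Suc i))" and \<epsilon>: "\<epsilon> \<in> gmodule_hom M (I 0)"
    and exact0: "\<epsilon> ` carrier M = {x\<in>carrier (I 0). d 0 x = \<zero>\<^bsub>I 1\<^esub>}"
    and exact: "d i ` carrier (I i) = {x\<in>carrier (I (Suc i)). d (Suc i) x = \<zero>\<^bsub>I (Suc (Suc i))\<^esub>}" for i
    using res by (auto simp: graded_injective_resolution_def graded_injective_def)
  interpret I: graded_weyl_module "I i" for i by (rule I)
  let ?\<theta> = "\<lambda>i. euler_endo a (I i)"
  note \<theta> = I.euler_endo_hom[of a] and dD = gmodule_homD[OF d]
  have natural: "?\<theta> (Suc i) (d i x) = d i (?\<theta> i x)" if "x \<in> carrier (I i)" for i x
    by (rule euler_endo_natural[OF I I d that])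
  have dd: "d (Suc i) (d i x) = \<zero>\<^bsub>I (Suc (Suc i))\<^esub>" if "x \<in> carrier (I i)" for i x
    using exact[of i] that by auto
  have base: "?\<theta> 0 x = \<zero>\<^bsub>I 0\<^esub>" if "x \<in> carrier (I 0)" "d 0 x = \<zero>\<^bsub>I (Suc 0)\<^esub>" for x
  proof -
    from that have "x \<in> \<epsilon> ` carrier M" using exact0 by simp
    then obtain m where m: "m \<in> carrier M" "x = \<epsilon> m" by auto
    then show ?thesis
      using euler_endo_natural[OF M I \<epsilon>, of m a] eulerian_of_exponent_endo[OF eul]
        gmodule_hom_zero[OF M I \<epsilon>] by simp
  qed
  \<comment> \<open>The second clause of \<open>P\<close> is what the next stage needs: it says that the Euler endomorphism minus \<open>d\<^sub>i h\<close> vanishes on the image of \<open>d\<^sub>i\<close>, which is the kernel of \<open>d\<^sub>i\<^sub>+\<^sub>1\<close>.\<close>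
  define P where "P i h \<longleftrightarrow> h \<in> gmodule_hom (I (Suc i)) (I i) \<and>
    (\<forall>x\<in>carrier (I i). d i (h (d i x)) = d i (?\<theta> i x)) \<and>
    (i = 0 \<longrightarrow> (\<forall>x\<in>carrier (I 0). ?\<theta> 0 x = h (d 0 x)))" for i h
  define Q where "Q i h h' \<longleftrightarrow> (\<forall>x\<in>carrier (I (Suc i)).
    ?\<theta> (Suc i) x = h' (d (Suc i) x) \<oplus>\<^bsub>I (Suc i)\<^esub> d i (h x))" for i h h'
  have "\<exists>h. \<forall>i. P i (h i) \<and> Q i (h i) (h (Suc i))"
  proof (rule dependent_nat_choice)
    obtain h where h: "h \<in> gmodule_hom (I (Suc 0)) (I 0)" "\<And>x. x \<in> carrier (I 0) \<Longrightarrow> h (d 0 x) = ?\<theta> 0 x"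
      using graded_injective_factor[OF I I inj d \<theta> base] by blast
    then have "P 0 h" by (simp add: P_def)
    then show "\<exists>h. P 0 h" by (rule exI[of _ h])
  next
    fix h i assume P: "P i h"
    then have h: "h \<in> gmodule_hom (I (Suc i)) (I i)"
      and h_d: "\<And>x. x \<in> carrier (I i) \<Longrightarrow> d i (h (d i x)) = d i (?\<theta> i x)" by (auto simp: P_def)
    note hD = gmodule_homD[OF h]
    let ?\<phi> = "\<lambda>x. ?\<theta> (Suc i) x \<ominus>\<^bsub>I (Suc i)\<^esub> d i (h x)"
    have \<phi>: "?\<phi> \<in> gmodule_hom (I (Suc i)) (I (Suc i))"
      by (rule gmodule_hom_diff[OF I \<theta> gmodule_hom_compose[OF h d]])
    have ker: "?\<phi> x = \<zero>\<^bsub>I (Suc i)\<^esub>"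
      if x: "x \<in> carrier (I (Suc i))" "d (Suc i) x = \<zero>\<^bsub>I (Suc (Suc i))\<^esub>" for x
    proof -
      from x have "x \<in> d i ` carrier (I i)" using exact[of i] by simp
      then obtain y where y: "y \<in> carrier (I i)" "x = d i y" by auto
      then show ?thesis
        using natural[OF y(1)] h_d[OF y(1)] dD(2)[OF I.euler_endo_closed[OF y(1), of a]]
        by (simp add: a_minus_def I.M.r_neg)
    qed
    obtain h' where h': "h' \<in> gmodule_hom (I (Suc (Suc i))) (I (Suc i))"
      "\<And>x. x \<in> carrier (I (Suc i)) \<Longrightarrow> h' (d (Suc i) x) = ?\<phi> x"
      using graded_injective_factor[OF I I inj d \<phi> ker] by blast
    have Q: "Q i h h'"
      unfolding Q_def
    proof
      fix x assume x: "x \<in> carrier (I (Suc i))"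
      show "?\<theta> (Suc i) x = h' (d (Suc i) x) \<oplus>\<^bsub>I (Suc i)\<^esub> d i (h x)"
        using dD(2)[OF hD(2)[OF x]] I.euler_endo_closed[OF x, of a]
        by (simp add: h'(2)[OF x] a_minus_def I.M.a_assoc I.M.l_neg)
    qed
    have "d (Suc i) (h' (d (Suc i) x)) = d (Suc i) (?\<theta> (Suc i) x)" if x: "x \<in> carrier (I (Suc i))" for x
    proof -
      have c: "h' (d (Suc i) x) \<in> carrier (I (Suc i))" using gmodule_homD(2)[OF h'(1)] dD(2) x by blast
      have "d (Suc i) (?\<theta> (Suc i) x) = d (Suc i) (h' (d (Suc i) x)) \<oplus>\<^bsub>I (Suc (Suc i))\<^esub> d (Suc i) (d i (h x))"
        using Q x dD(3)[OF c dD(2)[OF hD(2)[OF x]]] by (simp add: Q_def)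
      then show ?thesis using dd[OF hD(2)[OF x]] dD(2)[OF c] by simp
    qed
    with h'(1) have "P (Suc i) h'" by (simp add: P_def)
    with Q show "\<exists>h'. P (Suc i) h' \<and> Q i h h'" by blast
  qed
  then obtain h where h: "\<And>i. P i (h i)" "\<And>i. Q i (h i) (h (Suc i))" by blast
  show thesis
    by (rule that[of h]) (use h in \<open>auto simp: P_def Q_def\<close>)
qed

section \<open>Sections with support\<close>

lemma poly_ring_simps [simp]:
  "carrier poly_ring = UNIV" "mult poly_ring = (*)" "one poly_ring = 1"
  "zero poly_ring = 0" "add poly_ring = (+)"
  by (simp_all add: poly_ring_def)

lemma poly_ring_cring: "cring (poly_ring :: ('n, 'k::field_char_0) mpoly ring)"
proof (rule cringI)
  show "abelian_group (poly_ring :: ('n, 'k) mpoly ring)"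
    by (rule abelian_groupI) (auto simp: algebra_simps intro: exI[of _ "- x" for x])
  show "comm_monoid (poly_ring :: ('n, 'k) mpoly ring)"
    by (rule comm_monoidI) (auto simp: algebra_simps)
qed (auto simp: algebra_simps)

interpretation poly_ring: cring "poly_ring :: ('n, 'k::field_char_0) mpoly ring"
  by (rule poly_ring_cring)

lemma ideal_poly_ring_iff:
  fixes J :: "('n, 'k::field_char_0) mpoly set"
  shows "ideal J poly_ring \<longleftrightarrow> 0 \<in> J \<and> (\<forall>x\<in>J. \<forall>y\<in>J. x + y \<in> J) \<and> (\<forall>r. \<forall>x\<in>J. r * x \<in> J)"
proof
  assume "ideal J poly_ring"
  then interpret ideal J poly_ring .
  show "0 \<in> J \<and> (\<forall>x\<in>J. \<forall>y\<in>J. x + y \<in> J) \<and> (\<forall>r. \<forall>x\<in>J. r * x \<in> J)"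
    using zero_closed a_closed I_l_closed by simp
next
  assume J: "0 \<in> J \<and> (\<forall>x\<in>J. \<forall>y\<in>J. x + y \<in> J) \<and> (\<forall>r. \<forall>x\<in>J. r * x \<in> J)"
  have neg: "- x \<in> J" if "x \<in> J" for x using J that by (metis mult_minus1)
  have inv: "inv\<^bsub>add_monoid poly_ring\<^esub> x = - x" for x :: "('n, 'k) mpoly"
    using poly_ring.minus_equality[of "- x" x] by (simp add: a_inv_def)
  show "ideal J poly_ring"
  proof (rule idealI[OF cring.axioms(1)[OF poly_ring_cring]])
    show "subgroup J (add_monoid poly_ring)"
      using J neg by (intro subgroup.intro) (auto simp only: inv, auto)
  next
    fix a x :: "('n, 'k) mpoly" assume "a \<in> J"
    then show "x \<otimes>\<^bsub>poly_ring\<^esub> a \<in> J" "a \<otimes>\<^bsub>poly_ring\<^esub> x \<in> J"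
      unfolding poly_ring_simps using J by (metis, metis mult.commute)
  qed
qed

lemma Spec_iff:
  "P \<in> Spec \<longleftrightarrow> ideal P poly_ring \<and> 1 \<notin> P \<and> (\<forall>a b. a * b \<in> P \<longrightarrow> a \<in> P \<or> b \<in> P)"
proof -
  have "P \<noteq> UNIV \<longleftrightarrow> 1 \<notin> P" if "ideal P poly_ring"
    using that by (metis UNIV_I UNIV_eq_I ideal_poly_ring_iff mult.right_neutral)
  then show ?thesis
    by (auto simp: Spec_def primeideal_def primeideal_axioms_def poly_ring_cring)
qed

lemma Spec_power:
  assumes "P \<in> Spec" "f ^ k \<in> P"
  shows "f \<in> P"
  using assms by (induction k) (auto simp: Spec_iff)

text \<open>An ideal maximal among those that contain \<open>A\<close> and no power of \<open>f\<close> is prime: two ideals properly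
  larger than it each contain a power of \<open>f\<close>, hence so does their product.\<close>

lemma prime_ideal_avoiding_powers:
  fixes A :: "('n, 'k::field_char_0) mpoly set"
  assumes A: "ideal A poly_ring" and f: "\<And>k. f ^ k \<notin> A"
  obtains P where "P \<in> Spec" "A \<subseteq> P" "f \<notin> P"
proof -
  let ?C = "{J. ideal J poly_ring \<and> A \<subseteq> J \<and> (\<forall>k. f ^ k \<notin> J)}"
  have "\<exists>P\<in>?C. \<forall>J\<in>?C. P \<subseteq> J \<longrightarrow> J = P"
  proof (rule subset_Zorn_nonempty)
    show "?C \<noteq> {}" using A f by blast
    fix \<C> assume "\<C> \<noteq> {}" and chain: "subset.chain ?C \<C>"
    then have C: "J \<in> \<C> \<Longrightarrow> J \<in> ?C" and total: "J \<in> \<C> \<Longrightarrow> J' \<in> \<C> \<Longrightarrow> J \<subseteq> J' \<or> J' \<subseteq> J" for J J'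
      by (auto simp: subset.chain_def)
    have "ideal (\<Union>\<C>) poly_ring"
      unfolding ideal_poly_ring_iff
    proof (intro conjI ballI allI)
      show "0 \<in> \<Union>\<C>" using \<open>\<C> \<noteq> {}\<close> C by (auto simp: ideal_poly_ring_iff)
      fix x y assume "x \<in> \<Union>\<C>" "y \<in> \<Union>\<C>"
      then obtain J J' where "J \<in> \<C>" "x \<in> J" "J' \<in> \<C>" "y \<in> J'" by blast
      with total[of J J'] obtain J'' where "J'' \<in> \<C>" "x \<in> J''" "y \<in> J''" by blast
      with C[of J''] show "x + y \<in> \<Union>\<C>" by (auto simp: ideal_poly_ring_iff)
    next
      fix r x assume "x \<in> \<Union>\<C>"
      then obtain J where "J \<in> \<C>" "x \<in> J" by blast
      moreover from this C[of J] have "r * x \<in> J" by (simp add: ideal_poly_ring_iff)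
      ultimately show "r * x \<in> \<Union>\<C>" by blast
    qed
    with \<open>\<C> \<noteq> {}\<close> C show "\<Union>\<C> \<in> ?C" by blast
  qed
  then obtain P where "P \<in> ?C" and max: "\<forall>J\<in>?C. P \<subseteq> J \<longrightarrow> J = P" ..
  then have P: "ideal P poly_ring" "A \<subseteq> P" "\<And>k. f ^ k \<notin> P" by simp_all
  note P' = P(1)[unfolded ideal_poly_ring_iff]
  have larger: "\<exists>k m r. m \<in> P \<and> f ^ k = m + r * a" if "a \<notin> P" for a
  proof (rule ccontr)
    assume no: "\<not> ?thesis"
    let ?J = "{m + r * a | m r. m \<in> P}"
    have "ideal ?J poly_ring"
      unfolding ideal_poly_ring_iff
    proof (intro conjI ballI allI)
      show "0 \<in> ?J" using P' by (force intro: exI[of _ 0])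
      fix x y assume "x \<in> ?J" "y \<in> ?J"
      then obtain m r m' r' where "m \<in> P" "m' \<in> P" "x = m + r * a" "y = m' + r' * a" by blast
      then have "m + m' \<in> P" "x + y = (m + m') + (r + r') * a" using P' by (auto simp: algebra_simps)
      then show "x + y \<in> ?J" by blast
    next
      fix s x assume "x \<in> ?J"
      then obtain m r where "m \<in> P" "x = m + r * a" by blast
      then have "s * m \<in> P" "s * x = s * m + (s * r) * a" using P' by (blast, simp add: algebra_simps)
      then show "s * x \<in> ?J" by blast
    qed
    moreover have "P \<subseteq> ?J" by (force intro: exI[of _ 0])
    moreover have "\<forall>k. f ^ k \<notin> ?J" using no by blast
    ultimately have "?J \<in> ?C" using P(2) by (intro CollectI conjI) auto
    with max \<open>P \<subseteq> ?J\<close> have "?J = P" by (intro max[rule_format])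
    moreover have "0 + 1 * a \<in> ?J" using P' by blast
    ultimately show False using that by simp
  qed
  have "a \<in> P \<or> b \<in> P" if ab: "a * b \<in> P" for a b
  proof (rule ccontr)
    assume "\<not> (a \<in> P \<or> b \<in> P)"
    then obtain k m r l n s where eq: "m \<in> P" "f ^ k = m + r * a" "n \<in> P" "f ^ l = n + s * b"
      using larger by metis
    have "f ^ (k + l) = (n + s * b) * m + (r * a) * n + (r * s) * (a * b)"
      by (simp add: power_add eq algebra_simps)
    moreover have "\<dots> \<in> P" using P' eq ab by simp
    ultimately show False using P(3) by metis
  qed
  with P(1,3) have "P \<in> Spec" unfolding Spec_iff by (metis power_0)
  then show thesis using that[OF _ P(2)] P(3)[of 1] by simp
qed

lemma power_in_ideal_power:
  assumes "f \<in> J"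
  shows "f ^ k \<in> ideal_power J k"
proof (induction k)
  case (Suc k)
  with ideal_prod.prod[OF assms, of _ "(ideal_prod poly_ring J ^^ k) UNIV" poly_ring] show ?case
    by (simp add: ideal_power_def)
qed (simp add: ideal_power_def)

text \<open>Products of generators suffice. In the induction step one factor is moved into the ideal quotient
  of \<open>A\<close> by the ideal generated by \<open>F\<close>, to which the induction hypothesis applies.\<close>

lemma ideal_power_genideal_subset:
  fixes F A :: "('n, 'k::field_char_0) mpoly set"
  assumes "ideal A poly_ring" "\<And>xs. set xs \<subseteq> F \<Longrightarrow> length xs = k \<Longrightarrow> prod_list xs \<in> A"
  shows "ideal_power (Idl\<^bsub>poly_ring\<^esub> F) k \<subseteq> A"
  using assms
proof (induction k arbitrary: A)
  case 0
  from 0(2)[of "[]"] 0(1) have "A = UNIV" by (auto simp: ideal_poly_ring_iff) (metis mult.right_neutral)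
  then show ?case by simp
next
  case (Suc k)
  let ?I = "Idl\<^bsub>poly_ring\<^esub> F" and ?A = "{r. \<forall>g\<in>Idl\<^bsub>poly_ring\<^esub> F. g * r \<in> A}"
  note A = Suc(2)[unfolded ideal_poly_ring_iff]
  have "ideal ?A poly_ring"
    using A by (auto simp: ideal_poly_ring_iff distrib_left mult.left_commute)
  moreover have "prod_list xs \<in> ?A" if xs: "set xs \<subseteq> F" "length xs = k" for xs
  proof -
    have "ideal {g. g * prod_list xs \<in> A} poly_ring"
      using A by (auto simp: ideal_poly_ring_iff distrib_right mult.assoc)
    moreover have "F \<subseteq> {g. g * prod_list xs \<in> A}"
      using Suc(3)[of "g # xs" for g] xs by auto
    ultimately show ?thesis using poly_ring.genideal_minimal by blast
  qed
  ultimately have IH: "ideal_power ?I k \<subseteq> ?A" by (rule Suc.IH)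
  show ?case
  proof
    fix r assume "r \<in> ideal_power ?I (Suc k)"
    then have "r \<in> ideal_prod poly_ring ?I (ideal_power ?I k)" by (simp add: ideal_power_def)
    then show "r \<in> A"
      by (induction rule: ideal_prod.induct) (use IH A in auto)
  qed
qed

lemma power_count_list_dvd_prod_list:
  fixes f :: "'a::comm_monoid_mult"
  shows "f ^ count_list xs f dvd prod_list xs"
  by (induction xs) (auto intro: mult_dvd_mono dvd_mult)

text \<open>By the pigeonhole principle, a product of sufficiently many elements of \<open>F\<close> contains one of them to
  a power that lies in \<open>A\<close>.\<close>

lemma ideal_power_subset:
  fixes F A :: "('n, 'k::field_char_0) mpoly set"
  assumes A: "ideal A poly_ring" and "finite F" "\<And>f. f \<in> F \<Longrightarrow> \<exists>k. f ^ k \<in> A"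
  obtains N where "ideal_power (Idl\<^bsub>poly_ring\<^esub> F) N \<subseteq> A"
proof -
  from assms(3) obtain k where k: "\<And>f. f \<in> F \<Longrightarrow> f ^ k f \<in> A" by metis
  note A' = A[unfolded ideal_poly_ring_iff]
  have "prod_list xs \<in> A" if xs: "set xs \<subseteq> F" "length xs = Suc (\<Sum>f\<in>F. k f)" for xs
  proof -
    have "\<exists>f\<in>F. k f \<le> count_list xs f"
    proof (rule ccontr)
      assume "\<not> ?thesis"
      then have "(\<Sum>f\<in>F. count_list xs f) \<le> (\<Sum>f\<in>F. k f)" by (intro sum_mono) auto
      with xs show False using sum_count_set[OF xs(1) \<open>finite F\<close>] by simp
    qed
    then obtain f where f: "f \<in> F" "k f \<le> count_list xs f" by blast
    then have "f ^ k f dvd prod_list xs"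
      by (metis le_imp_power_dvd dvd_trans power_count_list_dvd_prod_list)
    then obtain r where "prod_list xs = f ^ k f * r" by (elim dvdE)
    with k[OF f(1)] A' show ?thesis by (simp add: mult.commute)
  qed
  from ideal_power_genideal_subset[OF A this] show thesis by (rule that)
qed

lemma homogeneous_polys_power:
  assumes "f \<in> homogeneous_polys d"
  shows "f ^ k \<in> homogeneous_polys (int k * d)"
proof (induction k)
  case 0
  show ?case by (auto simp: homogeneous_polys_def single_one[symmetric] simp del: single_one)
next
  case (Suc k)
  from homogeneous_polys_mult[OF assms Suc] show ?case by (simp add: algebra_simps)
qed

lemma mult_op_add: "mult_op (r + s) = (\<lambda>p. mult_op r p + mult_op s p)"
  by (simp add: mult_op_def distrib_right)

lemma mult_op_mult: "mult_op (r * s) = mult_op r \<circ> mult_op s"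
  by (simp add: mult_op_def fun_eq_iff mult.assoc)

definition annihilator :: "('n, 'k::field_char_0, 'm) weyl_gmodule \<Rightarrow> 'm \<Rightarrow> ('n, 'k) mpoly set" where
  "annihilator M x = {r. mult_op r \<odot>\<^bsub>M\<^esub> x = \<zero>\<^bsub>M\<^esub>}"

context graded_weyl_module
begin

lemma annihilator_ideal:
  assumes "x \<in> carrier M"
  shows "ideal (annihilator M x) poly_ring"
proof -
  have "mult_op 0 \<odot>\<^bsub>M\<^esub> x = \<zero>\<^bsub>M\<^esub>"
    using zero_act[OF assms] by (simp add: mult_op_def)
  then show ?thesis
    unfolding ideal_poly_ring_iff annihilator_def mem_Collect_eq mult_op_add mult_op_mult
    using assms by (simp add: act_add_left[OF mult_op_closed mult_op_closed]
      act_comp[OF mult_op_closed mult_op_closed] act_zero[OF mult_op_closed])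
qed

text \<open>A power of the ideal generated by \<open>F\<close> annihilates \<open>x\<close> as soon as each of the finitely many
  generators has a power that does.\<close>

lemma torsion_genideal_iff:
  assumes "finite F" "x \<in> carrier M"
  shows "x \<in> torsion (Idl\<^bsub>poly_ring\<^esub> F) M \<longleftrightarrow> (\<forall>f\<in>F. \<exists>k. f ^ k \<in> annihilator M x)"
proof
  assume "x \<in> torsion (Idl\<^bsub>poly_ring\<^esub> F) M"
  then obtain k where "ideal_power (Idl\<^bsub>poly_ring\<^esub> F) k \<subseteq> annihilator M x"
    by (auto simp: torsion_def annihilator_def)
  then show "\<forall>f\<in>F. \<exists>k. f ^ k \<in> annihilator M x"
    using power_in_ideal_power poly_ring.genideal_self[of F] by (metis poly_ring_simps(1) subset_UNIV subset_iff)
next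
  assume "\<forall>f\<in>F. \<exists>k. f ^ k \<in> annihilator M x"
  then obtain N where "ideal_power (Idl\<^bsub>poly_ring\<^esub> F) N \<subseteq> annihilator M x"
    using ideal_power_subset[OF annihilator_ideal[OF assms(2)] assms(1)] by blast
  then show "x \<in> torsion (Idl\<^bsub>poly_ring\<^esub> F) M"
    using assms(2) by (auto simp: torsion_def annihilator_def)
qed

text \<open>If no power of \<open>f\<close> annihilates \<open>x\<close>, some prime contains the annihilator but not \<open>f\<close>: the radical of
  an ideal is the intersection of the primes that contain it.\<close>

lemma V_annihilator_subset_iff:
  assumes "x \<in> carrier M"
  shows "V (annihilator M x) \<subseteq> V F \<longleftrightarrow> (\<forall>f\<in>F. \<exists>k. f ^ k \<in> annihilator M x)"
proof
  assume sub: "V (annihilator M x) \<subseteq> V F"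
  show "\<forall>f\<in>F. \<exists>k. f ^ k \<in> annihilator M x"
  proof (rule ballI, rule ccontr)
    fix f assume f: "f \<in> F" "\<nexists>k. f ^ k \<in> annihilator M x"
    then obtain P where "P \<in> Spec" "annihilator M x \<subseteq> P" "f \<notin> P"
      using prime_ideal_avoiding_powers[OF annihilator_ideal[OF assms]] by metis
    with sub f(1) show False by (auto simp: V_def)
  qed
next
  assume "\<forall>f\<in>F. \<exists>k. f ^ k \<in> annihilator M x"
  then show "V (annihilator M x) \<subseteq> V F"
    unfolding V_def using Spec_power by blast
qed

text \<open>The support of an element is the set of primes containing its annihilator. In this description
  the choice of equations for \<open>Y\<close> no longer occurs.\<close>

lemma sections_with_support_iff:
  assumes "homogeneous_closed Y"
  shows "x \<in> sections_with_support Y M \<longleftrightarrow> x \<in> carrier M \<and> V (annihilator M x) \<subseteq> Y"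
proof -
  have "x \<in> torsion (Idl\<^bsub>poly_ring\<^esub> F) M \<longleftrightarrow> x \<in> carrier M \<and> V (annihilator M x) \<subseteq> Y"
    if "homogeneous_presentation F Y" for F
  proof (cases "x \<in> carrier M")
    case True
    with that show ?thesis
      using torsion_genideal_iff V_annihilator_subset_iff by (simp add: homogeneous_presentation_def)
  qed (simp add: torsion_def)
  then show ?thesis
    using assms by (auto simp: sections_with_support_def homogeneous_closed_def)
qed

text \<open>The product rule in the form \<open>r \<partial>\<^sub>i = \<partial>\<^sub>i r - \<partial>\<^sub>i(r)\<close> gives \<open>r\<^sup>2 \<partial>\<^sub>i = (r \<partial>\<^sub>i - \<partial>\<^sub>i(r)) r\<close>. So \<open>\<partial>\<^sub>i x\<close> has its support
  in that of \<open>x\<close>.\<close>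

lemma square_annihilates_derivative:
  assumes "x \<in> carrier M" "r \<in> annihilator M x"
  shows "r * r \<in> annihilator M (pdiff i \<odot>\<^bsub>M\<^esub> x)"
proof -
  let ?b = "\<lambda>p. (mult_op r \<circ> pdiff i) p + mult_op (- pdiff i r) p"
  have b: "?b \<in> weyl_carrier"
    by (intro weyl_carrier.add weyl_carrier.mult weyl_carrier.D mult_op_closed)
  have "mult_op (r * r) \<circ> pdiff i = ?b \<circ> mult_op r"
    by (simp add: fun_eq_iff mult_op_def pdiff_mult algebra_simps)
  then have "mult_op (r * r) \<odot>\<^bsub>M\<^esub> (pdiff i \<odot>\<^bsub>M\<^esub> x) = ?b \<odot>\<^bsub>M\<^esub> (mult_op r \<odot>\<^bsub>M\<^esub> x)"
    using act_comp[OF mult_op_closed weyl_carrier.D assms(1)] act_comp[OF b mult_op_closed assms(1)]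
    by metis
  also have "\<dots> = \<zero>\<^bsub>M\<^esub>"
    using assms(2) act_zero[OF b] by (simp add: annihilator_def)
  finally show ?thesis by (simp add: annihilator_def)
qed

lemma V_annihilator_mult_op:
  assumes "x \<in> carrier M"
  shows "V (annihilator M (mult_op s \<odot>\<^bsub>M\<^esub> x)) \<subseteq> V (annihilator M x)"
proof -
  have "r \<in> annihilator M (mult_op s \<odot>\<^bsub>M\<^esub> x)" if r: "r \<in> annihilator M x" for r
  proof -
    have "mult_op r \<odot>\<^bsub>M\<^esub> (mult_op s \<odot>\<^bsub>M\<^esub> x) = mult_op s \<odot>\<^bsub>M\<^esub> (mult_op r \<odot>\<^bsub>M\<^esub> x)"
      using act_comp[OF mult_op_closed mult_op_closed assms] mult_op_mult by (metis mult.commute)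
    with r show ?thesis by (simp add: annihilator_def act_zero[OF mult_op_closed])
  qed
  then show ?thesis by (auto simp: V_def)
qed

text \<open>If \<open>r\<close> annihilates \<open>x\<close> and \<open>s\<close> annihilates \<open>y\<close>, then \<open>r s\<close> annihilates \<open>x + y\<close>; a prime containing
  all these products contains one of the two annihilators.\<close>

lemma V_annihilator_add:
  assumes "x \<in> carrier M" "y \<in> carrier M"
  shows "V (annihilator M (x \<oplus>\<^bsub>M\<^esub> y)) \<subseteq> V (annihilator M x) \<union> V (annihilator M y)"
proof
  fix P assume P: "P \<in> V (annihilator M (x \<oplus>\<^bsub>M\<^esub> y))"
  show "P \<in> V (annihilator M x) \<union> V (annihilator M y)"
  proof (rule ccontr)
    assume "\<not> ?thesis"
    with P obtain r s where rs: "r \<in> annihilator M x" "s \<in> annihilator M y" "r \<notin> P" "s \<notin> P"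
      by (auto simp: V_def)
    have "r * s \<in> annihilator M x" "r * s \<in> annihilator M y"
      using rs annihilator_ideal assms unfolding ideal_poly_ring_iff by (metis mult.commute)+
    then have "r * s \<in> annihilator M (x \<oplus>\<^bsub>M\<^esub> y)"
      using assms by (simp add: annihilator_def act_add_right[OF mult_op_closed])
    with P rs show False by (auto simp: V_def Spec_iff)
  qed
qed

lemma V_annihilator_act:
  assumes "a \<in> weyl_carrier" "x \<in> carrier M"
  shows "V (annihilator M (a \<odot>\<^bsub>M\<^esub> x)) \<subseteq> V (annihilator M x)"
  using assms
proof (induction a arbitrary: x rule: weyl_carrier.induct)
  case (add a b)
  from V_annihilator_add[OF act_closed[OF add(1,5)] act_closed[OF add(2,5)]] add(3,4)[OF add(5)]
  show ?case unfolding act_add_left[OF add(1,2,5)] by blast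
next
  case (mult a b)
  from mult(3)[OF act_closed[OF mult(2,5)]] mult(4)[OF mult(5)]
  show ?case unfolding act_comp[OF mult(1,2,5)] by blast
next
  case (D i)
  then show ?case
    using square_annihilates_derivative[of x _ i] by (auto simp: V_def Spec_iff)
qed (rule V_annihilator_mult_op, assumption)+

text \<open>Homogeneous parts of sections are sections because \<open>Y\<close> is given by homogeneous equations \<open>f\<close>: if
  \<open>f\<^sup>k x = 0\<close>, then multiplication by \<open>f\<^sup>k\<close> also kills every homogeneous part of \<open>x\<close>.\<close>

lemma graded_submodule_sections:
  assumes Y: "homogeneous_closed Y"
  shows "graded_submodule M (sections_with_support Y M)"
proof -
  from Y obtain F where "homogeneous_presentation F Y" by (auto simp: homogeneous_closed_def)
  then have F: "F \<subseteq> (\<Union>e. homogeneous_polys e)" "Y = V F" by (auto simp: homogeneous_presentation_def)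
  have part: "V (annihilator M (homogeneous_part M e x)) \<subseteq> Y"
    if x: "x \<in> carrier M" "V (annihilator M x) \<subseteq> Y" for x e
    unfolding F(2) V_annihilator_subset_iff[OF homogeneous_part_closed[OF x(1)]]
  proof
    fix f assume f: "f \<in> F"
    with F(1) obtain d where d: "f \<in> homogeneous_polys d" by blast
    from x f obtain k where k: "f ^ k \<in> annihilator M x"
      unfolding F(2) V_annihilator_subset_iff[OF x(1)] by blast
    have "mult_op (f ^ k) \<odot>\<^bsub>M\<^esub> homogeneous_part M e x
        = homogeneous_part M (int k * d + e) (mult_op (f ^ k) \<odot>\<^bsub>M\<^esub> x)"
      by (rule homogeneous_part_act[OF graded_weyl_module_axioms
            weyl_homogeneous_mult_op[OF homogeneous_polys_power[OF d]] x(1), symmetric])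
    also have "\<dots> = \<zero>\<^bsub>M\<^esub>"
      using k homogeneous_part_of_homogeneous[OF hcomp_zero] by (simp add: annihilator_def)
    finally show "\<exists>k. f ^ k \<in> annihilator M (homogeneous_part M e x)" by (auto simp: annihilator_def)
  qed
  have zero: "V (annihilator M \<zero>\<^bsub>M\<^esub>) \<subseteq> Y"
    using act_zero[OF mult_op_closed] by (auto simp: V_def annihilator_def Spec_iff)
  show ?thesis
    unfolding graded_submodule_def sections_with_support_iff[OF Y]
  proof (intro conjI ballI allI)
    show "sections_with_support Y M \<subseteq> carrier M"
      using sections_with_support_iff[OF Y] by blast
    show "\<zero>\<^bsub>M\<^esub> \<in> carrier M" "V (annihilator M \<zero>\<^bsub>M\<^esub>) \<subseteq> Y"
      using zero by auto
  next
    fix x y assume "x \<in> sections_with_support Y M" "y \<in> sections_with_support Y M"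
    then have "x \<in> carrier M" "V (annihilator M x) \<subseteq> Y" "y \<in> carrier M" "V (annihilator M y) \<subseteq> Y"
      by (simp_all add: sections_with_support_iff[OF Y])
    then show "x \<oplus>\<^bsub>M\<^esub> y \<in> carrier M" "V (annihilator M (x \<oplus>\<^bsub>M\<^esub> y)) \<subseteq> Y"
      using V_annihilator_add[of x y] by auto
  next
    fix a :: "('n, 'k) operator" and x assume "a \<in> weyl_carrier" "x \<in> sections_with_support Y M"
    then show "a \<odot>\<^bsub>M\<^esub> x \<in> carrier M" "V (annihilator M (a \<odot>\<^bsub>M\<^esub> x)) \<subseteq> Y"
      using V_annihilator_act[of a x] act_closed[of a x] by (auto simp: sections_with_support_iff[OF Y])
  next
    fix x e assume "x \<in> sections_with_support Y M"
    then show "homogeneous_part M e x \<in> carrier M" "V (annihilator M (homogeneous_part M e x)) \<subseteq> Y"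
      using part[of x e] homogeneous_part_closed[of x e] by (simp_all add: sections_with_support_iff[OF Y])
  qed
qed

lemma sections_with_support_mono:
  assumes "homogeneous_closed Y" "homogeneous_closed Y'" "Y' \<subseteq> Y"
  shows "sections_with_support Y' M \<subseteq> sections_with_support Y M"
  using assms(3) unfolding subset_iff sections_with_support_iff[OF assms(1)] sections_with_support_iff[OF assms(2)]
  by blast

end

text \<open>Linear maps enlarge annihilators. This applies to the homotopy as well as to the differential.\<close>

lemma sections_with_support_hom:
  assumes "graded_weyl_module M" "graded_weyl_module N" "f \<in> gmodule_hom M N" "homogeneous_closed Y"
    and x: "x \<in> sections_with_support Y M"
  shows "f x \<in> sections_with_support Y N"
proof -
  interpret M: graded_weyl_module M by fact
  interpret N: graded_weyl_module N by fact
  note f = gmodule_homD[OF assms(3)]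
  have xM: "x \<in> carrier M" "V (annihilator M x) \<subseteq> Y"
    using x by (auto simp: M.sections_with_support_iff[OF assms(4)])
  have "annihilator M x \<subseteq> annihilator N (f x)"
    using f(4)[OF mult_op_closed xM(1), symmetric] gmodule_hom_zero[OF assms(1-3)]
    by (auto simp: annihilator_def)
  then have "V (annihilator N (f x)) \<subseteq> V (annihilator M x)" by (auto simp: V_def)
  with xM f(2) show ?thesis by (auto simp: N.sections_with_support_iff[OF assms(4)])
qed

section \<open>Cohomology of graded complexes\<close>

lemma gquot_map_gsub [simp]: "gquot_map (gsub M S) B f = gquot_map M B f"
  by (simp add: gquot_map_def fun_eq_iff)

lemma gmodule_hom_gsub:
  assumes "f \<in> gmodule_hom M N" "\<And>x. x \<in> S \<Longrightarrow> x \<in> carrier M" "\<And>x. x \<in> S \<Longrightarrow> f x \<in> S'"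
  shows "f \<in> gmodule_hom (gsub M S) (gsub N S')"
  using assms gmodule_homD[OF assms(1)] by (intro gmodule_homI) auto

locale graded_complex =
  fixes C :: "nat \<Rightarrow> ('n::finite, 'k::field_char_0, 'm) weyl_gmodule" and d :: "nat \<Rightarrow> 'm \<Rightarrow> 'm"
  assumes module: "graded_weyl_module (C i)"
    and d_hom: "d i \<in> gmodule_hom (C i) (C (Suc i))"
    and d_d: "x \<in> carrier (C i) \<Longrightarrow> d (Suc i) (d i x) = \<zero>\<^bsub>C (Suc (Suc i))\<^esub>"
begin

abbreviation cycles :: "nat \<Rightarrow> 'm set" where
  "cycles i \<equiv> {x\<in>carrier (C i). d i x = \<zero>\<^bsub>C (Suc i)\<^esub>}"

lemma d_zero: "d i \<zero>\<^bsub>C i\<^esub> = \<zero>\<^bsub>C (Suc i)\<^esub>"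
  by (rule gmodule_hom_zero[OF module module d_hom])

lemma boundaries_0: "boundaries C d 0 = {\<zero>\<^bsub>C 0\<^esub>}"
  and boundaries_Suc: "boundaries C d (Suc i) = d i ` carrier (C i)"
  by (simp_all add: boundaries_def)

lemma boundaries_submodule: "graded_submodule (C i) (boundaries C d i)"
proof (cases i)
  case 0
  then show ?thesis using graded_submodule_zero[OF module] by (simp add: boundaries_0)
next
  case (Suc j)
  then show ?thesis using graded_submodule_image[OF module module d_hom] by (simp add: boundaries_Suc)
qed

lemma boundaries_cycles: "boundaries C d i \<subseteq> cycles i"
proof (cases i)
  case 0
  interpret graded_weyl_module "C 0" by (rule module)
  show ?thesis using 0 d_zero by (simp add: boundaries_0)
next
  case (Suc j)
  then show ?thesis using gmodule_homD(2)[OF d_hom] d_d by (auto simp: boundaries_Suc)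
qed

lemma cycles_submodule: "graded_submodule (C i) (cycles i)"
  by (rule graded_submodule_kernel[OF module module d_hom])

lemma cohomology_quotient: "graded_quotient (gsub (C i) (cycles i)) (boundaries C d i)"
  using graded_weyl_module_gsub[OF module cycles_submodule]
    graded_submodule_gsub[OF module cycles_submodule boundaries_submodule boundaries_cycles]
  by (simp add: graded_quotient_def graded_quotient_axioms_def)

lemma cohomology_eulerian:
  assumes "\<And>e x. x \<in> hcomp (C i) e \<Longrightarrow> d i x = \<zero>\<^bsub>C (Suc i)\<^esub> \<Longrightarrow>
    euler_power a e \<odot>\<^bsub>C i\<^esub> x \<in> boundaries C d i"
  shows "eulerian_of_exponent a (cohomology C d i)"
proof -
  interpret Q: graded_quotient "gsub (C i) (cycles i)" "boundaries C d i" by (rule cohomology_quotient)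
  have "euler_power a e \<odot>\<^bsub>cohomology C d i\<^esub> w = \<zero>\<^bsub>cohomology C d i\<^esub>"
    if "w \<in> hcomp (cohomology C d i) e" for e w
  proof -
    from that obtain x where x: "x \<in> hcomp (C i) e" "x \<in> cycles i" "w = boundaries C d i +>\<^bsub>C i\<^esub> x"
      unfolding cohomology_def Q.gquot_simps(4) by auto
    then have c: "x \<in> carrier (gsub (C i) (cycles i))" by simp
    have "euler_power a e \<odot>\<^bsub>cohomology C d i\<^esub> w = boundaries C d i +>\<^bsub>C i\<^esub> (euler_power a e \<odot>\<^bsub>C i\<^esub> x)"
      using Q.gquot_act[OF weyl_homogeneous_closed[OF euler_power_homogeneous] c] x(3)
      by (simp add: cohomology_def)
    also have "\<dots> = boundaries C d i"
      using Q.coset_eq_zero_iff[OF Q.M.euler_power_act_closed[OF c]] assms[OF x(1)] x(2) by simp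
    finally show ?thesis by (simp add: cohomology_def Q.gquot_simps)
  qed
  with Q.graded_weyl_module_gquot show ?thesis
    by (simp add: eulerian_of_exponent_def cohomology_def)
qed

end

lemma cohomology_map_hom:
  fixes C :: "nat \<Rightarrow> ('n::finite, 'k::field_char_0, 'v) weyl_gmodule"
    and C' :: "nat \<Rightarrow> ('n, 'k, 'w) weyl_gmodule"
  assumes "graded_complex C d" "graded_complex C' d'" "f \<in> gmodule_hom (C i) (C' i)"
    and cycles: "\<And>x. x \<in> carrier (C i) \<Longrightarrow> d i x = \<zero>\<^bsub>C (Suc i)\<^esub> \<Longrightarrow> d' i (f x) = \<zero>\<^bsub>C' (Suc i)\<^esub>"
    and boundaries: "\<And>x. x \<in> boundaries C d i \<Longrightarrow> f x \<in> boundaries C' d' i"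
  shows "gquot_map (C' i) (boundaries C' d' i) f \<in> gmodule_hom (cohomology C d i) (cohomology C' d' i)"
proof -
  interpret C: graded_complex C d by fact
  interpret C': graded_complex C' d' by fact
  have "f \<in> gmodule_hom (gsub (C i) (C.cycles i)) (gsub (C' i) (C'.cycles i))"
    by (rule gmodule_hom_gsub[OF assms(3)]) (use cycles gmodule_homD(2)[OF assms(3)] in auto)
  from gquot_map_hom[OF C.cohomology_quotient C'.cohomology_quotient this boundaries]
  show ?thesis by (simp add: cohomology_def)
qed

section \<open>Local cohomology of a resolution with contracted Euler endomorphism\<close>

text \<open>What injectivity provides for a resolution of a module killed by the Euler endomorphism: a
  contracting homotopy \<open>h\<close> that is linear over the Weyl algebra and therefore preserves supports.\<close>

locale contracted_resolution = graded_complex I d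
  for I :: "nat \<Rightarrow> ('n::finite, 'k::field_char_0, 'u) weyl_gmodule" and d +
  fixes h :: "nat \<Rightarrow> 'u \<Rightarrow> 'u" and a :: nat
  assumes h_hom: "h i \<in> gmodule_hom (I (Suc i)) (I i)"
    and contract_0: "x \<in> carrier (I 0) \<Longrightarrow> euler_endo a (I 0) x = h 0 (d 0 x)"
    and contract_Suc: "x \<in> carrier (I (Suc i)) \<Longrightarrow>
       euler_endo a (I (Suc i)) x = h (Suc i) (d (Suc i) x) \<oplus>\<^bsub>I (Suc i)\<^esub> d i (h i x)"
begin

sublocale I: graded_weyl_module "I i" for i
  by (rule module)

abbreviation sections :: "('n, 'k) mpoly set set \<Rightarrow> nat \<Rightarrow> 'u set" where
  "sections Y i \<equiv> sections_with_support Y (I i)"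

lemma sections_closed: "homogeneous_closed Y \<Longrightarrow> x \<in> sections Y i \<Longrightarrow> x \<in> carrier (I i)"
  using graded_submoduleD(1)[OF I.graded_submodule_sections] .

lemma sections_d: "homogeneous_closed Y \<Longrightarrow> x \<in> sections Y i \<Longrightarrow> d i x \<in> sections Y (Suc i)"
  by (rule sections_with_support_hom[OF module module d_hom])

lemma sections_h: "homogeneous_closed Y \<Longrightarrow> x \<in> sections Y (Suc i) \<Longrightarrow> h i x \<in> sections Y i"
  by (rule sections_with_support_hom[OF module module h_hom])

lemma \<Gamma>_simps [simp]:
  "carrier (\<Gamma> Y I i) = sections Y i" "zero (\<Gamma> Y I i) = zero (I i)" "add (\<Gamma> Y I i) = add (I i)"
  "smult (\<Gamma> Y I i) = smult (I i)" "hcomp (\<Gamma> Y I i) e = hcomp (I i) e \<inter> sections Y i"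
  "B +>\<^bsub>\<Gamma> Y I i\<^esub> x = B +>\<^bsub>I i\<^esub> x"
  by (simp_all add: \<Gamma>_def)

lemma \<Gamma>_module: "homogeneous_closed Y \<Longrightarrow> graded_weyl_module (\<Gamma> Y I i)"
  unfolding \<Gamma>_def by (rule graded_weyl_module_gsub[OF module I.graded_submodule_sections])

lemma \<Gamma>_complex:
  assumes "homogeneous_closed Y"
  shows "graded_complex (\<Gamma> Y I) d"
proof (rule graded_complex.intro)
  show "graded_weyl_module (\<Gamma> Y I i)" for i by (rule \<Gamma>_module[OF assms])
  show "d i \<in> gmodule_hom (\<Gamma> Y I i) (\<Gamma> Y I (Suc i))" for i
    unfolding \<Gamma>_def
    by (rule gmodule_hom_gsub[OF d_hom]) (use sections_closed[OF assms] sections_d[OF assms] in auto)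
  show "d (Suc i) (d i x) = \<zero>\<^bsub>\<Gamma> Y I (Suc (Suc i))\<^esub>" if "x \<in> carrier (\<Gamma> Y I i)" for i x
    using d_d[OF sections_closed[OF assms]] that by simp
qed

text \<open>On a cocycle \<open>x\<close> the homotopy formula reduces to \<open>d (h x)\<close>, and \<open>h x\<close> is again a section supported in
  \<open>Y\<close>.\<close>

lemma H_closed_eulerian:
  assumes Y: "homogeneous_closed Y"
  shows "eulerian_of_exponent a (H_closed Y I d i)"
proof -
  interpret G: graded_complex "\<Gamma> Y I" d by (rule \<Gamma>_complex[OF Y])
  show ?thesis
    unfolding H_closed_def
  proof (rule G.cohomology_eulerian)
    fix e x assume "x \<in> hcomp (\<Gamma> Y I i) e" and "d i x = \<zero>\<^bsub>\<Gamma> Y I (Suc i)\<^esub>"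
    then have x: "x \<in> hcomp (I i) e" "x \<in> sections Y i" "d i x = \<zero>\<^bsub>I (Suc i)\<^esub>" by simp_all
    note xI = sections_closed[OF Y x(2)]
    have h0: "h i (d i x) = \<zero>\<^bsub>I i\<^esub>"
      using x(3) gmodule_hom_zero[OF module module h_hom] by simp
    have "euler_endo a (I i) x \<in> boundaries (\<Gamma> Y I) d i"
    proof (cases i)
      case 0
      then show ?thesis using h0 contract_0 xI by (simp add: G.boundaries_0)
    next
      case (Suc j)
      with x(2) have "h j x \<in> sections Y j" using sections_h[OF Y] by simp
      moreover from this have "d j (h j x) \<in> carrier (I i)"
        using sections_closed[OF Y sections_d[OF Y]] Suc by simp
      ultimately show ?thesis
        using Suc h0 contract_Suc[of x j] xI by (simp add: G.boundaries_Suc)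
    qed
    then show "euler_power a e \<odot>\<^bsub>\<Gamma> Y I i\<^esub> x \<in> boundaries (\<Gamma> Y I) d i"
      using I.euler_endo_homogeneous[OF x(1)] by simp
  qed
qed

end

locale contracted_resolution_pair = contracted_resolution I d h a
  for I :: "nat \<Rightarrow> ('n::finite, 'k::field_char_0, 'u) weyl_gmodule" and d h a +
  fixes Y'' Y' :: "('n, 'k) mpoly set set"
  assumes Y'': "homogeneous_closed Y''" and Y': "homogeneous_closed Y'" and subset: "Y' \<subseteq> Y''"
begin

lemma sections_subset: "sections Y' i \<subseteq> sections Y'' i"
  by (rule I.sections_with_support_mono[OF Y'' Y' subset])

lemma quotient: "graded_quotient (\<Gamma> Y'' I i) (sections Y' i)"
proof -
  have "graded_submodule (\<Gamma> Y'' I i) (sections Y' i)"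
    unfolding \<Gamma>_def
    by (rule graded_submodule_gsub[OF module I.graded_submodule_sections[OF Y'']
          I.graded_submodule_sections[OF Y'] sections_subset])
  then show ?thesis
    using \<Gamma>_module[OF Y''] by (simp add: graded_quotient_def graded_quotient_axioms_def)
qed

sublocale Q: graded_quotient "\<Gamma> Y'' I i" "sections Y' i" for i
  by (rule quotient)

sublocale G': graded_complex "\<Gamma> Y' I" d
  by (rule \<Gamma>_complex[OF Y'])

sublocale G'': graded_complex "\<Gamma> Y'' I" d
  by (rule \<Gamma>_complex[OF Y''])

lemma \<Gamma>_quot_eq: "\<Gamma>_quot Y'' Y' I i = gquot (\<Gamma> Y'' I i) (sections Y' i)"
  by (simp add: \<Gamma>_quot_def)

lemma d_quot_hom: "d_quot Y'' Y' I d i \<in> gmodule_hom (\<Gamma>_quot Y'' Y' I i) (\<Gamma>_quot Y'' Y' I (Suc i))"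
  using gquot_map_hom[OF quotient quotient G''.d_hom sections_d[OF Y']]
  by (simp add: \<Gamma>_quot_eq d_quot_def)

lemma d_quot_coset:
  "x \<in> sections Y'' i \<Longrightarrow> d_quot Y'' Y' I d i (sections Y' i +>\<^bsub>I i\<^esub> x) = sections Y' (Suc i) +>\<^bsub>I (Suc i)\<^esub> d i x"
  using gquot_map_coset[OF quotient quotient G''.d_hom sections_d[OF Y']] by (simp add: d_quot_def)

lemma \<Gamma>_quot_carrierE:
  assumes "z \<in> carrier (\<Gamma>_quot Y'' Y' I i)"
  obtains x where "x \<in> sections Y'' i" "z = sections Y' i +>\<^bsub>I i\<^esub> x"
  using Q.gquot_carrierE[of z i] assms by (auto simp: \<Gamma>_quot_eq)

lemma \<Gamma>_quot_zero: "\<zero>\<^bsub>\<Gamma>_quot Y'' Y' I i\<^esub> = sections Y' i"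
  by (simp add: \<Gamma>_quot_eq Q.gquot_simps)

lemma coset_eq_zero_iff:
  "x \<in> sections Y'' i \<Longrightarrow> sections Y' i +>\<^bsub>I i\<^esub> x = sections Y' i \<longleftrightarrow> x \<in> sections Y' i"
  using Q.coset_eq_zero_iff[of x i] by simp

sublocale GQ: graded_complex "\<Gamma>_quot Y'' Y' I" "d_quot Y'' Y' I d"
proof (rule graded_complex.intro)
  show "graded_weyl_module (\<Gamma>_quot Y'' Y' I i)" for i
    unfolding \<Gamma>_quot_eq by (rule Q.graded_weyl_module_gquot)
  show "d_quot Y'' Y' I d i \<in> gmodule_hom (\<Gamma>_quot Y'' Y' I i) (\<Gamma>_quot Y'' Y' I (Suc i))" for i
    by (rule d_quot_hom)
  show "d_quot Y'' Y' I d (Suc i) (d_quot Y'' Y' I d i z) = \<zero>\<^bsub>\<Gamma>_quot Y'' Y' I (Suc (Suc i))\<^esub>"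
    if z: "z \<in> carrier (\<Gamma>_quot Y'' Y' I i)" for i z
  proof -
    obtain x where x: "x \<in> sections Y'' i" "z = sections Y' i +>\<^bsub>I i\<^esub> x" using \<Gamma>_quot_carrierE[OF z] .
    then show ?thesis
      using d_d[OF sections_closed[OF Y'' x(1)]] coset_eq_zero_iff[of "\<zero>\<^bsub>I (Suc (Suc i))\<^esub>" "Suc (Suc i)"]
        graded_submoduleD(2)[OF I.graded_submodule_sections[OF Y']]
        graded_submoduleD(2)[OF I.graded_submodule_sections[OF Y'']]
      by (simp add: d_quot_coset sections_d[OF Y''] \<Gamma>_quot_zero)
  qed
qed

text \<open>A cocycle modulo \<open>\<Gamma>\<^sub>Y\<^sub>'\<close> is represented by \<open>x\<close> with \<open>d x\<close> supported in \<open>Y'\<close>. Then \<open>h (d x)\<close> is also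
  supported in \<open>Y'\<close>, so that modulo \<open>\<Gamma>\<^sub>Y\<^sub>'\<close> only the boundary \<open>d (h x)\<close> remains of the homotopy formula.\<close>

lemma H_locally_closed_eulerian: "eulerian_of_exponent a (H_locally_closed Y'' Y' I d i)"
  unfolding H_locally_closed_def
proof (rule GQ.cohomology_eulerian)
  fix e z assume "z \<in> hcomp (\<Gamma>_quot Y'' Y' I i) e"
    and dz: "d_quot Y'' Y' I d i z = \<zero>\<^bsub>\<Gamma>_quot Y'' Y' I (Suc i)\<^esub>"
  then obtain x where x: "x \<in> hcomp (I i) e" "x \<in> sections Y'' i" "z = sections Y' i +>\<^bsub>I i\<^esub> x"
    by (auto simp: \<Gamma>_quot_eq Q.gquot_simps)
  from dz x have dx: "d i x \<in> sections Y' (Suc i)"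
    by (simp add: d_quot_coset \<Gamma>_quot_zero coset_eq_zero_iff sections_d[OF Y''])
  note hdx = sections_h[OF Y' dx] and xI = sections_closed[OF Y'' x(2)]
  have z: "euler_power a e \<odot>\<^bsub>\<Gamma>_quot Y'' Y' I i\<^esub> z = sections Y' i +>\<^bsub>I i\<^esub> euler_endo a (I i) x"
    using Q.gquot_act[OF weyl_homogeneous_closed[OF euler_power_homogeneous], of x i e a] x
    by (simp add: \<Gamma>_quot_eq I.euler_endo_homogeneous[OF x(1)])
  show "euler_power a e \<odot>\<^bsub>\<Gamma>_quot Y'' Y' I i\<^esub> z \<in> boundaries (\<Gamma>_quot Y'' Y' I) (d_quot Y'' Y' I d) i"
  proof (cases i)
    case 0
    with hdx have "euler_endo a (I i) x \<in> sections Y' i" using contract_0 xI by simp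
    then show ?thesis
      unfolding z using 0 coset_eq_zero_iff sections_subset by (auto simp: GQ.boundaries_0 \<Gamma>_quot_zero)
  next
    case (Suc j)
    from x(2) Suc have hx: "h j x \<in> sections Y'' j" using sections_h[OF Y''] by simp
    have "sections Y' i +>\<^bsub>I i\<^esub> euler_endo a (I i) x = sections Y' i +>\<^bsub>I i\<^esub> d j (h j x)"
      using Q.coset_absorb[OF hdx, of "d j (h j x)"] sections_d[OF Y'' hx] contract_Suc[of x j] xI Suc
      by simp
    also have "\<dots> = d_quot Y'' Y' I d j (sections Y' j +>\<^bsub>I j\<^esub> h j x)"
      using d_quot_coset[OF hx] Suc by simp
    finally have "euler_power a e \<odot>\<^bsub>\<Gamma>_quot Y'' Y' I i\<^esub> z = d_quot Y'' Y' I d j (sections Y' j +>\<^bsub>I j\<^esub> h j x)"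
      unfolding z .
    then show ?thesis
      using Suc hx by (auto simp: GQ.boundaries_Suc \<Gamma>_quot_eq Q.gquot_simps)
  qed
qed

subsection \<open>The arrows of the long exact sequence\<close>

lemma boundaries_subset: "boundaries (\<Gamma> Y' I) d i \<subseteq> boundaries (\<Gamma> Y'' I) d i"
  using sections_subset by (cases i) (auto simp: G'.boundaries_0 G''.boundaries_0 G'.boundaries_Suc G''.boundaries_Suc)

lemma arrow_incl_hom: "arrow_incl Y'' Y' I d i \<in> gmodule_hom (H_closed Y' I d i) (H_closed Y'' I d i)"
  unfolding arrow_incl_def H_closed_def
proof (rule cohomology_map_hom[OF G'.graded_complex_axioms G''.graded_complex_axioms])
  show "id \<in> gmodule_hom (\<Gamma> Y' I i) (\<Gamma> Y'' I i)"
    using sections_subset by (intro gmodule_homI) auto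
qed (use boundaries_subset in auto)

lemma arrow_proj_hom:
  "arrow_proj Y'' Y' I d i \<in> gmodule_hom (H_closed Y'' I d i) (H_locally_closed Y'' Y' I d i)"
  unfolding arrow_proj_def H_closed_def H_locally_closed_def
proof (rule cohomology_map_hom[OF G''.graded_complex_axioms GQ.graded_complex_axioms])
  show "(\<lambda>x. carrier (\<Gamma> Y' I i) +>\<^bsub>\<Gamma> Y'' I i\<^esub> x) \<in> gmodule_hom (\<Gamma> Y'' I i) (\<Gamma>_quot Y'' Y' I i)"
    using Q.coset_hom by (simp add: \<Gamma>_quot_eq)
  have zero: "sections Y' i +>\<^bsub>I i\<^esub> \<zero>\<^bsub>I i\<^esub> = sections Y' i" for i
    using coset_eq_zero_iff[of "\<zero>\<^bsub>I i\<^esub>" i] graded_submoduleD(2)[OF I.graded_submodule_sections[OF Y']]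
      graded_submoduleD(2)[OF I.graded_submodule_sections[OF Y'']] by simp
  show "d_quot Y'' Y' I d i (carrier (\<Gamma> Y' I i) +>\<^bsub>\<Gamma> Y'' I i\<^esub> x) = \<zero>\<^bsub>\<Gamma>_quot Y'' Y' I (Suc i)\<^esub>"
    if "x \<in> carrier (\<Gamma> Y'' I i)" "d i x = \<zero>\<^bsub>\<Gamma> Y'' I (Suc i)\<^esub>" for x
    using that by (simp add: d_quot_coset \<Gamma>_quot_zero zero)
  show "carrier (\<Gamma> Y' I i) +>\<^bsub>\<Gamma> Y'' I i\<^esub> x \<in> boundaries (\<Gamma>_quot Y'' Y' I) (d_quot Y'' Y' I d) i"
    if "x \<in> boundaries (\<Gamma> Y'' I) d i" for x
  proof (cases i)
    case 0
    then show ?thesis using that by (simp add: G''.boundaries_0 GQ.boundaries_0 \<Gamma>_quot_zero zero)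
  next
    case (Suc j)
    with that obtain y where y: "y \<in> sections Y'' j" "x = d j y" by (auto simp: G''.boundaries_Suc)
    then have "carrier (\<Gamma> Y' I i) +>\<^bsub>\<Gamma> Y'' I i\<^esub> x = d_quot Y'' Y' I d j (sections Y' j +>\<^bsub>I j\<^esub> y)"
      using Suc by (simp add: d_quot_coset)
    then show ?thesis using Suc y(1) by (auto simp: GQ.boundaries_Suc \<Gamma>_quot_eq Q.gquot_simps)
  qed
qed

abbreviation class_closed :: "nat \<Rightarrow> 'u \<Rightarrow> 'u set" where
  "class_closed i x \<equiv> boundaries (\<Gamma> Y' I) d i +>\<^bsub>I i\<^esub> x"

abbreviation class_locally_closed :: "nat \<Rightarrow> 'u \<Rightarrow> 'u set set" where
  "class_locally_closed i x \<equiv> boundaries (\<Gamma>_quot Y'' Y' I) (d_quot Y'' Y' I d) i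
     +>\<^bsub>\<Gamma>_quot Y'' Y' I i\<^esub> (sections Y' i +>\<^bsub>I i\<^esub> x)"

text \<open>The connecting map does not depend on representatives: changing the coset by a boundary
  changes \<open>x\<close> by a boundary, on which \<open>d\<close> vanishes, and changing \<open>x\<close> within its coset by a section
  supported in \<open>Y'\<close> changes \<open>d x\<close> by a boundary.\<close>

lemma arrow_conn_class:
  assumes x: "x \<in> sections Y'' i" "d i x \<in> sections Y' (Suc i)"
  shows "arrow_conn Y'' Y' I d i (class_locally_closed i x) = class_closed (Suc i) (d i x)"
proof -
  interpret H: graded_quotient "gsub (\<Gamma> Y' I (Suc i)) (G'.cycles (Suc i))" "boundaries (\<Gamma> Y' I) d (Suc i)"
    by (rule G'.cohomology_quotient)
  interpret HQ: graded_quotient "gsub (\<Gamma>_quot Y'' Y' I i) (GQ.cycles i)"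
      "boundaries (\<Gamma>_quot Y'' Y' I) (d_quot Y'' Y' I d) i"
    by (rule GQ.cohomology_quotient)
  note xI = sections_closed[OF Y'' x(1)] and dD = gmodule_homD[OF d_hom]
  have cycle: "d i x \<in> carrier (gsub (\<Gamma> Y' I (Suc i)) (G'.cycles (Suc i)))"
    using x(2) d_d[OF xI] by simp
  have independent: "class_closed (Suc i) (d i y) = class_closed (Suc i) (d i x)"
    if z: "z \<in> class_locally_closed i x" and y: "y \<in> z" for z y
  proof -
    from z obtain b where b: "b \<in> boundaries (\<Gamma>_quot Y'' Y' I) (d_quot Y'' Y' I d) i"
      "z = b \<oplus>\<^bsub>\<Gamma>_quot Y'' Y' I i\<^esub> (sections Y' i +>\<^bsub>I i\<^esub> x)"
      by (auto simp: a_r_coset_def')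
    have "\<exists>b0\<in>sections Y'' i. d i b0 = \<zero>\<^bsub>I (Suc i)\<^esub> \<and> b = sections Y' i +>\<^bsub>I i\<^esub> b0"
    proof (cases i)
      case 0
      have zero: "\<zero>\<^bsub>I i\<^esub> \<in> sections Y' i" "\<zero>\<^bsub>I i\<^esub> \<in> sections Y'' i"
        using graded_submoduleD(2)[OF I.graded_submodule_sections] Y' Y'' by auto
      from b(1) 0 have "b = sections Y' i +>\<^bsub>I i\<^esub> \<zero>\<^bsub>I i\<^esub>"
        using coset_eq_zero_iff[OF zero(2)] zero(1) by (simp add: GQ.boundaries_0 \<Gamma>_quot_zero)
      with zero(2) d_zero[of i] show ?thesis by blast
    next
      case (Suc j)
      with b(1) obtain w where "w \<in> carrier (\<Gamma>_quot Y'' Y' I j)" "b = d_quot Y'' Y' I d j w"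
        by (auto simp: GQ.boundaries_Suc)
      moreover from this(1) obtain v where v: "v \<in> sections Y'' j" "w = sections Y' j +>\<^bsub>I j\<^esub> v"
        using \<Gamma>_quot_carrierE by metis
      ultimately have "b = sections Y' i +>\<^bsub>I i\<^esub> d j v" using Suc by (simp add: d_quot_coset)
      moreover have "d j v \<in> sections Y'' i" using sections_d[OF Y'' v(1)] Suc by simp
      moreover have "d i (d j v) = \<zero>\<^bsub>I (Suc i)\<^esub>" using d_d[OF sections_closed[OF Y'' v(1)]] Suc by simp
      ultimately show ?thesis by blast
    qed
    then obtain b0 where b0: "b0 \<in> sections Y'' i" "d i b0 = \<zero>\<^bsub>I (Suc i)\<^esub>"
      "b = sections Y' i +>\<^bsub>I i\<^esub> b0" by blast
    note b0I = sections_closed[OF Y'' b0(1)]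
    have "z = sections Y' i +>\<^bsub>I i\<^esub> (b0 \<oplus>\<^bsub>I i\<^esub> x)"
      using b(2) b0 x(1) Q.gquot_simps(3)[of b0 i x] by (simp add: \<Gamma>_quot_eq)
    with y obtain s where s: "s \<in> sections Y' i" "y = s \<oplus>\<^bsub>I i\<^esub> (b0 \<oplus>\<^bsub>I i\<^esub> x)"
      by (auto simp: a_r_coset_def')
    note sI = sections_closed[OF Y' s(1)]
    have "d i y = d i s \<oplus>\<^bsub>I (Suc i)\<^esub> d i x"
      using s(2) b0(2) sI b0I xI dD(2)[OF xI] by (simp add: dD(3))
    moreover have "d i s \<in> boundaries (\<Gamma> Y' I) d (Suc i)"
      using s(1) by (simp add: G'.boundaries_Suc)
    ultimately show ?thesis
      using H.coset_absorb[OF _ cycle] by simp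
  qed
  have x_mem: "x \<in> sections Y' i +>\<^bsub>I i\<^esub> x"
    using Q.coset_self[of x i] x(1) by simp
  have cycleQ: "sections Y' i +>\<^bsub>I i\<^esub> x \<in> GQ.cycles i"
    using x coset_eq_zero_iff[OF sections_d[OF Y'' x(1)]]
    by (auto simp: d_quot_coset \<Gamma>_quot_zero) (auto simp: \<Gamma>_quot_eq Q.gquot_simps)
  have class_mem: "sections Y' i +>\<^bsub>I i\<^esub> x \<in> class_locally_closed i x"
    using HQ.coset_self[of "sections Y' i +>\<^bsub>I i\<^esub> x"] cycleQ by simp
  have "arrow_conn Y'' Y' I d i (class_locally_closed i x) =
      (\<Union>y\<in>\<Union>(class_locally_closed i x). class_closed (Suc i) (d i y))"
    by (simp add: arrow_conn_def gquot_map_def)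
  also have "\<dots> = class_closed (Suc i) (d i x)"
    by (rule UN_eq_common_value[of x]) (use x_mem class_mem independent in blast)+
  finally show ?thesis .
qed

lemma arrow_conn_hom:
  "arrow_conn Y'' Y' I d i \<in> gmodule_hom (H_locally_closed Y'' Y' I d i) (H_closed Y' I d (Suc i))"
proof -
  interpret H: graded_quotient "gsub (\<Gamma> Y' I (Suc i)) (G'.cycles (Suc i))" "boundaries (\<Gamma> Y' I) d (Suc i)"
    by (rule G'.cohomology_quotient)
  interpret HQ: graded_quotient "gsub (\<Gamma>_quot Y'' Y' I i) (GQ.cycles i)"
      "boundaries (\<Gamma>_quot Y'' Y' I) (d_quot Y'' Y' I d) i"
    by (rule GQ.cohomology_quotient)
  let ?H = "H_closed Y' I d (Suc i)" and ?L = "H_locally_closed Y'' Y' I d i"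
  let ?rep = "{x\<in>sections Y'' i. d i x \<in> sections Y' (Suc i)}"
  note dD = gmodule_homD[OF d_hom]
  have H: "?H = gquot (gsub (\<Gamma> Y' I (Suc i)) (G'.cycles (Suc i))) (boundaries (\<Gamma> Y' I) d (Suc i))"
    and L: "?L = gquot (gsub (\<Gamma>_quot Y'' Y' I i) (GQ.cycles i)) (boundaries (\<Gamma>_quot Y'' Y' I) (d_quot Y'' Y' I d) i)"
    by (simp_all add: H_closed_def H_locally_closed_def cohomology_def)
  \<comment> \<open>Classes of \<open>H\<^sup>i\<^sub>Y\<close> are represented by the sections \<open>x\<close> supported in \<open>Y''\<close> with \<open>d x\<close> supported in \<open>Y'\<close>.\<close>
  have cycle: "d i x \<in> G'.cycles (Suc i)" if "x \<in> ?rep" for x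
    using that d_d[OF sections_closed[OF Y'']] by simp
  have rep_iff: "sections Y' i +>\<^bsub>I i\<^esub> x \<in> GQ.cycles i \<longleftrightarrow> x \<in> ?rep" if "x \<in> sections Y'' i" for x
    using that coset_eq_zero_iff[OF sections_d[OF Y'' that]]
    by (auto simp: d_quot_coset \<Gamma>_quot_zero) (auto simp: \<Gamma>_quot_eq Q.gquot_simps)
  have rep: "\<exists>x\<in>?rep. Z = class_locally_closed i x" if "Z \<in> carrier ?L" for Z
  proof -
    from that obtain z where z: "z \<in> GQ.cycles i"
      "Z = boundaries (\<Gamma>_quot Y'' Y' I) (d_quot Y'' Y' I d) i +>\<^bsub>\<Gamma>_quot Y'' Y' I i\<^esub> z"
      unfolding L HQ.gquot_simps(1) by auto
    from z(1) obtain x where x: "x \<in> sections Y'' i" "z = sections Y' i +>\<^bsub>I i\<^esub> x"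
      using \<Gamma>_quot_carrierE by auto
    then show ?thesis using z rep_iff[OF x(1)] by blast
  qed
  have conn: "arrow_conn Y'' Y' I d i (class_locally_closed i x) = class_closed (Suc i) (d i x)"
    if "x \<in> ?rep" for x
    by (rule arrow_conn_class) (use that in auto)
  have repI: "x \<in> ?rep \<Longrightarrow> x \<in> carrier (I i)" for x using sections_closed[OF Y''] by auto
  have class_carrier: "class_closed (Suc i) y \<in> carrier ?H" if "y \<in> G'.cycles (Suc i)" for y
    unfolding H H.gquot_simps(1) by (rule image_eqI[of _ _ y]) (use that in simp_all)
  have class_hcomp: "class_closed (Suc i) y \<in> hcomp ?H e"
    if "y \<in> G'.cycles (Suc i)" "y \<in> hcomp (I (Suc i)) e" for y e
    unfolding H H.gquot_simps(4) by (rule image_eqI[of _ _ y]) (use that in simp_all)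
  show ?thesis
  proof (rule gmodule_homI)
    fix Z assume "Z \<in> carrier ?L"
    then obtain x where x: "x \<in> ?rep" "Z = class_locally_closed i x" using rep by blast
    then show "arrow_conn Y'' Y' I d i Z \<in> carrier ?H"
      using class_carrier[OF cycle[OF x(1)]] by (simp only: conn)
  next
    fix Z W assume "Z \<in> carrier ?L" "W \<in> carrier ?L"
    then have "\<exists>x\<in>?rep. Z = class_locally_closed i x" "\<exists>y\<in>?rep. W = class_locally_closed i y"
      by (blast intro: rep)+
    then obtain x y where x: "x \<in> ?rep" "Z = class_locally_closed i x"
      and y: "y \<in> ?rep" "W = class_locally_closed i y" by blast
    have xy: "x \<oplus>\<^bsub>I i\<^esub> y \<in> ?rep"
      using x(1) y(1) graded_submoduleD(3)[OF I.graded_submodule_sections] Y' Y'' repI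
      by (simp add: dD(3))
    have "Z \<oplus>\<^bsub>?L\<^esub> W = class_locally_closed i (x \<oplus>\<^bsub>I i\<^esub> y)"
      using x y HQ.gquot_simps(3)[of "sections Y' i +>\<^bsub>I i\<^esub> x" "sections Y' i +>\<^bsub>I i\<^esub> y"]
        rep_iff Q.gquot_simps(3)[of x i y]
      by (simp add: L \<Gamma>_quot_eq)
    moreover have "class_closed (Suc i) (d i x) \<oplus>\<^bsub>?H\<^esub> class_closed (Suc i) (d i y) = class_closed (Suc i) (d i (x \<oplus>\<^bsub>I i\<^esub> y))"
      using H.gquot_simps(3)[of "d i x" "d i y"] cycle[OF x(1)] cycle[OF y(1)] repI x(1) y(1)
      by (simp add: H dD(3))
    ultimately show "arrow_conn Y'' Y' I d i (Z \<oplus>\<^bsub>?L\<^esub> W) = arrow_conn Y'' Y' I d i Z \<oplus>\<^bsub>?H\<^esub> arrow_conn Y'' Y' I d i W"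
      using x y xy by (simp only: conn)
  next
    fix b :: "('n, 'k) operator" and Z assume b: "b \<in> weyl_carrier" and "Z \<in> carrier ?L"
    then obtain x where x: "x \<in> ?rep" "Z = class_locally_closed i x" using rep by blast
    have bx: "b \<odot>\<^bsub>I i\<^esub> x \<in> ?rep"
      using x(1) b graded_submoduleD(4)[OF I.graded_submodule_sections] Y' Y'' repI
      by (simp flip: dD(4)) (simp add: dD(4))
    have "b \<odot>\<^bsub>?L\<^esub> Z = class_locally_closed i (b \<odot>\<^bsub>I i\<^esub> x)"
      using x HQ.gquot_act[OF b, of "sections Y' i +>\<^bsub>I i\<^esub> x"] rep_iff Q.gquot_act[OF b, of x i]
      by (simp add: L \<Gamma>_quot_eq)
    moreover have "b \<odot>\<^bsub>?H\<^esub> class_closed (Suc i) (d i x) = class_closed (Suc i) (d i (b \<odot>\<^bsub>I i\<^esub> x))"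
      using H.gquot_act[OF b, of "d i x"] cycle[OF x(1)] repI[OF x(1)] b
      by (simp add: H dD(4))
    ultimately show "arrow_conn Y'' Y' I d i (b \<odot>\<^bsub>?L\<^esub> Z) = b \<odot>\<^bsub>?H\<^esub> arrow_conn Y'' Y' I d i Z"
      using x bx by (simp only: conn)
  next
    fix e Z assume "Z \<in> hcomp ?L e"
    then obtain z where z: "z \<in> hcomp (\<Gamma>_quot Y'' Y' I i) e" "z \<in> GQ.cycles i"
      "Z = boundaries (\<Gamma>_quot Y'' Y' I) (d_quot Y'' Y' I d) i +>\<^bsub>\<Gamma>_quot Y'' Y' I i\<^esub> z"
      unfolding L HQ.gquot_simps(4) by auto
    from z(1) obtain x where x: "x \<in> hcomp (I i) e" "x \<in> sections Y'' i" "z = sections Y' i +>\<^bsub>I i\<^esub> x"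
      by (auto simp: \<Gamma>_quot_eq Q.gquot_simps)
    with z(2) have rep_x: "x \<in> ?rep" using rep_iff[OF x(2)] by blast
    show "arrow_conn Y'' Y' I d i Z \<in> hcomp ?H e"
      unfolding z(3) x(3) conn[OF rep_x] by (rule class_hcomp[OF cycle[OF rep_x] dD(5)[OF x(1)]])
  qed
qed

end

section \<open>Graded Lyubeznik functors\<close>

lemma is_part_eulerian:
  assumes "f \<in> gmodule_hom M N" "eulerian_of_exponent a M" "eulerian_of_exponent a N" "is_part p f M N W"
  shows "eulerian_of_exponent a W"
proof -
  have M: "graded_weyl_module M" and N: "graded_weyl_module N"
    using assms(2,3) by (simp_all add: eulerian_of_exponent_def)
  show ?thesis
  proof (cases p)
    case Kernel
    then show ?thesis
      using eulerian_iso[OF eulerian_gsub[OF assms(2) graded_submodule_kernel[OF M N assms(1)]]] assms(4) by simp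
  next
    case Image
    then show ?thesis
      using eulerian_iso[OF eulerian_gsub[OF assms(3) graded_submodule_image[OF M N assms(1)]]] assms(4) by simp
  next
    case Cokernel
    then show ?thesis
      using eulerian_iso[OF eulerian_gquot[OF assms(3) graded_submodule_image[OF M N assms(1)]]] assms(4) by simp
  qed
qed

lemma step_value_eulerian:
  fixes M :: "('n::finite, 'k::field_char_0, 'v) weyl_gmodule" and W :: "('n, 'k, 'u) weyl_gmodule"
  assumes "valid_step s" "eulerian_of_exponent a M" "step_value s M W"
  shows "eulerian_of_exponent a W"
proof -
  obtain \<epsilon> :: "'v \<Rightarrow> 'u" and I d where res: "graded_injective_resolution M \<epsilon> I d"
    and step: "step_on_resolution s I d W"
    using assms(3) unfolding step_value_def by blast
  obtain h where h: "\<And>i. h i \<in> gmodule_hom (I (Suc i)) (I i)"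
    "\<And>x. x \<in> carrier (I 0) \<Longrightarrow> euler_endo a (I 0) x = h 0 (d 0 x)"
    "\<And>i x. x \<in> carrier (I (Suc i)) \<Longrightarrow>
       euler_endo a (I (Suc i)) x = h (Suc i) (d (Suc i) x) \<oplus>\<^bsub>I (Suc i)\<^esub> d i (h i x)"
    using euler_endo_null_homotopic[OF res assms(2)] by blast
  have complex: "graded_weyl_module (I i)" "d i \<in> gmodule_hom (I i) (I (Suc i))"
    and exact: "d i ` carrier (I i) = {x\<in>carrier (I (Suc i)). d (Suc i) x = \<zero>\<^bsub>I (Suc (Suc i))\<^esub>}" for i
    using res by (simp_all add: graded_injective_resolution_def graded_injective_def)
  have dd: "d (Suc i) (d i x) = \<zero>\<^bsub>I (Suc (Suc i))\<^esub>" if "x \<in> carrier (I i)" for i x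
    using exact[of i] that by blast
  interpret contracted_resolution I d h a
    by (intro contracted_resolution.intro graded_complex.intro contracted_resolution_axioms.intro)
      (fact complex dd h)+
  show ?thesis
  proof (cases s)
    case (Closed i Y)
    then show ?thesis using eulerian_iso[OF H_closed_eulerian[of Y i]] step assms(1) by simp
  next
    case (Locally_Closed i Y'' Y')
    then interpret contracted_resolution_pair I d h a Y'' Y'
      using assms(1) by unfold_locales auto
    show ?thesis using eulerian_iso[OF H_locally_closed_eulerian[of i]] step Locally_Closed by simp
  next
    case (Part p q i Y'' Y')
    then interpret contracted_resolution_pair I d h a Y'' Y'
      using assms(1) by unfold_locales auto
    show ?thesis
    proof (cases q)
      case Incl
      then show ?thesis
        using is_part_eulerian[OF arrow_incl_hom H_closed_eulerian[OF Y'] H_closed_eulerian[OF Y'']] step Part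
        by simp
    next
      case Proj
      then show ?thesis
        using is_part_eulerian[OF arrow_proj_hom H_closed_eulerian[OF Y''] H_locally_closed_eulerian] step Part
        by simp
    next
      case Conn
      then show ?thesis
        using is_part_eulerian[OF arrow_conn_hom H_locally_closed_eulerian H_closed_eulerian[OF Y']] step Part
        by simp
    qed
  qed
qed

lemma poly_gmodule_simps:
  "carrier poly_gmodule = UNIV" "zero poly_gmodule = 0" "add poly_gmodule = (+)"
  "smult poly_gmodule = (\<lambda>a p. a p)" "hcomp poly_gmodule = homogeneous_polys"
  by (simp_all add: poly_gmodule_def)

definition component :: "int \<Rightarrow> ('n::finite, 'k::field_char_0) mpoly \<Rightarrow> ('n, 'k) mpoly" where
  "component e p = (\<Sum>m | m \<in> Poly_Mapping.keys p \<and> mdegree m = e.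
     Poly_Mapping.single m (Poly_Mapping.lookup p m))"

lemma lookup_component:
  "Poly_Mapping.lookup (component e p) m = (if mdegree m = e then Poly_Mapping.lookup p m else 0)"
  unfolding component_def
  by (auto simp: lookup_sum lookup_single when_def in_keys_iff)

lemma component_homogeneous: "component e p \<in> homogeneous_polys e"
  by (auto simp: homogeneous_polys_def in_keys_iff lookup_component simp del: of_nat_sum split: if_splits)

lemma component_of_homogeneous:
  assumes "p \<in> homogeneous_polys e'"
  shows "component e p = (if e = e' then p else 0)"
  using assms by (intro poly_mapping_eqI)
    (auto simp: homogeneous_polys_def in_keys_iff lookup_component simp del: of_nat_sum)

lemma component_sum: "component e (sum f A) = (\<Sum>x\<in>A. component e (f x))"
  by (rule poly_mapping_eqI) (simp add: lookup_component lookup_sum)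

lemma poly_gmodule_graded: "graded_weyl_module (poly_gmodule :: ('n::finite, 'k::field_char_0, _) weyl_gmodule)"
proof -
  let ?P = "poly_gmodule :: ('n, 'k, ('n, 'k) mpoly) weyl_gmodule"
  have group: "abelian_group ?P"
    by (rule abelian_groupI) (auto simp: poly_gmodule_simps algebra_simps intro: exI[of _ "- x" for x])
  then interpret P: abelian_group ?P .
  have module: "left_module weyl ?P"
    by (intro left_module.intro left_module_axioms.intro weyl_ring group)
      (simp_all add: poly_gmodule_simps weyl_additive)
  have inv: "inv\<^bsub>add_monoid ?P\<^esub> p = - p" for p
    using P.minus_equality[of "- p" p] by (simp add: a_inv_def poly_gmodule_simps)
  have finsum: "(\<Oplus>\<^bsub>?P\<^esub>e\<in>A. c e) = (\<Sum>e\<in>A. c e)" if "finite A" for A :: "int set" and c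
    using that
  proof (induction A rule: finite_induct)
    case (insert e A)
    then show ?case using P.finsum_insert[of A e c] by (simp add: poly_gmodule_simps)
  qed (simp add: poly_gmodule_simps)
  show ?thesis
  proof (intro graded_weyl_module.intro module graded_weyl_module_axioms.intro)
    show "additive_subgroup (hcomp ?P e) ?P" for e
    proof (intro additive_subgroup.intro subgroup.intro, unfold inv)
      show "- p \<in> hcomp ?P e" if "p \<in> hcomp ?P e" for p
        using that by (simp add: poly_gmodule_simps homogeneous_polys_def in_keys_iff)
    qed (auto simp: poly_gmodule_simps homogeneous_polys_0 homogeneous_polys_add)
  next
    show "a \<odot>\<^bsub>?P\<^esub> p \<in> hcomp ?P (e + e')" if "weyl_homogeneous e a" "p \<in> hcomp ?P e'" for e e' a p
      using that weyl_homogeneous_polys by (simp add: poly_gmodule_simps)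
  next
    fix p :: "('n, 'k) mpoly"
    have supp: "{e. component e p \<noteq> 0} \<subseteq> mdegree ` Poly_Mapping.keys p"
    proof
      fix e assume "e \<in> {e. component e p \<noteq> 0}"
      then obtain m where "Poly_Mapping.lookup (component e p) m \<noteq> 0"
        by (metis (mono_tags) lookup_zero mem_Collect_eq poly_mapping_eqI)
      then show "e \<in> mdegree ` Poly_Mapping.keys p"
        by (auto simp: lookup_component in_keys_iff split: if_splits)
    qed
    then have fin: "finite {e. component e p \<noteq> 0}" by (rule finite_subset) simp
    have decomposition: "p = (\<Sum>e | component e p \<noteq> 0. component e p)"
    proof (rule poly_mapping_eqI)
      fix m
      have "Poly_Mapping.lookup (\<Sum>e | component e p \<noteq> 0. component e p) m =
          (if component (mdegree m) p \<noteq> 0 then Poly_Mapping.lookup p m else 0)"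
        using fin by (simp add: lookup_sum lookup_component)
      also have "\<dots> = Poly_Mapping.lookup p m"
        using lookup_component[of "mdegree m" p m] by auto
      finally show "Poly_Mapping.lookup p m = Poly_Mapping.lookup (\<Sum>e | component e p \<noteq> 0. component e p) m" ..
    qed
    have "c = (\<lambda>e. component e p)"
      if c: "\<And>e. c e \<in> homogeneous_polys e" and "finite {e. c e \<noteq> 0}" and p: "p = (\<Sum>e | c e \<noteq> 0. c e)" for c
    proof
      fix e
      have "component e p = (\<Sum>e' | c e' \<noteq> 0. component e (c e'))"
        unfolding p component_sum ..
      also have "\<dots> = (\<Sum>e' | c e' \<noteq> 0. if e' = e then c e else 0)"
        by (intro sum.cong) (auto simp: component_of_homogeneous[OF c])
      also have "\<dots> = c e" using \<open>finite {e. c e \<noteq> 0}\<close> by simp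
      finally show "c e = component e p" ..
    qed
    with fin decomposition show "\<exists>!c. (\<forall>e. c e \<in> hcomp ?P e) \<and> finite {e. c e \<noteq> \<zero>\<^bsub>?P\<^esub>} \<and>
        p = (\<Oplus>\<^bsub>?P\<^esub>e\<in>{e. c e \<noteq> \<zero>\<^bsub>?P\<^esub>}. c e)"
      by (intro ex1I[of _ "\<lambda>e. component e p"])
        (auto simp: finsum poly_gmodule_simps component_homogeneous)
  qed
qed

text \<open>This is Euler's identity.\<close>

lemma poly_gmodule_eulerian:
  "eulerian_of_exponent 1 (poly_gmodule :: ('n::finite, 'k::field_char_0, _) weyl_gmodule)"
proof -
  have "euler_power 1 e p = 0" if "p \<in> homogeneous_polys e" for e and p :: "('n, 'k) mpoly"
    using euler_homogeneous_poly[OF that] by (simp add: euler_minus_apply)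
  then show ?thesis
    using poly_gmodule_graded by (simp add: eulerian_of_exponent_def poly_gmodule_simps)
qed

lemma functor_value_eulerian:
  assumes "\<forall>s\<in>set T. valid_step s" "eulerian_of_exponent a M" "functor_value T M W"
  shows "eulerian_of_exponent a W"
  using assms
proof (induction T arbitrary: W)
  case Nil
  then show ?case using eulerian_iso by auto
next
  case (Cons s T)
  then show ?case using step_value_eulerian by fastforce
qed

theorem corollary3p10:
  fixes T :: "('n::finite, 'k::field_char_0) lyubeznik_step list"
    and W :: "('n, 'k, 'u) weyl_gmodule"
  assumes "graded_Lyubeznik_functor T"
    and "functor_value T poly_gmodule W"
  shows "strongly_generalized_Eulerian W"
proof -
  have "eulerian_of_exponent 1 W"
    using functor_value_eulerian[OF _ poly_gmodule_eulerian assms(2)] assms(1)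
    by (simp add: graded_Lyubeznik_functor_def)
  then show ?thesis
    unfolding strongly_generalized_Eulerian_iff by (intro exI[of _ 1]) simp
qed

end
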